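(* Let $d\ge 2$. There exist positive constants $\varepsilon$, $c$ and $C$ such that for every $x\in\mathbb{Z}^d$, $$\mathbb{P}\Big(c|x|_1\le \min_{\gamma\in\mathbb{O}(x)} l(\gamma)\le \max_{\gamma\in\mathbb{O}(x)} l(\gamma)\le C|x|_1\Big)\ge 1-e^{-|x|_1^{\varepsilon}}.$$
   Context: For $x=(x_1,\dots,x_d)\in\mathbb{Z}^d$, $|x|_1=|x_1|+\dots+|x_d|$. Let $\{(S^x_j)_{j\ge 0}: x\in\mathbb{Z}^d\}$ be independent simple (nearest-neighbour, symmetric) random walks on $\mathbb{Z}^d$ with $S^x_0=x$. For $x,y\in\mathbb{Z}^d$ let $t(x,y)=\inf\{j\in\{0,1,2,\dots\}: S^x_j=y\}$ (with $\inf\emptyset=\infty$). The first passage time from $x$ to $y$ is $T(x,y)=\inf\{\sum_{i=1}^k t(x_{i-1},x_i): x=x_0,x_1,\dots,x_k=y \text{ in } \mathbb{Z}^d \text{ for some } k\}$, and $T(x)=T(0,x)$. A path of length $\ell\ge1$ is a sequence $\gamma=(y_i)_{i=1}^{\ell}$ of $\ell$ distinct vertices of $\mathbb{Z}^d$ (consecutive vertices need not be neighbours), and $l(\gamma)=\ell$ denotes its length. A path $\gamma=(y_i)_{i=1}^\ell$ with $y_1=x$, $y_\ell=y$ is optimal (from $x$ to $y$) if $T(x,y)=\sum_{i=1}^{\ell-1}t(y_i,y_{i+1})$. $\mathbb{O}(x)$ is the (random) set of all optimal paths from $0$ to $x$; it is almost surely nonempty. *)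

theory Defs
  imports "HOL-Probability.Probability"
begin

definition l1_norm :: "int ^ 'd \<Rightarrow> int" where
  "l1_norm x = (\<Sum>i\<in>UNIV. \<bar>x $ i\<bar>)"

definition unit_steps :: "(int ^ 'd) set" where
  "unit_steps = {v. l1_norm v = 1}"

lemma unit_steps_eq: "unit_steps = (\<lambda>(k, s). axis k s) ` (UNIV \<times> {1, -1})"
proof (intro equalityI subsetI)
  fix v :: "int ^ 'd"
  assume "v \<in> unit_steps"
  then have sum1: "(\<Sum>i\<in>UNIV. \<bar>v $ i\<bar>) = 1"
    by (simp add: unit_steps_def l1_norm_def)
  then obtain k where k: "v $ k \<noteq> 0"
    by (metis abs_zero sum.neutral zero_neq_one)
  have split: "\<bar>v $ k\<bar> + (\<Sum>i\<in>UNIV - {k}. \<bar>v $ i\<bar>) = 1"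
    using sum1 sum.remove[of UNIV k "\<lambda>i. \<bar>v $ i\<bar>"] by simp
  have nonneg: "(\<Sum>i\<in>UNIV - {k}. \<bar>v $ i\<bar>) \<ge> 0"
    by (simp add: sum_nonneg)
  have zero: "(\<Sum>i\<in>UNIV - {k}. \<bar>v $ i\<bar>) = 0" and one: "\<bar>v $ k\<bar> = 1"
    using split nonneg k by linarith+
  have "v $ i = 0" if "i \<noteq> k" for i
    using zero that by (simp add: sum_nonneg_eq_0_iff)
  then have "v = axis k (v $ k)"
    by (simp add: vec_eq_iff axis_def)
  moreover have "v $ k \<in> {1, -1}"
    using one by auto
  ultimately show "v \<in> (\<lambda>(k, s). axis k s) ` (UNIV \<times> {1, -1})"
    by (metis (no_types, lifting) SigmaI UNIV_I case_prod_conv image_eqI)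
next
  fix v :: "int ^ 'd"
  assume "v \<in> (\<lambda>(k, s). axis k s) ` (UNIV \<times> {1, -1})"
  then obtain k s where v: "v = axis k s" and s: "s \<in> {1, -1}"
    by auto
  have "(\<Sum>i\<in>UNIV. \<bar>v $ i\<bar>) = (\<Sum>i\<in>UNIV. if i = k then \<bar>s\<bar> else 0)"
    by (rule sum.cong) (auto simp: v axis_def)
  then show "v \<in> unit_steps"
    using s by (auto simp: unit_steps_def l1_norm_def)
qed

lemma card_unit_steps: "card (unit_steps :: (int ^ 'd) set) = 2 * CARD('d)"
proof -
  have "inj_on (\<lambda>(k :: 'd, s :: int). axis k s) (UNIV \<times> {1, -1})"
    by (auto simp: inj_on_def axis_eq_axis)
  then show ?thesis
    by (simp add: unit_steps_eq card_image card_cartesian_product)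
qed

lemma finite_unit_steps: "finite unit_steps"
  by (simp add: unit_steps_eq)

lemma unit_steps_nonempty: "unit_steps \<noteq> {}"
  by (simp add: unit_steps_eq)

locale simple_random_walk = prob_space M
  for M :: "'w measure" +
  fixes x :: "int ^ 'd" and W :: "nat \<Rightarrow> 'w \<Rightarrow> int ^ 'd"
  assumes measurable_walk: "\<And>j. W j \<in> measurable M (count_space UNIV)"
    and start: "\<And>\<omega>. \<omega> \<in> space M \<Longrightarrow> W 0 \<omega> = x"
    and indep_increments:
      "indep_vars (\<lambda>_. count_space UNIV) (\<lambda>j \<omega>. W (Suc j) \<omega> - W j \<omega>) UNIV"
    and distr_increment:
      "\<And>j. distr M (count_space UNIV) (\<lambda>\<omega>. W (Suc j) \<omega> - W j \<omega>)
        = measure_pmf (pmf_of_set unit_steps)"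

text \<open>Independence of the walks means independence of their whole trajectories, as random
  elements of the product space.\<close>

locale independent_simple_random_walks = prob_space M
  for M :: "'w measure" +
  fixes S :: "int ^ 'd \<Rightarrow> nat \<Rightarrow> 'w \<Rightarrow> int ^ 'd"
  assumes walk: "\<And>x. simple_random_walk M x (S x)"
    and indep_walks:
      "indep_vars (\<lambda>_. \<Pi>\<^sub>M j\<in>UNIV. count_space UNIV) (\<lambda>x \<omega> j. S x j \<omega>) UNIV"

text \<open>The infimum over the empty set is \<open>\<infinity>\<close> in \<^typ>\<open>enat\<close>.\<close>

definition hitting_time ::
  "(int ^ 'd \<Rightarrow> nat \<Rightarrow> 'w \<Rightarrow> int ^ 'd) \<Rightarrow> 'w \<Rightarrow> int ^ 'd \<Rightarrow> int ^ 'd \<Rightarrow> enat" where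
  "hitting_time S \<omega> x y = (INF j\<in>{j. S x j \<omega> = y}. enat j)"

definition chain_time ::
  "(int ^ 'd \<Rightarrow> nat \<Rightarrow> 'w \<Rightarrow> int ^ 'd) \<Rightarrow> 'w \<Rightarrow> (int ^ 'd) list \<Rightarrow> enat" where
  "chain_time S \<omega> ys = (\<Sum>i<length ys - 1. hitting_time S \<omega> (ys ! i) (ys ! Suc i))"

definition first_passage_time ::
  "(int ^ 'd \<Rightarrow> nat \<Rightarrow> 'w \<Rightarrow> int ^ 'd) \<Rightarrow> 'w \<Rightarrow> int ^ 'd \<Rightarrow> int ^ 'd \<Rightarrow> enat" where
  "first_passage_time S \<omega> x y =
    (INF ys\<in>{ys. ys \<noteq> [] \<and> hd ys = x \<and> last ys = y}. chain_time S \<omega> ys)"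

text \<open>A path is a nonempty list of distinct vertices; its length is its number of vertices,
  that is, \<^const>\<open>length\<close>.\<close>

definition is_path :: "(int ^ 'd) list \<Rightarrow> bool" where
  "is_path \<gamma> \<longleftrightarrow> \<gamma> \<noteq> [] \<and> distinct \<gamma>"

definition optimal_paths ::
  "(int ^ 'd \<Rightarrow> nat \<Rightarrow> 'w \<Rightarrow> int ^ 'd) \<Rightarrow> 'w \<Rightarrow> int ^ 'd \<Rightarrow> int ^ 'd \<Rightarrow> (int ^ 'd) list set" where
  "optimal_paths S \<omega> x y =
    {\<gamma>. is_path \<gamma> \<and> hd \<gamma> = x \<and> last \<gamma> = y \<and> first_passage_time S \<omega> x y = chain_time S \<omega> \<gamma>}"

text \<open>The first two conjuncts say that the minimum and the maximum exist;
  \<^const>\<open>Min\<close> and \<^const>\<open>Max\<close> are unspecified otherwise.\<close>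

definition optimal_lengths_between ::
  "(int ^ 'd \<Rightarrow> nat \<Rightarrow> 'w \<Rightarrow> int ^ 'd) \<Rightarrow> 'w \<Rightarrow> int ^ 'd \<Rightarrow> real \<Rightarrow> real \<Rightarrow> bool" where
  "optimal_lengths_between S \<omega> x a b \<longleftrightarrow>
    (let L = length ` optimal_paths S \<omega> 0 x in
      L \<noteq> {} \<and> finite L \<and> a \<le> real (Min L) \<and> Min L \<le> Max L \<and> real (Max L) \<le> b)"

end

theory Submission
  imports Defs "HOL-Real_Asymp.Real_Asymp"
begin

text \<open>Every step of an optimal path costs at least one unit of time, so its length is at most
  \<open>T(x) + 1\<close>. Conversely, a walk needs time of order \<open>r\<^sup>2\<close> to cover a distance \<open>r\<close>; a union bound
  with exponential weights shows that paths with fewer than \<open>c |x|\<close> vertices are too slow once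
  \<open>T(x) \<le> C |x|\<close>. So everything rests on the linear upper bound for \<open>T(x)\<close>, up to a stretched
  exponential probability.

  For a neighbour \<open>y\<close> of \<open>0\<close> this is a cascade. The walk from \<open>0\<close> visits \<open>r\<close> sites near \<open>0\<close>.
  A walk hits a ball of radius \<open>\<rho>\<close> at distance \<open>r\<close> with probability at least of order
  \<open>(\<rho> / r) ^ (d - 1)\<close> within polynomial time, because the \<open>(1 - d)\<close>-th power of the norm is
  subharmonic. Hence \<open>m ^ d\<close> awake walks in a box of side \<open>r\<close> wake up a site in each of the cells
  of side \<open>r / m'\<close> of the next (disjoint) box, where \<open>m'\<close> is larger than \<open>m\<close> by a power of \<open>r\<close>.
  After a bounded number of such stages there are about \<open>r ^ d\<close> awake walks, and one of them hits \<open>y\<close>.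
  Summing along a geodesic, with truncation to make distant increments independent, gives the bound
  for \<open>T(x)\<close>.\<close>

section \<open>Laws of finitely many steps\<close>

text \<open>The bound available for one walk reaching a given site at distance of order
  \<open>r\<close> is only \<open>r ^ (1 - d)\<close>, whereas \<open>r ^ d\<close> independent
  attempts all fail with probability about \<open>exp (- r)\<close>. So walks have to be gathered
  before the target is tried, and any hitting exponent below \<open>d\<close> would do. The exponent
  \<open>d - 1\<close> lies above the harmonic value \<open>d - 2\<close>: this leaves room for the
  lattice corrections, and it treats \<open>d = 2\<close> like the other dimensions, without Green
  functions. The cascade takes a time that is a large power \<open>b\<close> of the parameter
  \<open>q\<close> in its failure probability \<open>exp (- c * q)\<close>, so a passage to a
  neighbour gets a stretched exponential tail only. For this reason the passage times are truncated
  at a small power of the norm of \<open>x\<close>, and \<open>\<epsilon>\<close> is a fixed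
  fraction of \<open>1 / b\<close>. Probabilities about finitely many steps are handled as finite
  averages: \<open>walk_mean\<close> conditions on the first step, so that stopping-time arguments
  turn into inductions on the number of steps.\<close>

primrec walk_mean :: "nat \<Rightarrow> ((int ^ 'd) list \<Rightarrow> real) \<Rightarrow> real" where
  "walk_mean 0 F = F []"
| "walk_mean (Suc n) F =
    (\<Sum>v\<in>unit_steps. walk_mean n (\<lambda>vs. F (v # vs))) / (2 * real CARD('d))"

lemma walk_mean_const [simp]: "walk_mean n (\<lambda>_ :: (int ^ 'd) list. c) = c"
  by (induction n) (simp_all add: card_unit_steps)

lemma walk_mean_cmult:
  "walk_mean n (\<lambda>vs. c * F vs) = c * walk_mean n (F :: (int ^ 'd) list \<Rightarrow> real)"
  by (induction n arbitrary: F) (simp_all add: sum_distrib_left)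

lemma walk_mean_sum:
  fixes F :: "'b \<Rightarrow> (int ^ 'd) list \<Rightarrow> real"
  shows "walk_mean n (\<lambda>vs. \<Sum>i\<in>I. F i vs) = (\<Sum>i\<in>I. walk_mean n (F i))"
proof (induction n arbitrary: F)
  case (Suc n)
  have "walk_mean (Suc n) (\<lambda>vs. \<Sum>i\<in>I. F i vs)
      = (\<Sum>v\<in>unit_steps. \<Sum>i\<in>I. walk_mean n (\<lambda>vs. F i (v # vs))) / (2 * real CARD('d))"
    by (simp add: Suc)
  also have "\<dots> = (\<Sum>i\<in>I. walk_mean (Suc n) (F i))"
    by (subst sum.swap) (simp add: sum_divide_distrib)
  finally show ?case .
qed simp

text \<open>Unrolling the recursion yields the uniform average over words in
  \<open>unit_steps\<close>; in this form comparisons have to be checked on such words only.\<close>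

lemma walk_mean_eq_sum:
  fixes F :: "(int ^ 'd) list \<Rightarrow> real"
  shows "walk_mean n F =
    (\<Sum>vs\<in>{vs. set vs \<subseteq> unit_steps \<and> length vs = n}. F vs) / (2 * real CARD('d)) ^ n"
proof (induction n arbitrary: F)
  case 0
  have "{vs :: (int ^ 'd) list. set vs \<subseteq> unit_steps \<and> length vs = 0} = {[]}"
    by auto
  then show ?case by (simp only: sum.insert) simp
next
  case (Suc n)
  let ?L = "\<lambda>n. {vs :: (int ^ 'd) list. set vs \<subseteq> unit_steps \<and> length vs = n}"
  have "(\<Sum>vs\<in>?L (Suc n). F vs) = (\<Sum>(vs, v)\<in>?L n \<times> unit_steps. F (v # vs))"
    unfolding lists_length_Suc_eq
    by (subst sum.reindex) (auto simp: inj_on_def case_prod_unfold)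
  also have "\<dots> = (\<Sum>v\<in>unit_steps. \<Sum>vs\<in>?L n. F (v # vs))"
    by (simp add: sum.cartesian_product[symmetric] sum.swap[of _ unit_steps])
  finally show ?case
    by (simp add: Suc sum_divide_distrib mult.commute)
qed

lemma walk_mean_mono:
  fixes F G :: "(int ^ 'd) list \<Rightarrow> real"
  assumes "\<And>vs. set vs \<subseteq> unit_steps \<Longrightarrow> length vs = n \<Longrightarrow> F vs \<le> G vs"
  shows "walk_mean n F \<le> walk_mean n G"
  unfolding walk_mean_eq_sum using assms by (intro divide_right_mono sum_mono) auto

lemma sum_of_bool:
  "finite A \<Longrightarrow> (\<Sum>a\<in>A. of_bool (P a) :: real) = real (card {a \<in> A. P a})"
  by (simp add: of_bool_def sum.If_cases Int_def)

context simple_random_walk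
begin

definition steps :: "nat \<Rightarrow> 'w \<Rightarrow> (int ^ 'd) list" where
  "steps n \<omega> = map (\<lambda>j. W (Suc j) \<omega> - W j \<omega>) [0..<n]"

lemma walk_eq_sum_steps:
  assumes "\<omega> \<in> space M" "j \<le> n"
  shows "W j \<omega> = x + sum_list (take j (steps n \<omega>))"
proof -
  have "W j \<omega> = x + sum_list (steps j \<omega>)" for j
    by (induction j) (auto simp: steps_def start assms)
  moreover have "take j (steps n \<omega>) = steps j \<omega>"
    using assms(2) by (simp add: steps_def take_map min_def)
  ultimately show ?thesis by simp
qed

lemma measurable_increment [measurable]:
  "(\<lambda>\<omega>. W (Suc j) \<omega> - W j \<omega>) \<in> measurable M (count_space UNIV)"
  using indep_increments by (auto simp: indep_vars_def)

lemma prob_increment: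
  "prob {\<omega> \<in> space M. W (Suc j) \<omega> - W j \<omega> = v}
    = (if v \<in> unit_steps then 1 / (2 * real CARD('d)) else 0)"
proof -
  have "prob {\<omega> \<in> space M. W (Suc j) \<omega> - W j \<omega> = v}
      = measure (distr M (count_space UNIV) (\<lambda>\<omega>. W (Suc j) \<omega> - W j \<omega>)) {v}"
    by (subst measure_distr) (auto intro!: arg_cong[where f = prob])
  also have "\<dots> = pmf (pmf_of_set unit_steps) v"
    by (simp add: distr_increment pmf.rep_eq)
  finally show ?thesis
    by (simp add: pmf_of_set finite_unit_steps unit_steps_nonempty card_unit_steps indicator_def)
qed

lemma steps_eq_iff:
  "steps n \<omega> = vs \<longleftrightarrow> length vs = n \<and> (\<forall>j<n. W (Suc j) \<omega> - W j \<omega> = vs ! j)"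
  by (auto simp: steps_def list_eq_iff_nth_eq)

lemma measurable_steps [measurable]: "steps n \<in> measurable M (count_space UNIV)"
proof (rule measurable_count_space_eq_countable[THEN iffD2], simp, intro conjI ballI)
  fix vs :: "(int ^ 'd) list"
  have "steps n -` {vs} \<inter> space M
      = {\<omega> \<in> space M. length vs = n \<and> (\<forall>j\<in>{..<n}. W (Suc j) \<omega> - W j \<omega> = vs ! j)}"
    using steps_eq_iff[of n _ vs] by blast
  also have "\<dots> \<in> sets M" by measurable
  finally show "steps n -` {vs} \<inter> space M \<in> sets M" .
qed simp

lemma prob_steps_eq:
  "prob {\<omega> \<in> space M. steps n \<omega> = vs} =
    (if set vs \<subseteq> unit_steps \<and> length vs = n then 1 / (2 * real CARD('d)) ^ n else 0)"
proof (cases "length vs = n \<and> n \<noteq> 0")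
  case True
  let ?X = "\<lambda>j \<omega>. W (Suc j) \<omega> - W j \<omega>"
  have "{\<omega> \<in> space M. steps n \<omega> = vs} = (\<Inter>j\<in>{..<n}. ?X j -` {vs ! j} \<inter> space M)"
    using True by (auto simp: steps_eq_iff)
  also have "prob \<dots> = (\<Prod>j\<in>{..<n}. prob (?X j -` {vs ! j} \<inter> space M))"
    using True by (intro indep_varsD[OF indep_increments]) auto
  also have "\<dots> = (\<Prod>j\<in>{..<n}. if vs ! j \<in> unit_steps then 1 / (2 * real CARD('d)) else 0)"
    by (intro prod.cong refl, subst prob_increment[symmetric])
      (auto intro!: arg_cong[where f = prob])
  also have "\<dots> = (if set vs \<subseteq> unit_steps then 1 / (2 * real CARD('d)) ^ n else 0)"
  proof (cases "set vs \<subseteq> unit_steps")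
    case sub: True
    then have "vs ! j \<in> unit_steps" if "j < n" for j
      using that True by auto
    then show ?thesis using sub by (simp add: power_divide)
  next
    case False
    then obtain j where "j < n" "vs ! j \<notin> unit_steps"
      using True by (metis in_set_conv_nth subsetI)
    then show ?thesis using False by auto
  qed
  finally show ?thesis using True by simp
next
  case False
  then consider "length vs \<noteq> n" | "n = 0" "vs = []" by auto
  then show ?thesis
    by cases (auto simp: steps_eq_iff prob_space)
qed

lemma prob_steps:
  "prob {\<omega> \<in> space M. \<Phi> (steps n \<omega>)} = walk_mean n (\<lambda>vs. of_bool (\<Phi> vs))"
proof -
  let ?L = "{vs :: (int ^ 'd) list. set vs \<subseteq> unit_steps \<and> length vs = n}"
  have fin: "finite ?L"
    by (rule finite_lists_length_eq[OF finite_unit_steps])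
  have *: "prob {\<omega> \<in> space M. steps n \<omega> \<in> A} = real (card A) / (2 * real CARD('d)) ^ n"
    if "A \<subseteq> ?L" for A
  proof -
    have "finite A" using that fin finite_subset by blast
    have "{\<omega> \<in> space M. steps n \<omega> \<in> A} = (\<Union>vs\<in>A. {\<omega> \<in> space M. steps n \<omega> = vs})" by auto
    also have "prob \<dots> = (\<Sum>vs\<in>A. prob {\<omega> \<in> space M. steps n \<omega> = vs})"
      by (intro finite_measure_finite_Union \<open>finite A\<close>) (auto simp: disjoint_family_on_def)
    also have "\<dots> = (\<Sum>vs\<in>A. 1 / (2 * real CARD('d)) ^ n)"
      using that by (intro sum.cong refl) (auto simp: prob_steps_eq)
    finally show ?thesis by simp
  qed
  \<comment> \<open>The finitely many words over \<open>unit_steps\<close> carry all the mass, so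
    the probability of \<open>\<Phi>\<close> becomes a count over them.\<close>
  have "prob {\<omega> \<in> space M. steps n \<omega> \<in> ?L} = 1"
    by (subst *) (auto simp: card_lists_length_eq finite_lists_length_eq finite_unit_steps card_unit_steps)
  then have ae: "AE \<omega> in M. steps n \<omega> \<in> ?L"
    by (subst (asm) prob_Collect_eq_1) (auto simp: fin intro!: measurable_sets_Collect[OF measurable_steps])
  have "prob {\<omega> \<in> space M. \<Phi> (steps n \<omega>)} = prob {\<omega> \<in> space M. steps n \<omega> \<in> {vs \<in> ?L. \<Phi> vs}}"
    by (intro measure_eq_AE)
      (use ae in \<open>auto intro!: measurable_sets_Collect[OF measurable_steps]\<close>)
  also have "\<dots> = real (card {vs \<in> ?L. \<Phi> vs}) / (2 * real CARD('d)) ^ n"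
    by (rule *) auto
  also have "real (card {vs \<in> ?L. \<Phi> vs}) = (\<Sum>vs\<in>?L. of_bool (\<Phi> vs))"
    by (rule sum_of_bool[OF fin, symmetric])
  finally show ?thesis by (simp add: walk_mean_eq_sum)
qed

text \<open>The word of the first \<open>n\<close> steps determines the positions up to time
  \<open>n\<close>, so a predicate on whole trajectories that looks no further reduces to a finite
  average.\<close>

lemma prob_walk:
  assumes "\<And>w w'. (\<And>j. j \<le> n \<Longrightarrow> w j = w' j) \<Longrightarrow> Q w \<longleftrightarrow> Q w'"
  shows "prob {\<omega> \<in> space M. Q (\<lambda>j. W j \<omega>)}
    = walk_mean n (\<lambda>vs. of_bool (Q (\<lambda>j. x + sum_list (take j vs))))"
proof -
  have "{\<omega> \<in> space M. Q (\<lambda>j. W j \<omega>)}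
      = {\<omega> \<in> space M. Q (\<lambda>j. x + sum_list (take j (steps n \<omega>)))}"
    by (intro Collect_cong conj_cong refl assms) (simp add: walk_eq_sum_steps)
  then show ?thesis
    using prob_steps[of "\<lambda>vs. Q (\<lambda>j. x + sum_list (take j vs))" n] by simp
qed

end

section \<open>Functionals of disjoint families of walks\<close>

context independent_simple_random_walks
begin

text \<open>Cutting at time \<open>n\<close> gives values in a countable type, so finite families of
  trajectories live on a discrete space, where every function is measurable.\<close>

definition trajectory :: "nat \<Rightarrow> int ^ 'd \<Rightarrow> 'w \<Rightarrow> (int ^ 'd) list" where
  "trajectory n x \<omega> = map (\<lambda>j. S x j \<omega>) [0..<Suc n]"

lemma indep_trajectories: "indep_vars (\<lambda>_. count_space UNIV) (trajectory n) UNIV"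
proof -
  have "(\<lambda>w :: nat \<Rightarrow> int ^ 'd. map w [0..<Suc n]) \<in> measurable (\<Pi>\<^sub>M j\<in>UNIV. count_space UNIV) (count_space UNIV)"
    (is "?f \<in> measurable ?N _")
  proof (rule measurable_count_space_eq_countable[THEN iffD2], simp, intro conjI ballI)
    fix l :: "(int ^ 'd) list"
    have "?f -` {l} \<inter> space ?N
        = {w \<in> space ?N. length l = Suc n \<and> (\<forall>j\<in>{..<Suc n}. w j = l ! j)}"
      by (auto simp: list_eq_iff_nth_eq simp del: upt_Suc)
    also have "\<dots> \<in> sets ?N" by measurable
    finally show "?f -` {l} \<inter> space ?N \<in> sets ?N" .
  qed auto
  from indep_vars_compose2[OF indep_walks this]
  show ?thesis by (simp add: trajectory_def[abs_def])
qed

text \<open>Each \<open>f i\<close> factors through the finitely many trajectories started in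
  \<open>K i\<close>, and disjoint blocks of independent trajectories are independent. The
  independence used for hitting, for chains of hops and for truncated passage times comes from
  here.\<close>

lemma indep_vars_local:
  fixes f :: "'i \<Rightarrow> 'w \<Rightarrow> 'c"
  assumes fin: "\<And>i. i \<in> I \<Longrightarrow> finite (K i)" and disj: "disjoint_family_on K I"
    and loc: "\<And>i \<omega> \<omega>'. i \<in> I \<Longrightarrow> \<omega> \<in> space M \<Longrightarrow> \<omega>' \<in> space M \<Longrightarrow>
      (\<And>x j. x \<in> K i \<Longrightarrow> j \<le> n \<Longrightarrow> S x j \<omega> = S x j \<omega>') \<Longrightarrow> f i \<omega> = f i \<omega>'"
  shows "indep_vars (\<lambda>_. count_space UNIV) f I"
proof -
  define X where "X i \<omega> = restrict (\<lambda>x. trajectory n x \<omega>) (K i)" for i \<omega>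
  \<comment> \<open>\<open>F\<close> evaluates \<open>f i\<close> at some sample point with the
    prescribed trajectories; by \<open>loc\<close> the value does not depend on the point
    chosen.\<close>
  define F where "F i t = f i (SOME \<omega>. \<omega> \<in> space M \<and> X i \<omega> = t)" for i t
  have "indep_vars (\<lambda>i. PiM (K i) (\<lambda>_. count_space UNIV)) X I"
    unfolding X_def[abs_def] by (rule indep_vars_restrict[OF indep_trajectories _ disj]) simp
  then have ind: "indep_vars (\<lambda>_. count_space UNIV) (\<lambda>i \<omega>. F i (X i \<omega>)) I"
  proof (rule indep_vars_compose2)
    fix i assume "i \<in> I"
    then have "PiM (K i) (\<lambda>_. count_space UNIV :: (int ^ 'd) list measure)
        = count_space (PiE (K i) (\<lambda>_. UNIV))"
      by (intro count_space_PiM_finite fin) auto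
    then show "F i \<in> measurable (PiM (K i) (\<lambda>_. count_space UNIV)) (count_space UNIV)"
      by simp
  qed
  have FX: "F i (X i \<omega>) = f i \<omega>" if "i \<in> I" "\<omega> \<in> space M" for i \<omega>
  proof -
    define \<omega>' where "\<omega>' = (SOME \<omega>'. \<omega>' \<in> space M \<and> X i \<omega>' = X i \<omega>)"
    have "\<omega>' \<in> space M \<and> X i \<omega>' = X i \<omega>"
      unfolding \<omega>'_def by (rule someI[of _ \<omega>]) (simp add: that)
    moreover have "S x j \<omega>' = S x j \<omega>" if "x \<in> K i" "j \<le> n" "X i \<omega>' = X i \<omega>" for x j
    proof -
      have "trajectory n x \<omega>' ! j = trajectory n x \<omega> ! j"
        using fun_cong[OF that(3), of x] that(1) by (simp add: X_def)
      then show ?thesis using that by (simp add: trajectory_def nth_append del: upt_Suc)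
    qed
    ultimately show ?thesis
      unfolding F_def \<omega>'_def[symmetric] using that loc[of i \<omega>' \<omega>] by blast
  qed
  have pre: "(\<lambda>\<omega>. F i (X i \<omega>)) -` A \<inter> space M = f i -` A \<inter> space M" if "i \<in> I" for i A
    using FX[OF that] by (intro vimage_inter_cong)
  have "f i \<in> measurable M (count_space UNIV)" if "i \<in> I" for i
  proof -
    have "(\<lambda>\<omega>. F i (X i \<omega>)) \<in> measurable M (count_space UNIV)"
      using ind that unfolding indep_vars_def2 by blast
    then show ?thesis
      by (rule measurable_cong[THEN iffD1, rotated]) (rule FX[OF that])
  qed
  moreover have "indep_sets (\<lambda>i. {f i -` A \<inter> space M |A. A \<in> sets (count_space UNIV)}) I"
  proof (rule indep_sets_cong[OF refl, THEN iffD1])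
    show "indep_sets (\<lambda>i. {(\<lambda>\<omega>. F i (X i \<omega>)) -` A \<inter> space M |A. A \<in> sets (count_space UNIV)}) I"
      using ind unfolding indep_vars_def2 by (rule conjunct2)
    fix i assume "i \<in> I"
    show "{(\<lambda>\<omega>. F i (X i \<omega>)) -` A \<inter> space M |A. A \<in> sets (count_space UNIV)}
        = {f i -` A \<inter> space M |A. A \<in> sets (count_space UNIV)}"
      by (simp only: pre[OF \<open>i \<in> I\<close>])
  qed
  ultimately show ?thesis unfolding indep_vars_def2 by (intro conjI ballI)
qed

end

section \<open>Hitting a ball\<close>

abbreviation step_mean :: "(int ^ 'd \<Rightarrow> real) \<Rightarrow> int ^ 'd \<Rightarrow> real" where
  "step_mean f x \<equiv> (\<Sum>v\<in>unit_steps. f (x + v)) / (2 * real CARD('d))"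

lemma walk_mean_nonneg:
  fixes F :: "(int ^ 'd) list \<Rightarrow> real"
  shows "(\<And>vs. 0 \<le> F vs) \<Longrightarrow> 0 \<le> walk_mean n F"
  using walk_mean_mono[of n "\<lambda>_. 0" F] by simp

lemma sum_unit_steps:
  fixes h :: "int ^ 'd \<Rightarrow> real"
  shows "(\<Sum>v\<in>unit_steps. h v) = (\<Sum>k\<in>UNIV. h (axis k 1) + h (axis k (-1)))"
proof -
  have "inj_on (\<lambda>(k :: 'd, s :: int). axis k s) (UNIV \<times> {1, -1})"
    by (auto simp: inj_on_def axis_eq_axis)
  then have "(\<Sum>v\<in>unit_steps. h v) = (\<Sum>(k, s)\<in>UNIV \<times> {1, -1}. h (axis k s))"
    unfolding unit_steps_eq by (subst sum.reindex) (auto simp: case_prod_unfold)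
  then show ?thesis
    by (simp add: sum.cartesian_product[symmetric])
qed

section \<open>Stopped averages along the walk\<close>

lemma Ex_le_Suc_shift: "(\<exists>j\<le>Suc n. P j) \<longleftrightarrow> P 0 \<or> (\<exists>j\<le>n. P (Suc j))"
  by (metis Suc_le_mono le0 not0_implies_Suc)

lemma All_le_Suc_shift: "(\<forall>j\<le>Suc n. P j) \<longleftrightarrow> P 0 \<and> (\<forall>j\<le>n. P (Suc j))"
  by (metis Suc_le_mono le0 not0_implies_Suc)

definition hit_prob :: "nat \<Rightarrow> (int ^ 'd) set \<Rightarrow> int ^ 'd \<Rightarrow> real" where
  "hit_prob n B x = walk_mean n (\<lambda>vs. of_bool (\<exists>j\<le>n. x + sum_list (take j vs) \<in> B))"

definition stay_prob :: "nat \<Rightarrow> (int ^ 'd) set \<Rightarrow> int ^ 'd \<Rightarrow> real" where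
  "stay_prob n R x = walk_mean n (\<lambda>vs. of_bool (\<forall>j\<le>n. x + sum_list (take j vs) \<in> R))"

lemma hit_prob_0: "hit_prob 0 B x = of_bool (x \<in> B)"
  by (simp add: hit_prob_def)

lemma hit_prob_Suc:
  fixes x :: "int ^ 'd"
  shows "hit_prob (Suc n) B x =
    (if x \<in> B then 1 else step_mean (hit_prob n B) x)"
  by (simp add: hit_prob_def Ex_le_Suc_shift add.assoc card_unit_steps)

lemma stay_prob_0: "stay_prob 0 R x = of_bool (x \<in> R)"
  by (simp add: stay_prob_def)

lemma stay_prob_Suc:
  fixes x :: "int ^ 'd"
  shows "stay_prob (Suc n) R x =
    (if x \<in> R then step_mean (stay_prob n R) x else 0)"
  by (simp add: stay_prob_def All_le_Suc_shift add.assoc card_unit_steps)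

lemma hit_prob_nonneg: "0 \<le> hit_prob n B x"
  unfolding hit_prob_def by (rule walk_mean_nonneg) simp

lemma stay_prob_nonneg: "0 \<le> stay_prob n R x"
  unfolding stay_prob_def by (rule walk_mean_nonneg) simp

text \<open>Optional stopping as an induction on \<open>n\<close>: on entering \<open>B\<close> the
  value is at most \<open>F\<close>, on leaving \<open>R\<close> at most \<open>m\<close>, and
  \<open>F\<close> still bounds it if neither has happened by time \<open>n\<close>. Apart from the
  start, \<open>F\<close> has to bound \<open>f\<close> only one step away from the complement of
  \<open>B\<close>, so \<open>f\<close> may be large deep inside \<open>B\<close>.\<close>

lemma hit_prob_ge:
  fixes f :: "int ^ 'd \<Rightarrow> real"
  assumes sub: "\<And>x. x \<in> R \<Longrightarrow> x \<notin> B \<Longrightarrow> f x \<le> step_mean f x"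
    and out: "\<And>x. x \<notin> R \<Longrightarrow> x \<notin> B \<Longrightarrow> f x \<le> m"
    and bd: "\<And>x v. x \<notin> B \<Longrightarrow> v \<in> unit_steps \<Longrightarrow> f (x + v) \<le> F"
    and "0 \<le> m" "0 \<le> F" "f x \<le> F"
  shows "f x \<le> F * hit_prob n B x + m + F * stay_prob n R x"
  using \<open>f x \<le> F\<close>
proof (induction n arbitrary: x)
  case 0
  then show ?case
    using \<open>0 \<le> m\<close> \<open>0 \<le> F\<close> out by (auto simp: hit_prob_0 stay_prob_0)
next
  case (Suc n)
  consider "x \<in> B" | "x \<notin> B" "x \<notin> R" | "x \<notin> B" "x \<in> R" by blast
  then show ?case
  proof cases
    case 1
    have "0 \<le> F * stay_prob (Suc n) R x" using \<open>0 \<le> F\<close> stay_prob_nonneg by (rule mult_nonneg_nonneg)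
    then show ?thesis using 1 \<open>0 \<le> m\<close> Suc.prems by (simp add: hit_prob_Suc del: )
  next
    case 2
    have "0 \<le> F * hit_prob (Suc n) B x" using \<open>0 \<le> F\<close> hit_prob_nonneg by (rule mult_nonneg_nonneg)
    then show ?thesis using out[OF 2(2,1)] 2 by (simp add: stay_prob_Suc)
  next
    case 3
    have "f x \<le> step_mean f x"
      using 3 by (intro sub)
    also have "\<dots> \<le> (\<Sum>v\<in>unit_steps. F * hit_prob n B (x + v) + m + F * stay_prob n R (x + v)) / (2 * real CARD('d))"
      using 3 bd by (intro divide_right_mono sum_mono Suc.IH) auto
    also have "\<dots> = F * hit_prob (Suc n) B x + m + F * stay_prob (Suc n) R x"
      using 3 by (simp add: hit_prob_Suc stay_prob_Suc sum.distrib card_unit_steps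
          sum_distrib_left[symmetric] field_simps)
    finally show ?thesis .
  qed
qed

text \<open>The function \<open>g\<close> in the proof satisfies \<open>1 \<le> g \<le> 2\<close> in the slab, and a step multiplies
  its mean by at most \<open>q\<close>.\<close>

lemma stay_prob_slab_le:
  fixes x :: "int ^ 'd" and K :: nat
  assumes "K \<ge> 1"
  shows "stay_prob n {y. \<bar>y $ i\<bar> < int K} x \<le> 2 * exp (- real n / (2 * real CARD('d) * real K ^ 2))"
proof -
  let ?R = "{y :: int ^ 'd. \<bar>y $ i\<bar> < int K}" and ?d = "real CARD('d)"
  define g where "g y = 2 - (real_of_int (y $ i) / real K) ^ 2" for y :: "int ^ 'd"
  define q where "q = 1 - 1 / (2 * ?d * real K ^ 2)"
  have d: "?d \<ge> 1" by (simp add: Suc_le_eq)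
  have "real K ^ 2 \<ge> 1" using assms by simp
  then have "2 * ?d * real K ^ 2 \<ge> 2 * 1 * 1"
    using d by (intro mult_mono) auto
  then have q: "0 \<le> q" by (simp add: q_def field_simps)
  have g1: "g y \<ge> 1" if "\<bar>y $ i\<bar> \<le> int K" for y
  proof -
    have "\<bar>real_of_int (y $ i) / real K\<bar> \<le> 1"
      using that assms by (simp add: field_simps)
    then have "(real_of_int (y $ i) / real K) ^ 2 \<le> 1"
      by (simp add: abs_square_le_1)
    then show ?thesis by (simp add: g_def)
  qed
  have gavg: "step_mean g y \<le> q * g y" if "\<bar>y $ i\<bar> \<le> int K" for y
  proof -
    let ?t = "real_of_int (y $ i)"
    have k: "g (y + axis k 1) + g (y + axis k (-1)) = 2 * g y - (if k = i then 2 / real K ^ 2 else 0)" for k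
      using assms by (simp add: g_def axis_def power2_eq_square field_simps)
    have "(\<Sum>v\<in>unit_steps. g (y + v)) = 2 * ?d * g y - 2 / real K ^ 2"
      by (simp add: sum_unit_steps k sum_subtractf sum_distrib_right[symmetric])
    then have "step_mean g y = g y - 1 / (?d * real K ^ 2)"
      using d assms by (simp add: field_simps)
    also have "\<dots> \<le> g y - (1 / (2 * ?d * real K ^ 2)) * g y"
    proof -
      have "g y \<le> 2" by (simp add: g_def)
      then have "(1 / (2 * ?d * real K ^ 2)) * g y \<le> (1 / (2 * ?d * real K ^ 2)) * 2"
        by (intro mult_left_mono) auto
      then show ?thesis by simp
    qed
    also have "\<dots> = q * g y" by (simp add: q_def algebra_simps)
    finally show ?thesis .
  qed
  have main: "stay_prob n ?R y \<le> q ^ n * g y" if "\<bar>y $ i\<bar> \<le> int K" for n y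
    using that
  proof (induction n arbitrary: y)
    case 0
    then show ?case using g1[of y] by (simp add: stay_prob_0)
  next
    case (Suc n)
    show ?case
    proof (cases "y \<in> ?R")
      case True
      have nb: "\<bar>(y + v) $ i\<bar> \<le> int K" if "v \<in> unit_steps" for v
        using that True by (auto simp: unit_steps_eq axis_def)
      have "stay_prob (Suc n) ?R y = (\<Sum>v\<in>unit_steps. stay_prob n ?R (y + v)) / (2 * ?d)"
        using True by (simp add: stay_prob_Suc)
      also have "\<dots> \<le> (\<Sum>v\<in>unit_steps. q ^ n * g (y + v)) / (2 * ?d)"
        using nb by (intro divide_right_mono sum_mono Suc.IH) auto
      also have "\<dots> = q ^ n * step_mean g y"
        by (simp add: sum_distrib_left)
      also have "\<dots> \<le> q ^ n * (q * g y)"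
        using Suc.prems q by (intro mult_left_mono gavg) auto
      finally show ?thesis by (simp add: mult_ac)
    next
      case False
      have "0 \<le> q ^ Suc n * g y" using q g1[OF Suc.prems] by simp
      then show ?thesis using False by (simp add: stay_prob_Suc)
    qed
  qed
  have "q ^ n * 2 \<le> 2 * exp (- real n / (2 * ?d * real K ^ 2))"
  proof -
    have "q \<le> exp (- (1 / (2 * ?d * real K ^ 2)))"
      using exp_ge_add_one_self[of "- (1 / (2 * ?d * real K ^ 2))"] by (simp add: q_def)
    then have "q ^ n \<le> exp (- (1 / (2 * ?d * real K ^ 2))) ^ n"
      using q by (intro power_mono)
    then show ?thesis by (simp add: exp_of_nat_mult[symmetric])
  qed
  moreover have "stay_prob n ?R x \<le> q ^ n * 2"
  proof (cases "\<bar>x $ i\<bar> \<le> int K")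
    case True
    have "g x \<le> 2" by (simp add: g_def)
    then have "q ^ n * g x \<le> q ^ n * 2" using q by (intro mult_left_mono) auto
    then show ?thesis using main[OF True, of n] by linarith
  next
    case False
    then have "stay_prob n ?R x = 0"
      by (cases n) (auto simp: stay_prob_0 stay_prob_Suc)
    then show ?thesis using q by simp
  qed
  ultimately show ?thesis by linarith
qed

text \<open>Taylor expansion at 1. Breaking off after an odd degree leaves a positive fourth
  derivative times an even power, so the inequality holds on both sides of 1 and for
  \<open>w - 1\<close> of any size.\<close>

lemma powr_neg_ge_cubic:
  fixes w \<kappa> :: real
  assumes "w > 0" "\<kappa> > 0"
  shows "w powr (-\<kappa>) \<ge> 1 - \<kappa> * (w - 1) + \<kappa> * (\<kappa> + 1) / 2 * (w - 1)^2
    - \<kappa> * (\<kappa> + 1) * (\<kappa> + 2) / 6 * (w - 1)^3"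
proof (cases "w = 1")
  case False
  define D where "D m t = (\<Prod>i<m. - \<kappa> - real i) * t powr (- \<kappa> - real m)" for m t
  have "\<exists>t. (if w < 1 then w < t \<and> t < 1 else 1 < t \<and> t < w) \<and>
      w powr (-\<kappa>) = (\<Sum>m<4. D m 1 / fact m * (w - 1) ^ m) + D 4 t / fact 4 * (w - 1) ^ 4"
  proof (rule Taylor[of 4 D _ "min w 1" "max w 1"])
    show "D 0 = (\<lambda>t. t powr - \<kappa>)" by (simp add: D_def fun_eq_iff)
    show "\<forall>m t. m < 4 \<and> min w 1 \<le> t \<and> t \<le> max w 1 \<longrightarrow> DERIV (D m) t :> D (Suc m) t"
    proof (intro allI impI)
      fix m :: nat and t assume "m < 4 \<and> min w 1 \<le> t \<and> t \<le> max w 1"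
      then have "t > 0" using assms(1) by linarith
      then have "((\<lambda>t. t powr (- \<kappa> - real m)) has_real_derivative
          (- \<kappa> - real m) * t powr (- \<kappa> - real m - 1)) (at t)"
        by (auto intro!: derivative_eq_intros)
      then have "DERIV (D m) t :> (\<Prod>i<m. - \<kappa> - real i) * ((- \<kappa> - real m) * t powr (- \<kappa> - real m - 1))"
        unfolding D_def by (rule DERIV_cmult)
      then show "DERIV (D m) t :> D (Suc m) t"
        by (simp add: D_def mult.assoc algebra_simps)
    qed
  qed (use False in auto)
  then obtain t where t': "if w < 1 then w < t \<and> t < 1 else 1 < t \<and> t < w"
    and eq: "w powr (-\<kappa>) = (\<Sum>m<4. D m 1 / fact m * (w - 1) ^ m) + D 4 t / fact 4 * (w - 1) ^ 4"
    by blast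
  from t' have t: "t > 0"
    using assms(1) by (auto split: if_splits)
  have "D 4 t = \<kappa> * (\<kappa> + 1) * (\<kappa> + 2) * (\<kappa> + 3) * t powr (- \<kappa> - 4)"
    by (simp add: D_def eval_nat_numeral algebra_simps)
  then have "0 \<le> D 4 t / fact 4 * (w - 1) ^ 4"
    using assms(2) t by simp
  moreover have "(\<Sum>m<4. D m 1 / fact m * (w - 1) ^ m) = 1 - \<kappa> * (w - 1) + \<kappa> * (\<kappa> + 1) / 2 * (w - 1)^2
    - \<kappa> * (\<kappa> + 1) * (\<kappa> + 2) / 6 * (w - 1)^3"
    by (simp add: D_def eval_nat_numeral fact_reduce) (simp add: field_simps)
  ultimately show ?thesis using eq by linarith
qed simp

section \<open>Lattice norms and subharmonicity of a negative power of the Euclidean norm\<close>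

definition sq_norm :: "int ^ 'd \<Rightarrow> int" where
  "sq_norm x = (\<Sum>i\<in>UNIV. (x $ i)\<^sup>2)"

lemma sq_norm_nonneg: "sq_norm x \<ge> 0"
  by (simp add: sq_norm_def sum_nonneg)

lemma sq_norm_eq_0 [simp]: "sq_norm x = 0 \<longleftrightarrow> x = 0"
  by (simp add: sq_norm_def sum_nonneg_eq_0_iff vec_eq_iff)

lemma sq_norm_0 [simp]: "sq_norm 0 = 0"
  by simp

lemma sq_norm_add_axis: "sq_norm (x + axis k s) = sq_norm x + 2 * s * x $ k + s\<^sup>2"
proof -
  have "(\<Sum>i\<in>UNIV. ((x + axis k s) $ i)\<^sup>2)
      = (\<Sum>i\<in>UNIV. (x $ i)\<^sup>2 + (if i = k then 2 * s * x $ k + s\<^sup>2 else 0))"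
    by (intro sum.cong refl) (auto simp: axis_def power2_eq_square algebra_simps)
  then show ?thesis by (simp add: sq_norm_def sum.distrib)
qed

lemma l1_norm_nonneg [simp]: "l1_norm x \<ge> 0"
  by (simp add: l1_norm_def sum_nonneg)

lemma l1_norm_eq_0 [simp]: "l1_norm x = 0 \<longleftrightarrow> x = 0"
  by (simp add: l1_norm_def sum_nonneg_eq_0_iff vec_eq_iff)

lemma l1_norm_triangle: "l1_norm (x + y) \<le> l1_norm x + l1_norm y"
  by (simp add: l1_norm_def sum.distrib[symmetric] sum_mono)

lemma l1_norm_minus_commute: "l1_norm (x - y) = l1_norm (y - x)"
  by (simp add: l1_norm_def abs_minus_commute)

lemma l1_norm_le_sq_norm: "l1_norm x \<le> sq_norm x"
proof -
  have "\<bar>t\<bar> \<le> t\<^sup>2" for t :: int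
  proof (cases "t = 0")
    case False
    then have "\<bar>t\<bar> * 1 \<le> \<bar>t\<bar> * \<bar>t\<bar>" by (intro mult_left_mono) auto
    then show ?thesis by (simp add: power2_eq_square)
  qed simp
  then show ?thesis
    unfolding l1_norm_def sq_norm_def by (intro sum_mono)
qed

lemma sq_norm_le_l1_norm: "sq_norm x \<le> (l1_norm x)\<^sup>2"
proof -
  have "(\<Sum>i\<in>UNIV. (x $ i)\<^sup>2) \<le> (\<Sum>i\<in>UNIV. \<bar>x $ i\<bar> * l1_norm x)"
  proof (rule sum_mono)
    fix i
    have "\<bar>x $ i\<bar> \<le> l1_norm x"
      unfolding l1_norm_def by (rule member_le_sum) auto
    then show "(x $ i)\<^sup>2 \<le> \<bar>x $ i\<bar> * l1_norm x"
      by (metis abs_ge_zero mult_left_mono power2_abs power2_eq_square)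
  qed
  then show ?thesis
    by (simp add: sq_norm_def l1_norm_def power2_eq_square sum_distrib_right)
qed

lemma ex_unit_step_towards:
  fixes x :: "int ^ 'd"
  assumes "x \<noteq> 0"
  obtains v where "v \<in> unit_steps" "l1_norm (x + v) = l1_norm x - 1"
proof -
  obtain k where k: "x $ k \<noteq> 0" using assms by (auto simp: vec_eq_iff)
  have "l1_norm (x + axis k (- sgn (x $ k))) = (\<Sum>i\<in>UNIV. \<bar>x $ i\<bar> - (if i = k then 1 else 0))"
    unfolding l1_norm_def using k by (intro sum.cong refl) (auto simp: axis_def sgn_if)
  also have "\<dots> = l1_norm x - 1" by (simp add: sum_subtractf l1_norm_def)
  finally show ?thesis
    using k by (intro that[of "axis k (- sgn (x $ k))"]) (auto simp: unit_steps_eq sgn_if)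
qed

lemma real_sq_norm_pos: "x \<noteq> 0 \<Longrightarrow> real_of_int (sq_norm x) \<ge> 1"
  using sq_norm_nonneg[of x] sq_norm_eq_0[of x] by linarith

text \<open>In the continuum the Laplacian of \<open>|x| ^ (- 2 * \<kappa>)\<close> is
  \<open>2 * \<kappa> * (2 * \<kappa> + 2 - d)\<close> times
  \<open>|x| ^ (- 2 * \<kappa> - 2)\<close>. For \<open>2 * \<kappa> = d - 1\<close> the bracket is
  1, and this surplus absorbs the lattice errors once the squared norm is large.\<close>

lemma sq_norm_powr_subharmonic:
  fixes x :: "int ^ 'd"
  defines "\<kappa> \<equiv> (real CARD('d) - 1) / 2"
  assumes d: "CARD('d) \<ge> 2" and x: "sq_norm x \<ge> (int CARD('d) + 3) ^ 3"
  shows "real_of_int (sq_norm x) powr (-\<kappa>)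
    \<le> (\<Sum>v\<in>unit_steps. real_of_int (sq_norm (x + v)) powr (-\<kappa>)) / (2 * real CARD('d))"
proof -
  let ?d = "real CARD('d)"
  define u where "u = real_of_int (sq_norm x)"
  have u: "u \<ge> (?d + 3) ^ 3"
    using x unfolding u_def by (metis (mono_tags, lifting) of_int_add of_int_le_iff of_int_numeral of_int_of_nat_eq of_int_power)
  have d2: "?d \<ge> 2" using d by simp
  then have "(?d + 3) ^ 3 \<ge> 1" by (intro one_le_power) auto
  then have u1: "u \<ge> 1" using u by linarith
  have kpos: "\<kappa> > 0" using d2 by (simp add: \<kappa>_def)
  \<comment> \<open>The cubic of \<open>powr_neg_ge_cubic\<close> in \<open>t = w - 1\<close>, with
    \<open>w\<close> the ratio of the squared norms after and before a step.\<close>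
  define P where "P t = 1 - \<kappa> * t + \<kappa> * (\<kappa> + 1) / 2 * t^2 - \<kappa> * (\<kappa> + 1) * (\<kappa> + 2) / 6 * t^3" for t
  have "sq_norm x > 0" using u1 by (simp add: u_def)
  have step: "real_of_int (sq_norm (x + axis k s)) powr (-\<kappa>) \<ge> u powr (-\<kappa>) * P ((1 + 2 * s * x $ k) / u)"
    if s: "s = 1 \<or> s = -1" for k and s :: int
  proof -
    have ss: "s\<^sup>2 = 1" using s by auto
    have eq: "real_of_int (sq_norm (x + axis k s)) = u + (1 + 2 * s * x $ k)"
      by (simp add: sq_norm_add_axis ss u_def)
    have "x + axis k s \<noteq> 0"
    proof
      assume "x + axis k s = 0"
      then have "x = - axis k s" by (simp add: eq_neg_iff_add_eq_0)
      also have "\<dots> = axis k (-s)" by (simp add: axis_def vec_eq_iff)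
      finally have "x = axis k (-s)" .
      then have "sq_norm x = s\<^sup>2"
        using sq_norm_add_axis[of 0 k "-s"] by simp
      then have "u = 1" by (simp add: u_def ss)
      moreover have "(?d + 3) ^ 3 \<ge> 5 ^ 3" using d2 by (intro power_mono) auto
      ultimately show False using u by simp
    qed
    then have pos: "u + (1 + 2 * s * x $ k) > 0"
      using real_sq_norm_pos[of "x + axis k s"] eq by linarith
    define w where "w = 1 + (1 + 2 * s * x $ k) / u"
    have uw: "u + (1 + 2 * s * x $ k) = u * w" using u1 by (simp add: w_def field_simps)
    then have w: "w > 0" using pos u1 by (simp add: zero_less_mult_iff)
    have "P (w - 1) \<le> w powr (-\<kappa>)"
      using powr_neg_ge_cubic[OF w kpos] by (simp add: P_def)
    then have "u powr (-\<kappa>) * P (w - 1) \<le> u powr (-\<kappa>) * w powr (-\<kappa>)"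
      by (intro mult_left_mono) auto
    also have "\<dots> = (u * w) powr (-\<kappa>)" using u1 w by (simp add: powr_mult)
    finally have "u powr (-\<kappa>) * P (w - 1) \<le> (u * w) powr (-\<kappa>)" .
    moreover have "w - 1 = (1 + 2 * s * x $ k) / u" by (simp add: w_def)
    ultimately show ?thesis by (simp only: eq uw)
  qed
  define X where "X k = real_of_int (x $ k)" for k
  have sumX: "(\<Sum>k\<in>UNIV. X k ^ 2) = u" by (simp add: u_def sq_norm_def X_def)
  define c where "c = (\<kappa> + 1) * (\<kappa> + 2) / 6"
  \<comment> \<open>Adding opposite directions removes the odd powers of \<open>X k\<close>, so only
    the sum of all \<open>X k ^ 2\<close>, which is \<open>u\<close>, enters the total.\<close>
  have pair: "P ((1 + 2 * X k) / u) + P ((1 - 2 * X k) / u)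
      = 2 * (1 - \<kappa> / u + \<kappa> * (\<kappa> + 1) / 2 / u^2 - \<kappa> * c / u^3)
        + (4 * \<kappa> * (\<kappa> + 1) / u^2 - 24 * \<kappa> * c / u^3) * X k ^ 2" for k
    using u1 unfolding P_def c_def by (simp add: field_simps power2_eq_square power3_eq_cube)
  have tot: "(\<Sum>k\<in>UNIV. P ((1 + 2 * X k) / u) + P ((1 - 2 * X k) / u)) \<ge> 2 * ?d"
  proof -
    have "(\<Sum>k\<in>UNIV. P ((1 + 2 * X k) / u) + P ((1 - 2 * X k) / u))
      = ?d * (2 * (1 - \<kappa> / u + \<kappa> * (\<kappa> + 1) / 2 / u^2 - \<kappa> * c / u^3))
        + (4 * \<kappa> * (\<kappa> + 1) / u^2 - 24 * \<kappa> * c / u^3) * u"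
      unfolding pair by (simp add: sum.distrib sum_distrib_left[symmetric] sumX)
    also have "\<dots> = 2 * ?d + 2 * \<kappa> / u * (- ?d + 2 * (\<kappa> + 1) + ?d * (\<kappa> + 1) / 2 / u - ?d * c / u^2 - 12 * c / u)"
      using u1 by (simp add: field_simps power2_eq_square power3_eq_cube)
    \<comment> \<open>The leading coefficient, the lattice counterpart of
      \<open>2 * \<kappa> + 2 - d = 1\<close>.\<close>
    also have "- ?d + 2 * (\<kappa> + 1) = 1" by (simp add: \<kappa>_def field_simps)
    finally have eq: "(\<Sum>k\<in>UNIV. P ((1 + 2 * X k) / u) + P ((1 - 2 * X k) / u))
      = 2 * ?d + 2 * \<kappa> / u * (1 + ?d * (\<kappa> + 1) / 2 / u - ?d * c / u^2 - 12 * c / u)" .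
    have c0: "c \<ge> 0" using kpos by (simp add: c_def)
    \<comment> \<open>The two negative corrections amount to at most
      \<open>(d + 12) * c / u\<close>; the threshold \<open>(d + 3) ^ 3\<close> on the squared norm
      makes this at most 1.\<close>
    have "(?d + 12) * c \<le> (?d + 3) ^ 3"
    proof -
      have "c = (?d + 1) * (?d + 3) / 24" by (simp add: c_def \<kappa>_def field_simps)
      also have "\<dots> \<le> (?d + 3) * (?d + 3) / 24"
        by (intro divide_right_mono mult_right_mono) auto
      finally have "(?d + 12) * c \<le> (24 * (?d + 3)) * ((?d + 3) * (?d + 3) / 24)"
        using c0 d2 by (intro mult_mono) auto
      also have "\<dots> = (?d + 3) ^ 3" by (simp add: power3_eq_cube)
      finally show ?thesis .
    qed
    then have "(?d + 12) * c \<le> u" using u by linarith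
    then have "(?d + 12) * c / u \<le> 1" using u1 by simp
    moreover have "?d * c / u^2 \<le> ?d * c / u"
      using u1 c0 d2 by (intro divide_left_mono) (auto simp: power2_eq_square)
    moreover have "(?d + 12) * c / u = ?d * c / u + 12 * c / u"
      by (simp add: distrib_right add_divide_distrib)
    moreover have "0 \<le> ?d * (\<kappa> + 1) / 2 / u" using u1 kpos by simp
    ultimately have "0 \<le> 1 + ?d * (\<kappa> + 1) / 2 / u - ?d * c / u^2 - 12 * c / u" by linarith
    then show ?thesis unfolding eq using kpos u1 by simp
  qed
  have "2 * ?d * u powr (-\<kappa>) \<le> u powr (-\<kappa>) * (\<Sum>k\<in>UNIV. P ((1 + 2 * X k) / u) + P ((1 - 2 * X k) / u))"
    using mult_left_mono[OF tot, of "u powr (-\<kappa>)"] by (simp add: mult_ac)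
  also have "\<dots> \<le> (\<Sum>k\<in>UNIV. real_of_int (sq_norm (x + axis k 1)) powr (-\<kappa>)
      + real_of_int (sq_norm (x + axis k (-1))) powr (-\<kappa>))"
    unfolding sum_distrib_left using step[of 1] step[of "-1"]
    by (intro sum_mono) (simp add: X_def distrib_left add_mono)
  also have "\<dots> = (\<Sum>v\<in>unit_steps. real_of_int (sq_norm (x + v)) powr (-\<kappa>))"
    by (simp add: sum_unit_steps)
  finally show ?thesis using d2 by (simp add: u_def field_simps)
qed

lemma power_le_geometric:
  fixes k :: nat and b :: real
  assumes "b > 1"
  obtains C where "C \<ge> 1" "\<And>l :: nat. real l ^ k \<le> C * b ^ l"
proof -
  have "(\<lambda>l. real l ^ k * (1 / b) ^ l) \<longlonglongrightarrow> 0"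
    using assms by real_asymp
  then have "Bseq (\<lambda>l. real l ^ k * (1 / b) ^ l)" by (intro convergent_imp_Bseq convergentI)
  then obtain C where C: "\<And>l. norm (real l ^ k * (1 / b) ^ l) \<le> C" by (auto simp: Bseq_def)
  show ?thesis
  proof (rule that[of "max 1 C"])
    fix l
    have "real l ^ k * (1 / b) ^ l \<le> max 1 C" using C[of l] by (auto simp: abs_le_iff max_def)
    then show "real l ^ k \<le> max 1 C * b ^ l" using assms by (simp add: field_simps)
  qed simp
qed

text \<open>\<open>f\<close> is the maximum of two functions. The negative power of the Euclidean norm is subharmonic
  only far from \<open>0\<close>; near \<open>0\<close> it is dominated by \<open>(1 / (2 d)) ^ l1_norm x\<close>, which is subharmonic off
  \<open>0\<close> because a single neighbour closer to \<open>0\<close> already carries the whole mean.\<close>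

lemma ex_subharmonic:
  assumes d: "CARD('d::finite) \<ge> 2"
  shows "\<exists>(f :: int ^ 'd \<Rightarrow> real) c C. 0 < c \<and> 1 \<le> C \<and> f 0 \<le> 1 \<and>
    (\<forall>x. x \<noteq> 0 \<longrightarrow> f x \<le> step_mean f x \<and>
      c / sqrt (sq_norm x) ^ (CARD('d) - 1) \<le> f x \<and>
      f x \<le> C / sqrt (sq_norm x) ^ (CARD('d) - 1))"
proof -
  let ?d = "real CARD('d)"
  define \<kappa> where "\<kappa> = (?d - 1) / 2"
  define h where "h x = (1 / (2 * ?d)) ^ nat (l1_norm x)" for x :: "int ^ 'd"
  define g where "g x = real_of_int (sq_norm x) powr (-\<kappa>)" for x :: "int ^ 'd"
  define u0 where "u0 = (CARD('d) + 3) ^ 3"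
  \<comment> \<open>A lower bound for \<open>h\<close> on the region where
    \<open>sq_norm_powr_subharmonic\<close> does not apply: there the l1 norm is at most
    \<open>u0\<close>. As \<open>g \<le> 1\<close> off the origin, \<open>c * g \<le> h\<close> on
    that region.\<close>
  define c where "c = (1 / (2 * ?d)) ^ u0"
  define f where "f x = max (h x) (c * g x)" for x
  have d2: "?d \<ge> 2" using d by simp
  have g_eq: "g x = 1 / sqrt (sq_norm x) ^ (CARD('d) - 1)" if "x \<noteq> 0" for x
  proof -
    have pos: "real_of_int (sq_norm x) > 0" using real_sq_norm_pos[OF that] by linarith
    have "sqrt (sq_norm x) ^ (CARD('d) - 1) = (real_of_int (sq_norm x) powr (1/2)) powr real (CARD('d) - 1)"
      using pos powr_realpow[of "sqrt (sq_norm x)" "CARD('d) - 1"] by (simp add: powr_half_sqrt)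
    also have "\<dots> = real_of_int (sq_norm x) powr \<kappa>"
      using d by (simp add: powr_powr \<kappa>_def of_nat_diff)
    finally show ?thesis by (simp add: g_def powr_minus_divide)
  qed
  have g_nn: "0 \<le> g x" for x by (simp add: g_def)
  have h_nn: "0 \<le> h x" for x by (simp add: h_def)
  have c0: "c > 0" using d2 by (simp add: c_def)
  obtain C where C: "C \<ge> 1" "\<And>l :: nat. real l ^ (CARD('d) - 1) \<le> C * (2 * ?d) ^ l"
    using power_le_geometric[of "2 * ?d" "CARD('d) - 1"] d2 by auto
  have c1: "c \<le> 1" using d2 by (auto simp: c_def intro!: power_le_one)
  show ?thesis
  proof (rule exI[of _ f], rule exI[of _ c], rule exI[of _ C], intro conjI allI impI)
    show "0 < c" "1 \<le> C" by fact+
    \<comment> \<open>By the convention \<open>0 powr a = 0\<close>, \<open>g\<close> vanishes at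
      the origin, so \<open>f 0 = h 0 = 1\<close>.\<close>
    show "f 0 \<le> 1" using c1 by (simp add: f_def h_def g_def l1_norm_def)
    fix x :: "int ^ 'd" assume x: "x \<noteq> 0"
    show "c / sqrt (sq_norm x) ^ (CARD('d) - 1) \<le> f x"
      by (simp add: f_def g_eq[OF x])
    have hC: "h x \<le> C * g x"
    proof -
      define l where "l = nat (l1_norm x)"
      have l: "real_of_int (l1_norm x) = real l" by (simp add: l_def)
      have "real_of_int (sq_norm x) \<le> (real l)\<^sup>2"
        using sq_norm_le_l1_norm[of x] l by (metis of_int_le_iff of_int_power)
      then have "sqrt (sq_norm x) \<le> real l" by (rule real_le_lsqrt[rotated]) auto
      then have "sqrt (sq_norm x) ^ (CARD('d) - 1) \<le> real l ^ (CARD('d) - 1)"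
        using sq_norm_nonneg by (intro power_mono) auto
      also have "\<dots> \<le> C * (2 * ?d) ^ l" by (rule C)
      finally have "sqrt (sq_norm x) ^ (CARD('d) - 1) \<le> C * (2 * ?d) ^ l" .
      moreover have "sqrt (sq_norm x) ^ (CARD('d) - 1) > 0"
        using real_sq_norm_pos[OF x] by (intro zero_less_power) simp
      ultimately show ?thesis
        using d2 by (simp add: h_def g_eq[OF x] l_def[symmetric] field_simps power_divide)
    qed
    have "c * g x \<le> C * g x" using c1 C(1) g_nn by (intro mult_right_mono) auto
    with hC show "f x \<le> C / sqrt (sq_norm x) ^ (CARD('d) - 1)"
      by (simp add: f_def g_eq[OF x])
    have sum_le: "step_mean k x \<le> step_mean f x"
      if "\<And>y. k y \<le> f y" for k
      using that by (intro divide_right_mono sum_mono) auto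
    have "h x \<le> step_mean h x"
    proof -
      obtain v where v: "v \<in> unit_steps" "l1_norm (x + v) = l1_norm x - 1"
        using ex_unit_step_towards[OF x] .
      have "nat (l1_norm x) = Suc (nat (l1_norm (x + v)))"
        using v(2) x l1_norm_nonneg[of "x + v"] by simp
      then have "h x = h (x + v) / (2 * ?d)" by (simp add: h_def)
      also have "\<dots> \<le> step_mean h x"
        using v(1) h_nn by (intro divide_right_mono member_le_sum finite_unit_steps) auto
      finally show ?thesis .
    qed
    also have "\<dots> \<le> step_mean f x"
      by (rule sum_le) (simp add: f_def)
    finally have hs: "h x \<le> step_mean f x" .
    have gs: "c * g x \<le> step_mean f x"
    proof (cases "sq_norm x \<ge> (int CARD('d) + 3) ^ 3")
      case True
      have "c * g x \<le> c * step_mean g x"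
        using sq_norm_powr_subharmonic[OF d True] c0
        unfolding g_def \<kappa>_def by (intro mult_left_mono) auto
      also have "\<dots> = (\<Sum>v\<in>unit_steps. c * g (x + v)) / (2 * ?d)"
        by (simp add: sum_distrib_left)
      also have "\<dots> \<le> step_mean f x"
        by (rule sum_le) (simp add: f_def)
      finally show ?thesis .
    next
      case False
      then have "nat (l1_norm x) \<le> u0"
        using l1_norm_le_sq_norm[of x] by (simp add: u0_def nat_le_iff add.commute)
      then have "c \<le> h x"
        unfolding c_def h_def using d2 by (intro power_decreasing) auto
      moreover have "g x \<le> 1"
        using real_sq_norm_pos[OF x] powr_mono[of "-\<kappa>" 0 "real_of_int (sq_norm x)"] d2 x
        unfolding g_def by (simp add: \<kappa>_def)
      ultimately have "c * g x \<le> h x"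
        using c0 by (meson less_imp_le mult_left_le order_trans)
      then show ?thesis using hs by linarith
    qed
    show "f x \<le> step_mean f x"
      using hs gs by (simp add: f_def[of x])
  qed
qed

section \<open>From a subharmonic function to a lower bound for hitting probabilities\<close>

lemma exp_minus_le_inverse:
  fixes t :: real
  assumes "t > 0"
  shows "exp (- t) \<le> 1 / t"
proof -
  have "t \<le> exp t" using exp_ge_add_one_self[of t] by linarith
  then show ?thesis using assms by (simp add: exp_minus field_simps)
qed

text \<open>\<open>hit_prob_ge\<close> for the function of \<open>ex_subharmonic\<close>, with a
  slab of half-width \<open>A * r\<close> as \<open>R\<close>. The starting value is at least
  \<open>c / r ^ (d - 1)\<close>; leaving the slab and lingering in it account for at most a quarter
  of this each, and \<open>F\<close> is of order \<open>(\<rho> + 1) ^ (1 - d)\<close>. Writing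
  \<open>\<rho> + 1\<close> includes the single site \<open>\<rho> = 0\<close>.\<close>

lemma ex_hit_prob_bound:
  assumes d: "CARD('d::finite) \<ge> 2"
  shows "\<exists>c>0. c \<le> 1 \<and> (\<exists>r0. \<forall>r\<ge>r0. \<forall>\<rho>\<le>r. \<forall>x :: int ^ 'd. l1_norm x \<le> int r \<longrightarrow>
    c * ((real \<rho> + 1) / real r) ^ (CARD('d) - 1)
      \<le> hit_prob (r ^ (CARD('d) + 3)) {y. sq_norm y \<le> int \<rho> ^ 2} x)"
proof -
  let ?d = "real CARD('d)" and ?\<beta> = "CARD('d) - 1"
  obtain f :: "int ^ 'd \<Rightarrow> real" and c C where c: "0 < c" and C: "1 \<le> C" and f0: "f 0 \<le> 1"
    and f: "\<forall>x. x \<noteq> 0 \<longrightarrow>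
      f x \<le> step_mean f x \<and>
      c / sqrt (sq_norm x) ^ (CARD('d) - 1) \<le> f x \<and>
      f x \<le> C / sqrt (sq_norm x) ^ (CARD('d) - 1)"
    using ex_subharmonic[OF d] by (elim exE conjE)
  have sub: "f x \<le> step_mean f x"
    and fl: "c / sqrt (sq_norm x) ^ (CARD('d) - 1) \<le> f x"
    and fu: "f x \<le> C / sqrt (sq_norm x) ^ (CARD('d) - 1)" if "x \<noteq> 0" for x
    using f that by blast+
  \<comment> \<open>Large enough that \<open>f\<close> is at most
    \<open>(c / 4) / r ^ (d - 1)\<close> outside both slab and ball.\<close>
  define A where "A = nat \<lceil>4 * C / c\<rceil> + 1"
  have A: "real A \<ge> 4 * C / c" "A \<ge> 1" unfolding A_def by linarith+
  \<comment> \<open>The factor \<open>3 ^ (d - 1)\<close> pays for points one step from outside the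
    ball, which may be as close to the centre as \<open>(\<rho> + 1) / 3\<close>.\<close>
  define D where "D = C * 3 ^ ?\<beta>"
  have "C * 1 \<le> C * 3 ^ ?\<beta>" using C by (intro mult_left_mono) auto
  then have D': "D \<ge> C" unfolding D_def by (simp only: mult_1_right)
  then have D: "D \<ge> 1" using C by linarith
  \<comment> \<open>From here on the lingering term is at most
    \<open>(c / 4) / r ^ (d - 1)\<close>.\<close>
  define r0 where "r0 = nat \<lceil>16 * D * ?d * real A ^ 2 / c\<rceil> + 1"
  define c' where "c' = min 1 (min (c / (2 * D)) (1 / 2 ^ ?\<beta>))"
  have c': "c' > 0" "c' \<le> 1" "c' \<le> c / (2 * D)" "c' \<le> 1 / 2 ^ ?\<beta>" using c D by (auto simp: c'_def)
  have d2: "?d \<ge> 2" using d by simp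
  have b1: "?\<beta> \<ge> 1" using d by simp
  obtain i :: 'd where True by blast
  have "c' * ((real \<rho> + 1) / real r) ^ ?\<beta> \<le> hit_prob (r ^ (CARD('d) + 3)) {y. sq_norm y \<le> int \<rho> ^ 2} x"
    if r: "r \<ge> r0" and \<rho>: "\<rho> \<le> r" and x: "l1_norm x \<le> int r" for r \<rho> and x :: "int ^ 'd"
  proof -
    let ?B = "{y :: int ^ 'd. sq_norm y \<le> int \<rho> ^ 2}" and ?R = "{y :: int ^ 'd. \<bar>y $ i\<bar> < int (A * r)}"
    let ?n = "r ^ (CARD('d) + 3)"
    have "real r0 \<ge> 16 * D * ?d * real A ^ 2 / c" unfolding r0_def by linarith
    then have r_large: "real r \<ge> 16 * D * ?d * real A ^ 2 / c"
      using r by (meson of_nat_le_iff order_trans)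
    have r1: "r \<ge> 1" using r by (simp add: r0_def)
    show ?thesis
    proof (cases "x \<in> ?B")
      case True
      have hit_1: "hit_prob n ?B x = 1" for n
        using True by (cases n) (auto simp: hit_prob_0 hit_prob_Suc)
      have "((real \<rho> + 1) / real r) ^ ?\<beta> \<le> 2 ^ ?\<beta>"
        using \<rho> r1 by (intro power_mono) (auto simp: field_simps)
      then have "c' * ((real \<rho> + 1) / real r) ^ ?\<beta> \<le> (1 / 2 ^ ?\<beta>) * 2 ^ ?\<beta>"
        using c' by (intro mult_mono) auto
      also have "\<dots> = hit_prob ?n ?B x"
        using hit_1 by simp
      finally show ?thesis .
    next
      case False
      define F where "F = D / (real \<rho> + 1) ^ ?\<beta>"
      define m where "m = C / real (A * r) ^ ?\<beta>"
      have notB: "y \<noteq> 0" if "y \<notin> ?B" for y :: "int ^ 'd" using that by auto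
      \<comment> \<open>Applied with \<open>a = \<rho>\<close> and \<open>s\<close> the norm of a
        point one step from outside the ball: that norm is at least \<open>\<rho> - 1\<close>, and
        at least 1 away from the origin.\<close>
      have third: "(a + 1) / 3 \<le> s" if "a - 1 \<le> s" "1 \<le> s" for a s :: real
        using that by simp
      \<comment> \<open>The second premise reflects that the origin is one step from outside the
        ball only if the ball is a single site.\<close>
      have far: "f y \<le> F" if "real_of_int (sq_norm y) \<ge> (real \<rho> - 1)^2" "y = 0 \<Longrightarrow> \<rho> = 0" for y
      proof (cases "y = 0")
        case True
        then show ?thesis using f0 D that(2) by (simp add: F_def)
      next
        case False
        have s1: "sqrt (sq_norm y) \<ge> 1" using real_sq_norm_pos[OF False] by simp
        have "real \<rho> - 1 \<le> sqrt (sq_norm y)" by (rule real_le_rsqrt) (rule that(1))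
        then have "(real \<rho> + 1) / 3 \<le> sqrt (sq_norm y)" using s1 third by blast
        then have "((real \<rho> + 1) / 3) ^ ?\<beta> \<le> sqrt (sq_norm y) ^ ?\<beta>" by (intro power_mono) auto
        moreover have "((real \<rho> + 1) / 3) ^ ?\<beta> > 0" by simp
        ultimately have "C / sqrt (sq_norm y) ^ ?\<beta> \<le> C / ((real \<rho> + 1) / 3) ^ ?\<beta>"
          using C s1 by (intro divide_left_mono mult_pos_pos zero_less_power) auto
        also have "\<dots> = F" by (simp add: F_def D_def power_divide)
        finally show ?thesis using fu[OF False] by linarith
      qed
      have nbF: "f (y + v) \<le> F" if yB: "y \<notin> ?B" and v': "v \<in> unit_steps" for y v
      proof -
        have ge: "real_of_int (sq_norm y) > real \<rho> ^ 2"
          using yB by (metis (mono_tags, lifting) mem_Collect_eq not_le of_int_less_iff of_int_of_nat_eq of_int_power)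
        obtain k s where v: "v = axis k s" and s: "s = 1 \<or> s = -1"
          using v' by (auto simp: unit_steps_eq)
        have ss: "s\<^sup>2 = 1" using s by auto
        define t where "t = sqrt (sq_norm y)"
        have tt: "t ^ 2 = real_of_int (sq_norm y)" unfolding t_def using sq_norm_nonneg[of y] by simp
        have "t > real \<rho>" unfolding t_def using ge by (rule real_less_rsqrt)
        have "real_of_int ((y $ k)^2) \<le> real_of_int (sq_norm y)"
          unfolding of_int_le_iff sq_norm_def by (rule member_le_sum) auto
        then have "\<bar>real_of_int (y $ k)\<bar> \<le> t"
          unfolding t_def by (simp add: real_le_rsqrt)
        then have "- t \<le> s * real_of_int (y $ k)" using s by auto
        then have "(t - 1)^2 \<le> real_of_int (sq_norm (y + v))"
          by (simp add: v sq_norm_add_axis ss power2_diff tt)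
        moreover have "(real \<rho> - 1)^2 \<le> (t - 1)^2 \<or> \<rho> = 0"
          using \<open>t > real \<rho>\<close> by (cases "\<rho> = 0") (auto intro!: power_mono)
        ultimately show ?thesis
        proof (cases "\<rho> = 0")
          case True
          show ?thesis
          proof (cases "y + v = 0")
            case True
            then show ?thesis using f0 D \<open>\<rho> = 0\<close> by (simp add: F_def)
          next
            case False
            then show ?thesis using real_sq_norm_pos[OF False] \<open>\<rho> = 0\<close> by (intro far) auto
          qed
        next
          case False
          have "0 \<noteq> y + v" if "\<rho> \<ge> 1"
          proof
            assume "0 = y + v"
            then have "(t - 1)^2 \<le> 0" using \<open>(t - 1)^2 \<le> real_of_int (sq_norm (y + v))\<close> by simp
            then have "t = 1" by simp
            then show False using \<open>t > real \<rho>\<close> that by simp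
          qed
          moreover have "(real \<rho> - 1)^2 \<le> (t - 1)^2"
            using \<open>t > real \<rho>\<close> False by (intro power_mono) auto
          ultimately show ?thesis
            using False \<open>(t - 1)^2 \<le> real_of_int (sq_norm (y + v))\<close> by (intro far) auto
        qed
      qed
      have fx: "f x \<le> F"
      proof (rule far)
        have "real_of_int (sq_norm x) > real \<rho> ^ 2"
          using False by (metis (mono_tags, lifting) mem_Collect_eq not_le of_int_less_iff of_int_of_nat_eq of_int_power)
        moreover have "(real \<rho> - 1)^2 \<le> real \<rho> ^ 2" if "\<rho> \<noteq> 0"
          using that by (intro power_mono) auto
        ultimately show "(real \<rho> - 1)^2 \<le> real_of_int (sq_norm x)"
          using real_sq_norm_pos[OF notB[OF False]] by (cases "\<rho> = 0") (simp, linarith)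
      qed (use notB[OF False] in auto)
      have outm: "f y \<le> m" if "y \<notin> ?R" "y \<notin> ?B" for y
      proof -
        have "real_of_int ((y $ i)^2) \<le> real_of_int (sq_norm y)"
          unfolding of_int_le_iff sq_norm_def by (rule member_le_sum) auto
        then have "\<bar>real_of_int (y $ i)\<bar> \<le> sqrt (sq_norm y)" by (simp add: real_le_rsqrt)
        moreover have "real (A * r) \<le> \<bar>real_of_int (y $ i)\<bar>"
          using that(1) by (simp del: of_nat_mult)
        ultimately have "real (A * r) ^ ?\<beta> \<le> sqrt (sq_norm y) ^ ?\<beta>" by (intro power_mono) auto
        moreover have "real (A * r) ^ ?\<beta> > 0" using A r1 by simp
        ultimately have "C / sqrt (sq_norm y) ^ ?\<beta> \<le> m"
          unfolding m_def using C by (intro divide_left_mono mult_pos_pos) auto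
        then show ?thesis using fu[OF notB[OF that(2)]] by linarith
      qed
      have F0: "0 \<le> F" using D by (simp add: F_def)
      have "f x \<le> F * hit_prob ?n ?B x + m + F * stay_prob ?n ?R x"
        by (rule hit_prob_ge) (use sub notB outm nbF F0 fx C in \<open>auto simp: m_def\<close>)
      moreover have "c / real r ^ ?\<beta> \<le> f x"
      proof -
        have "real_of_int (sq_norm x) \<le> (real_of_int (l1_norm x))^2"
          using sq_norm_le_l1_norm[of x] by (metis of_int_le_iff of_int_power)
        also have "\<dots> \<le> real r ^ 2" using x l1_norm_nonneg[of x] by (intro power_mono) linarith+
        finally have "sqrt (sq_norm x) \<le> real r" by (intro real_le_lsqrt) auto
        moreover have "sqrt (sq_norm x) > 0" using real_sq_norm_pos[OF notB[OF False]] by simp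
        ultimately have "c / real r ^ ?\<beta> \<le> c / sqrt (sq_norm x) ^ ?\<beta>"
          using c r1 by (intro divide_left_mono power_mono mult_pos_pos) auto
        then show ?thesis using fl[OF notB[OF False]] by linarith
      qed
      moreover have "m \<le> (c / 4) / real r ^ ?\<beta>"
      proof -
        have "real A \<le> real A ^ ?\<beta>" using A b1 by (intro self_le_power) auto
        then have "4 * C / c \<le> real A ^ ?\<beta>" using A by linarith
        then have "C / real A ^ ?\<beta> \<le> C / (4 * C / c)"
          using c C A by (intro divide_left_mono mult_pos_pos) auto
        also have "\<dots> = c / 4" using c C by simp
        finally have "C / real A ^ ?\<beta> / real r ^ ?\<beta> \<le> (c / 4) / real r ^ ?\<beta>"
          by (intro divide_right_mono) auto
        then show ?thesis by (simp add: m_def power_mult_distrib)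
      qed
      moreover have "F * stay_prob ?n ?R x \<le> (c / 4) / real r ^ ?\<beta>"
      proof -
        \<comment> \<open>After \<open>r ^ (d + 3)\<close> steps the exponent is of order
          \<open>r ^ (d + 1)\<close>; even the crude bound \<open>1 / t\<close> for
          \<open>exp (- t)\<close> then leaves a spare factor \<open>1 / r ^ 2\<close> against
          \<open>1 / r ^ (d - 1)\<close>.\<close>
        have "stay_prob ?n ?R x \<le> 2 * exp (- real ?n / (2 * ?d * real (A * r) ^ 2))"
          using A r1 by (intro stay_prob_slab_le) simp
        moreover have "exp (- real ?n / (2 * ?d * real (A * r) ^ 2)) \<le> 1 / (real ?n / (2 * ?d * real (A * r) ^ 2))"
          using exp_minus_le_inverse[of "real ?n / (2 * ?d * real (A * r) ^ 2)"] A r1 by simp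
        ultimately have "stay_prob ?n ?R x \<le> 2 * (1 / (real ?n / (2 * ?d * real (A * r) ^ 2)))" by linarith
        also have "real ?n = real r ^ (CARD('d) + 1) * real r ^ 2"
          by (simp add: power_add eval_nat_numeral)
        also have "2 * (1 / (real r ^ (CARD('d) + 1) * real r ^ 2 / (2 * ?d * real (A * r) ^ 2)))
            = 4 * ?d * real A ^ 2 / real r ^ (CARD('d) + 1)"
          using r1 by (simp add: power_mult_distrib)
        also have "real r ^ (CARD('d) + 1) = real r ^ ?\<beta> * real r ^ 2"
          using d by (simp add: power_add[symmetric])
        finally have st: "stay_prob ?n ?R x \<le> 4 * ?d * real A ^ 2 / (real r ^ ?\<beta> * real r ^ 2)" by simp
        have "F \<le> D" using D by (simp add: F_def divide_le_eq mult_le_cancel_left1)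
        then have "F * stay_prob ?n ?R x \<le> D * (4 * ?d * real A ^ 2 / (real r ^ ?\<beta> * real r ^ 2))"
          using st F0 D stay_prob_nonneg by (intro mult_mono) auto
        also have "\<dots> = (4 * D * ?d * real A ^ 2 / real r ^ 2) / real r ^ ?\<beta>" by (simp add: mult_ac)
        also have "\<dots> \<le> (c / 4) / real r ^ ?\<beta>"
        proof (intro divide_right_mono)
          have "16 * D * ?d * real A ^ 2 \<le> c * real r" using r_large c by (simp add: field_simps)
          also have "\<dots> \<le> c * real r ^ 2"
            using c r1 by (intro mult_left_mono) (auto simp: power2_eq_square)
          finally show "4 * D * ?d * real A ^ 2 / real r ^ 2 \<le> c / 4"
            using r1 by (simp add: field_simps)
        qed simp
        finally show ?thesis .
      qed
      ultimately have "(c / 2) / real r ^ ?\<beta> \<le> F * hit_prob ?n ?B x" by simp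
      then have "(c / 2) / real r ^ ?\<beta> * (real \<rho> + 1) ^ ?\<beta> / D \<le> hit_prob ?n ?B x"
      proof (subst pos_divide_le_eq)
        assume "(c / 2) / real r ^ ?\<beta> \<le> F * hit_prob ?n ?B x"
        then have "(c / 2) / real r ^ ?\<beta> * (real \<rho> + 1) ^ ?\<beta> \<le> F * hit_prob ?n ?B x * (real \<rho> + 1) ^ ?\<beta>"
          by (intro mult_right_mono) auto
        also have "\<dots> = hit_prob ?n ?B x * D" by (simp add: F_def)
        finally show "(c / 2) / real r ^ ?\<beta> * (real \<rho> + 1) ^ ?\<beta> \<le> hit_prob ?n ?B x * D" .
      qed (use D in auto)
      moreover have "c' * ((real \<rho> + 1) / real r) ^ ?\<beta> \<le> c / (2 * D) * ((real \<rho> + 1) / real r) ^ ?\<beta>"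
        using c'(3) by (intro mult_right_mono) auto
      ultimately show ?thesis by (simp add: power_divide mult_ac)
    qed
  qed
  then show ?thesis using c' by blast
qed

section \<open>Passage times\<close>

abbreviation slow_passage ::
  "'w measure \<Rightarrow> (int ^ 'd \<Rightarrow> nat \<Rightarrow> 'w \<Rightarrow> int ^ 'd) \<Rightarrow> int ^ 'd \<Rightarrow> int ^ 'd \<Rightarrow> nat \<Rightarrow> 'w set" where
  "slow_passage M S x y m \<equiv> {\<omega> \<in> space M. \<not> first_passage_time S \<omega> x y \<le> enat m}"

lemma hitting_time_le_iff: "hitting_time S \<omega> x y \<le> enat n \<longleftrightarrow> (\<exists>j\<le>n. S x j \<omega> = y)"
proof -
  have "hitting_time S \<omega> x y \<le> enat n \<longleftrightarrow> hitting_time S \<omega> x y < enat (Suc n)"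
    by (cases "hitting_time S \<omega> x y") auto
  also have "\<dots> \<longleftrightarrow> (\<exists>j\<le>n. S x j \<omega> = y)"
    by (auto simp: hitting_time_def INF_less_iff less_Suc_eq_le)
  finally show ?thesis .
qed

lemma chain_time_singleton [simp]: "chain_time S \<omega> [x] = 0"
  by (simp add: chain_time_def)

lemma chain_time_Cons_Cons:
  "chain_time S \<omega> (x # y # ys) = hitting_time S \<omega> x y + chain_time S \<omega> (y # ys)"
  by (simp add: chain_time_def sum.lessThan_Suc_shift del: sum.lessThan_Suc)

lemma chain_time_append:
  "chain_time S \<omega> (xs @ y # zs) = chain_time S \<omega> (xs @ [y]) + chain_time S \<omega> (y # zs)"
proof (induction xs)
  case (Cons x xs)
  then show ?case
    by (cases xs) (simp_all add: chain_time_Cons_Cons add.assoc)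
qed simp

lemma first_passage_time_le_chain_time:
  "ys \<noteq> [] \<Longrightarrow> hd ys = x \<Longrightarrow> last ys = y \<Longrightarrow> first_passage_time S \<omega> x y \<le> chain_time S \<omega> ys"
  by (auto simp: first_passage_time_def intro: INF_lower)

text \<open>\<open>enat\<close> is well-ordered, so the infimum over the nonempty set of chains is
  attained, also when it is infinite.\<close>

lemma chain_time_attains:
  obtains ys where "ys \<noteq> []" "hd ys = x" "last ys = y"
    "chain_time S \<omega> ys = first_passage_time S \<omega> x y"
proof -
  let ?A = "chain_time S \<omega> ` {ys. ys \<noteq> [] \<and> hd ys = x \<and> last ys = y}"
  have "[x, y] \<in> {ys. ys \<noteq> [] \<and> hd ys = x \<and> last ys = y}" by simp
  then obtain a where "a \<in> ?A" by blast
  then have "Inf ?A \<in> ?A" by (auto simp: Inf_enat_def intro: LeastI)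
  then show ?thesis using that by (auto simp: first_passage_time_def)
qed

lemma first_passage_time_refl: "first_passage_time S \<omega> x x = 0"
  using first_passage_time_le_chain_time[of "[x]" x x S \<omega>] by simp

lemma first_passage_time_triangle:
  "first_passage_time S \<omega> x z \<le> first_passage_time S \<omega> x y + first_passage_time S \<omega> y z"
proof -
  obtain xs where xs: "xs \<noteq> []" "hd xs = x" "last xs = y" "chain_time S \<omega> xs = first_passage_time S \<omega> x y"
    by (rule chain_time_attains)
  obtain ys where ys: "ys \<noteq> []" "hd ys = y" "last ys = z" "chain_time S \<omega> ys = first_passage_time S \<omega> y z"
    by (rule chain_time_attains)
  obtain zs where zs: "ys = y # zs" using ys by (cases ys) auto
  obtain as where as: "xs = as @ [y]" using xs by (metis append_butlast_last_id)
  have "hd (as @ ys) = x" using xs zs as by (cases as) auto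
  then have "first_passage_time S \<omega> x z \<le> chain_time S \<omega> (as @ ys)"
    using ys by (intro first_passage_time_le_chain_time) auto
  also have "\<dots> = chain_time S \<omega> xs + chain_time S \<omega> ys"
    using chain_time_append[of S \<omega> as y zs] as zs by simp
  finally show ?thesis by (simp add: xs ys)
qed

lemma first_passage_time_le_hitting_time: "first_passage_time S \<omega> x y \<le> hitting_time S \<omega> x y"
  using first_passage_time_le_chain_time[of "[x, y]" x y S \<omega>] by (simp add: chain_time_Cons_Cons)

text \<open>Among the chains attaining the infimum a shortest one has no repeated vertex, since
  cutting out a loop does not increase the chain time. This holds at every sample point, not just
  almost surely.\<close>

lemma ex_optimal_path: "optimal_paths S \<omega> x y \<noteq> {}"
proof -
  let ?P = "\<lambda>ys. ys \<noteq> [] \<and> hd ys = x \<and> last ys = y \<and> chain_time S \<omega> ys = first_passage_time S \<omega> x y"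
  obtain ys0 where "?P ys0" using chain_time_attains[of x y S \<omega>] by blast
  then obtain ys where ys: "?P ys" and min: "\<And>zs. ?P zs \<Longrightarrow> length ys \<le> length zs"
    using ex_has_least_nat[of ?P ys0 length] by blast
  have "distinct ys"
  proof (rule ccontr)
    assume "\<not> distinct ys"
    then obtain as bs cs z where eq: "ys = as @ [z] @ bs @ [z] @ cs"
      using not_distinct_decomp by blast
    let ?zs = "as @ z # cs"
    have "chain_time S \<omega> ys
        = chain_time S \<omega> (as @ [z]) + (chain_time S \<omega> (z # bs @ [z]) + chain_time S \<omega> (z # cs))"
      using chain_time_append[of S \<omega> as z "bs @ z # cs"] chain_time_append[of S \<omega> "z # bs" z cs]
      by (simp add: eq)
    then have "chain_time S \<omega> ?zs \<le> chain_time S \<omega> ys"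
      by (simp add: chain_time_append[of S \<omega> as z cs] add_left_mono)
    moreover have "?zs \<noteq> []" "hd ?zs = x" "last ?zs = y"
      using ys by (auto simp: eq hd_append split: if_splits)
    ultimately have "?P ?zs"
      using ys first_passage_time_le_chain_time[of ?zs x y S \<omega>] by auto
    then have "length ys \<le> length ?zs" by (rule min)
    then show False by (simp add: eq)
  qed
  then have "ys \<in> optimal_paths S \<omega> x y"
    using ys by (simp add: optimal_paths_def is_path_def)
  then show ?thesis by blast
qed

text \<open>A walk sits at its own vertex at time 0, so each hop to a different vertex takes at
  least one unit of time; the \<open>+ 1\<close> is the difference between vertices and
  hops.\<close>

lemma length_le_chain_time:
  assumes start: "\<And>x. S x 0 \<omega> = x" and "distinct ys" "ys \<noteq> []"
  shows "enat (length ys) \<le> chain_time S \<omega> ys + 1"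
  using assms(2,3)
proof (induction ys rule: induct_list012)
  case (3 x y ys)
  have "\<not> hitting_time S \<omega> x y \<le> enat 0"
    using 3(3) start by (simp add: hitting_time_le_iff del: enat_0 enat_0_iff)
  then have "1 \<le> hitting_time S \<omega> x y"
    by (cases "hitting_time S \<omega> x y") (auto simp: one_enat_def zero_enat_def)
  moreover have "enat (length (y # ys)) \<le> chain_time S \<omega> (y # ys) + 1"
    using 3 by simp
  ultimately have "1 + enat (length (y # ys)) \<le> hitting_time S \<omega> x y + (chain_time S \<omega> (y # ys) + 1)"
    by (rule add_mono)
  then show ?case
    by (simp add: chain_time_Cons_Cons add.assoc one_enat_def)
qed (simp_all add: one_enat_def)

section \<open>Finite boxes and balls of the lattice\<close>

lemma finite_vec_box: "finite {y :: int ^ 'd. \<forall>i. y $ i \<in> {a..b}}"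
proof (rule finite_subset)
  show "{y :: int ^ 'd. \<forall>i. y $ i \<in> {a..b}} \<subseteq> vec_lambda ` (PiE UNIV (\<lambda>_. {a..b}))"
    by (auto simp: PiE_UNIV_domain intro!: image_eqI[of _ vec_lambda "vec_nth _"])
  show "finite (vec_lambda ` (PiE UNIV (\<lambda>_. {a..b})) :: (int ^ 'd) set)"
    by (intro finite_imageI finite_PiE) auto
qed

lemma card_vec_box: "card {y :: int ^ 'd. \<forall>i. 0 \<le> y $ i \<and> y $ i < int m} = m ^ CARD('d)"
proof -
  have "bij_betw vec_lambda (PiE UNIV (\<lambda>_ :: 'd. {0..<int m})) {y :: int ^ 'd. \<forall>i. 0 \<le> y $ i \<and> y $ i < int m}"
    by (rule bij_betwI[of _ _ _ vec_nth]) (auto simp: PiE_UNIV_domain)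
  then show ?thesis
    by (simp add: bij_betw_same_card[symmetric] card_PiE)
qed

lemma abs_vec_nth_le_l1_norm: "\<bar>x $ i\<bar> \<le> l1_norm x"
  unfolding l1_norm_def by (rule member_le_sum) auto

lemma finite_l1_ball: "finite {y :: int ^ 'd. l1_norm (y - z) \<le> m}"
proof -
  have "{y :: int ^ 'd. l1_norm y \<le> m} \<subseteq> {y. \<forall>i. y $ i \<in> {-m..m}}"
  proof safe
    fix y :: "int ^ 'd" and i assume "l1_norm y \<le> m"
    then show "y $ i \<in> {-m..m}" using abs_vec_nth_le_l1_norm[of y i] by (simp add: abs_le_iff)
  qed
  then have "finite {y :: int ^ 'd. l1_norm y \<le> m}" using finite_vec_box finite_subset by blast
  then have "finite ((\<lambda>y. y + z) ` {y :: int ^ 'd. l1_norm y \<le> m})" by simp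
  moreover have "{y :: int ^ 'd. l1_norm (y - z) \<le> m} \<subseteq> (\<lambda>y. y + z) ` {y. l1_norm y \<le> m}"
    by (auto intro!: image_eqI[of _ _ "_ - z"])
  ultimately show ?thesis using finite_subset by blast
qed

lemma sq_norm_diff_le_imp_abs_le:
  assumes "sq_norm x \<le> (int \<rho>)\<^sup>2" shows "\<bar>x $ i\<bar> \<le> int \<rho>"
proof -
  have "(x $ i)\<^sup>2 \<le> sq_norm x" unfolding sq_norm_def by (rule member_le_sum) auto
  then have "(x $ i)\<^sup>2 \<le> (int \<rho>)\<^sup>2" using assms by linarith
  then show ?thesis using abs_le_square_iff[of "x $ i" "int \<rho>"] by simp
qed

lemma l1_norm_le_card_times:
  fixes x :: "int ^ 'd"
  assumes "\<And>i. \<bar>x $ i\<bar> \<le> m" shows "l1_norm x \<le> int CARD('d) * m"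
  unfolding l1_norm_def using sum_mono[of UNIV "\<lambda>i. \<bar>x $ i\<bar>" "\<lambda>_. m"] assms by simp

section \<open>One stage: many walks aiming at many targets\<close>

context independent_simple_random_walks
begin

lemma start: "\<omega> \<in> space M \<Longrightarrow> S x 0 \<omega> = x"
  using simple_random_walk.start[OF walk] .

lemma measurable_S [measurable]: "S x j \<in> measurable M (count_space UNIV)"
  using simple_random_walk.measurable_walk[OF walk] .

text \<open>Measurability is read off from \<open>indep_vars_local\<close> for a family with one
  member.\<close>

lemma local_measurable:
  fixes f :: "'w \<Rightarrow> 'c"
  assumes "finite K" and "\<And>\<omega> \<omega>'. \<omega> \<in> space M \<Longrightarrow> \<omega>' \<in> space M \<Longrightarrow>
      (\<And>x j. x \<in> K \<Longrightarrow> j \<le> n \<Longrightarrow> S x j \<omega> = S x j \<omega>') \<Longrightarrow> f \<omega> = f \<omega>'"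
  shows "f \<in> measurable M (count_space UNIV)"
proof -
  have "indep_vars (\<lambda>_. count_space UNIV) (\<lambda>_. f) {()}"
    by (rule indep_vars_local[of _ "\<lambda>_. K" n]) (simp add: assms(1) disjoint_family_on_def, simp add: disjoint_family_on_def, erule assms(2), blast+)
  then show ?thesis by (simp add: indep_vars_def2)
qed

lemma prob_hit: "prob {\<omega> \<in> space M. \<exists>j\<le>n. S a j \<omega> \<in> B} = hit_prob n B a"
proof -
  have "prob {\<omega> \<in> space M. \<exists>j\<le>n. (\<lambda>j. S a j \<omega>) j \<in> B}
      = walk_mean n (\<lambda>vs. of_bool (\<exists>j\<le>n. a + sum_list (take j vs) \<in> B))"
    by (rule simple_random_walk.prob_walk[OF walk, of n "\<lambda>w. \<exists>j\<le>n. w j \<in> B"]) auto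
  then show ?thesis by (simp add: hit_prob_def)
qed

lemma AE_unit_steps: "AE \<omega> in M. \<forall>x j. S x (Suc j) \<omega> - S x j \<omega> \<in> unit_steps"
proof -
  have "AE \<omega> in M. S x (Suc j) \<omega> - S x j \<omega> \<in> unit_steps" for x :: "int ^ 'd" and j
  proof -
    interpret W: simple_random_walk M x "S x" by (rule walk)
    have "measure M {\<omega> \<in> space M. S x (Suc j) \<omega> - S x j \<omega> \<in> unit_steps} = 1"
    proof -
      have "measure M {\<omega> \<in> space M. S x (Suc j) \<omega> - S x j \<omega> \<in> unit_steps}
          = measure (distr M (count_space UNIV) (\<lambda>\<omega>. S x (Suc j) \<omega> - S x j \<omega>)) unit_steps"
        by (subst measure_distr) (auto intro!: arg_cong[where f = prob])
      also have "\<dots> = measure_pmf.prob (pmf_of_set unit_steps) (unit_steps :: (int ^ 'd) set)"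
        by (simp add: W.distr_increment)
      also have "\<dots> = 1"
        by (simp add: measure_pmf_of_set finite_unit_steps unit_steps_nonempty)
      finally show ?thesis .
    qed
    then show ?thesis
      by (subst (asm) prob_Collect_eq_1) (auto intro!: measurable_sets_Collect[OF W.measurable_increment])
  qed
  then show ?thesis by (simp add: AE_all_countable)
qed

text \<open>Given \<open>A \<omega> = A0\<close>, the walks started in \<open>A0\<close> are still independent, since \<open>A\<close> depends only on
  the walks started in \<open>U\<close>.\<close>

lemma hit_stage:
  assumes fin: "finite U" "finite D" "finite I" and disj: "U \<inter> D = {}"
    and A_loc: "\<And>\<omega> \<omega>'. \<omega> \<in> space M \<Longrightarrow> \<omega>' \<in> space M \<Longrightarrow>
      (\<And>x j. x \<in> U \<Longrightarrow> j \<le> n \<Longrightarrow> S x j \<omega> = S x j \<omega>') \<Longrightarrow> A \<omega> = A \<omega>'"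
    and A_sub: "\<And>\<omega>. A \<omega> \<subseteq> D"
    and p: "\<And>a i. a \<in> D \<Longrightarrow> i \<in> I \<Longrightarrow> p \<le> hit_prob n (Q i) a" "0 \<le> p" "p \<le> 1"
  shows "prob {\<omega> \<in> space M. N \<le> card (A \<omega>) \<and> (\<exists>i\<in>I. \<forall>a\<in>A \<omega>. \<forall>j\<le>n. S a j \<omega> \<notin> Q i)}
    \<le> real (card I) * (1 - p) ^ N"
proof -
  define E where "E i A0 = {\<omega> \<in> space M. A \<omega> = A0 \<and> (\<forall>a\<in>A0. \<forall>j\<le>n. S a j \<omega> \<notin> Q i)}" for i A0
  define Ps where "Ps = {A0 \<in> Pow D. N \<le> card A0}"
  have finP: "finite Ps" using fin by (simp add: Ps_def)
  have mA: "A \<in> measurable M (count_space UNIV)"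
    by (rule local_measurable[OF fin(1) A_loc])
  have mS: "{\<omega> \<in> space M. S a j \<omega> \<in> B} \<in> events" for a j B
    by (rule measurable_sets_Collect[OF measurable_S]) auto
  have miss_ev: "{\<omega> \<in> space M. \<forall>j\<le>n. S a j \<omega> \<notin> Q i} \<in> events" for a i
  proof -
    have "{\<omega> \<in> space M. \<forall>j\<le>n. S a j \<omega> \<notin> Q i} = space M - (\<Union>j\<in>{..n}. {\<omega> \<in> space M. S a j \<omega> \<in> Q i})" by auto
    then show ?thesis using mS by simp
  qed
  have A_ev: "{\<omega> \<in> space M. A \<omega> = A0} \<in> events" for A0
    by (rule measurable_sets_Collect[OF mA, of "\<lambda>x. x = A0"]) auto
  have E_le: "prob (E i A0) \<le> prob {\<omega> \<in> space M. A \<omega> = A0} * (1 - p) ^ N" and E_ev: "E i A0 \<in> events"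
    if "i \<in> I" "A0 \<in> Ps" for i A0
  proof -
    have A0: "A0 \<subseteq> D" "finite A0" "N \<le> card A0" using that fin finite_subset by (auto simp: Ps_def)
    \<comment> \<open>\<open>None\<close> stands for the event on the walks from \<open>U\<close>,
      and \<open>Some a\<close> for a miss by the walk from \<open>a\<close>; together they form one
      independent family.\<close>
    define f where "f k \<omega> = (case k of None \<Rightarrow> A \<omega> = A0 | Some a \<Rightarrow> \<forall>j\<le>n. S a j \<omega> \<notin> Q i)" for k \<omega>
    define K where "K k = (case k of None \<Rightarrow> U | Some a \<Rightarrow> {a})" for k
    have ind: "indep_vars (\<lambda>_. count_space UNIV) f (insert None (Some ` A0))"
    proof (rule indep_vars_local[of _ K n])
      show "disjoint_family_on K (insert None (Some ` A0))"
        using disj A0 by (auto simp: disjoint_family_on_def K_def)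
      fix k \<omega> \<omega>' assume "k \<in> insert None (Some ` A0)" "\<omega> \<in> space M" "\<omega>' \<in> space M"
        and agree: "\<And>x j. x \<in> K k \<Longrightarrow> j \<le> n \<Longrightarrow> S x j \<omega> = S x j \<omega>'"
      then show "f k \<omega> = f k \<omega>'"
        using A_loc[of \<omega> \<omega>'] by (cases k) (auto simp: f_def K_def)
    qed (use fin in \<open>auto simp: K_def\<close>)
    have fN: "f None -` {True} \<inter> space M = {\<omega> \<in> space M. A \<omega> = A0}"
      by (intro set_eqI) (simp add: f_def conj_commute)
    have fS: "f (Some a) -` {True} \<inter> space M = {\<omega> \<in> space M. \<forall>j\<le>n. S a j \<omega> \<notin> Q i}" for a
      by (intro set_eqI) (simp add: f_def conj_commute)
    have "E i A0 = (\<Inter>k\<in>insert None (Some ` A0). f k -` {True} \<inter> space M)"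
    proof (rule set_eqI)
      fix \<omega>
      have "\<omega> \<in> (\<Inter>k\<in>insert None (Some ` A0). f k -` {True} \<inter> space M)
          \<longleftrightarrow> \<omega> \<in> f None -` {True} \<inter> space M \<and> (\<forall>a\<in>A0. \<omega> \<in> f (Some a) -` {True} \<inter> space M)"
        by auto
      also have "\<dots> \<longleftrightarrow> \<omega> \<in> E i A0" unfolding fN fS E_def by blast
      finally show "\<omega> \<in> E i A0 \<longleftrightarrow> \<omega> \<in> (\<Inter>k\<in>insert None (Some ` A0). f k -` {True} \<inter> space M)" ..
    qed
    also have "prob \<dots> = (\<Prod>k\<in>insert None (Some ` A0). prob (f k -` {True} \<inter> space M))"
      using A0 by (intro indep_varsD_finite[OF ind]) auto
    also have "\<dots> = prob {\<omega> \<in> space M. A \<omega> = A0} * (\<Prod>a\<in>A0. prob {\<omega> \<in> space M. \<forall>j\<le>n. S a j \<omega> \<notin> Q i})"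
      using A0 by (subst prod.insert) (auto simp: prod.reindex fN fS)
    also have "\<dots> \<le> prob {\<omega> \<in> space M. A \<omega> = A0} * (1 - p) ^ N"
    proof (intro mult_left_mono)
      have "prob {\<omega> \<in> space M. \<forall>j\<le>n. S a j \<omega> \<notin> Q i} \<le> 1 - p" if "a \<in> A0" for a
      proof -
        have "{\<omega> \<in> space M. \<forall>j\<le>n. S a j \<omega> \<notin> Q i} = space M - {\<omega> \<in> space M. \<exists>j\<le>n. S a j \<omega> \<in> Q i}"
          by auto
        moreover have "{\<omega> \<in> space M. \<exists>j\<le>n. S a j \<omega> \<in> Q i} \<in> events"
        proof -
          have "{\<omega> \<in> space M. \<exists>j\<le>n. S a j \<omega> \<in> Q i} = (\<Union>j\<in>{..n}. {\<omega> \<in> space M. S a j \<omega> \<in> Q i})" by auto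
          then show ?thesis using mS by simp
        qed
        ultimately show ?thesis
          using prob_hit[of n a "Q i"] p(1)[of a i] that A0 \<open>i \<in> I\<close> by (auto simp: prob_compl)
      qed
      then have "(\<Prod>a\<in>A0. prob {\<omega> \<in> space M. \<forall>j\<le>n. S a j \<omega> \<notin> Q i}) \<le> (\<Prod>a\<in>A0. 1 - p)"
        by (intro prod_mono) auto
      also have "\<dots> \<le> (1 - p) ^ N" using A0(3) p by (simp add: power_decreasing)
      finally show "(\<Prod>a\<in>A0. prob {\<omega> \<in> space M. \<forall>j\<le>n. S a j \<omega> \<notin> Q i}) \<le> (1 - p) ^ N" .
    qed simp
    finally show "prob (E i A0) \<le> prob {\<omega> \<in> space M. A \<omega> = A0} * (1 - p) ^ N" .
    have "E i A0 = {\<omega> \<in> space M. A \<omega> = A0} \<inter> (space M \<inter> (\<Inter>a\<in>A0. {\<omega> \<in> space M. \<forall>j\<le>n. S a j \<omega> \<notin> Q i}))"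
      by (auto simp: E_def)
    also have "\<dots> \<in> events"
      using A_ev miss_ev A0(2) by (cases "A0 = {}") (auto intro!: sets.Int sets.finite_INT)
    finally show "E i A0 \<in> events" .
  qed
  have "prob {\<omega> \<in> space M. N \<le> card (A \<omega>) \<and> (\<exists>i\<in>I. \<forall>a\<in>A \<omega>. \<forall>j\<le>n. S a j \<omega> \<notin> Q i)}
      \<le> prob (\<Union>i\<in>I. \<Union>A0\<in>Ps. E i A0)"
    using A_sub fin finP E_ev by (intro finite_measure_mono sets.finite_UN) (auto simp: E_def Ps_def)
  also have "\<dots> \<le> (\<Sum>i\<in>I. prob (\<Union>A0\<in>Ps. E i A0))"
    using fin finP E_ev by (intro finite_measure_subadditive_finite) auto
  also have "\<dots> \<le> (\<Sum>i\<in>I. (1 - p) ^ N)"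
  proof (rule sum_mono)
    fix i assume i: "i \<in> I"
    have "prob (\<Union>A0\<in>Ps. E i A0) \<le> (\<Sum>A0\<in>Ps. prob (E i A0))"
      using finP E_ev i by (intro finite_measure_subadditive_finite) auto
    also have "\<dots> \<le> (\<Sum>A0\<in>Ps. prob {\<omega> \<in> space M. A \<omega> = A0} * (1 - p) ^ N)"
      using E_le i by (intro sum_mono) auto
    also have "\<dots> = (\<Sum>A0\<in>Ps. prob {\<omega> \<in> space M. A \<omega> = A0}) * (1 - p) ^ N"
      by (simp add: sum_distrib_right)
    also have "(\<Sum>A0\<in>Ps. prob {\<omega> \<in> space M. A \<omega> = A0}) = prob (\<Union>A0\<in>Ps. {\<omega> \<in> space M. A \<omega> = A0})"
      using finP A_ev by (intro finite_measure_finite_Union[symmetric]) (auto simp: disjoint_family_on_def)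
    also have "\<dots> * (1 - p) ^ N \<le> 1 * (1 - p) ^ N"
      using p by (intro mult_right_mono) auto
    finally show "prob (\<Union>A0\<in>Ps. E i A0) \<le> (1 - p) ^ N" by simp
  qed
  finally show ?thesis by simp
qed

end

section \<open>Passage to a neighbour\<close>

lemma l1_norm_0 [simp]: "l1_norm 0 = 0"
  by simp

definition cell :: "int ^ 'd \<Rightarrow> nat \<Rightarrow> (int ^ 'd) set" where
  "cell z \<rho> = {y. sq_norm (y - z) \<le> (int \<rho>)\<^sup>2}"

definition grid :: "nat \<Rightarrow> (int ^ 'd) set" where
  "grid m = {v. \<forall>i. 0 \<le> v $ i \<and> v $ i < int m}"

text \<open>The spacing \<open>2 * \<rho> + 1\<close> makes cells of radius \<open>\<rho>\<close>
  around different centres disjoint; \<open>b\<close> pushes the whole box along coordinate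
  \<open>i\<close>.\<close>

definition centre :: "'d \<Rightarrow> int \<Rightarrow> nat \<Rightarrow> int ^ 'd \<Rightarrow> int ^ 'd" where
  "centre i b \<rho> v = (\<chi> k. (2 * int \<rho> + 1) * v $ k + (if k = i then b else 0))"

lemma hit_prob_cell: "hit_prob n (cell z \<rho>) a = hit_prob n {y. sq_norm y \<le> (int \<rho>)\<^sup>2} (a - z)"
  by (simp add: hit_prob_def cell_def algebra_simps)

lemma finite_grid: "finite (grid m)"
  by (rule finite_subset[OF _ finite_vec_box[of 0 "int m"]]) (auto simp: grid_def less_imp_le)

lemma card_grid: "card (grid m :: (int ^ 'd) set) = m ^ CARD('d)"
  by (simp add: grid_def card_vec_box)

lemma finite_cell: "finite (cell z \<rho>)"
proof (rule finite_subset)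
  show "cell z \<rho> \<subseteq> {y. l1_norm (y - z) \<le> (int \<rho>)\<^sup>2}"
    using l1_norm_le_sq_norm order_trans by (auto simp: cell_def)
qed (rule finite_l1_ball)

lemma abs_le_of_mem_cell: "y \<in> cell z \<rho> \<Longrightarrow> \<bar>y $ k - z $ k\<bar> \<le> int \<rho>"
  using sq_norm_diff_le_imp_abs_le[of "y - z" \<rho> k] by (simp add: cell_def)

lemma mem_cell_centre_unique:
  assumes "y \<in> cell (centre i b \<rho> v) \<rho>" "y \<in> cell (centre i b \<rho> v') \<rho>"
  shows "v = v'"
proof -
  have "v $ k = v' $ k" for k
  proof (rule ccontr)
    assume "v $ k \<noteq> v' $ k"
    then have "(2 * int \<rho> + 1) * 1 \<le> (2 * int \<rho> + 1) * \<bar>v $ k - v' $ k\<bar>"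
      by (intro mult_left_mono) auto
    also have "\<dots> = \<bar>(2 * int \<rho> + 1) * (v $ k - v' $ k)\<bar>"
      by (simp add: abs_mult)
    also have "\<dots> = \<bar>centre i b \<rho> v $ k - centre i b \<rho> v' $ k\<bar>"
      by (simp add: centre_def right_diff_distrib)
    also have "\<dots> \<le> 2 * int \<rho>"
      using abs_le_of_mem_cell[OF assms(1), of k] abs_le_of_mem_cell[OF assms(2), of k] by linarith
    finally show False by simp
  qed
  then show ?thesis by (simp add: vec_eq_iff)
qed

section \<open>Awake walks, generation by generation\<close>

lemma l1_norm_step_le: "v \<in> unit_steps \<Longrightarrow> \<bar>l1_norm (x + v) - l1_norm x\<bar> \<le> 1"
  using l1_norm_triangle[of x v] l1_norm_triangle[of "x + v" "-v"] l1_norm_minus_commute[of v 0]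
  by (simp add: unit_steps_def)

text \<open>A step changes the l1 norm by at most 1, so a discrete intermediate value argument finds
  a visited site at every level from 1 to \<open>r\<close>.\<close>

lemma card_visited_ge:
  fixes p :: "nat \<Rightarrow> int ^ 'd"
  assumes p: "p 0 = 0" "\<And>j. j < n \<Longrightarrow> p (Suc j) - p j \<in> unit_steps"
    and j: "j \<le> n" "int r \<le> \<bar>p j $ i\<bar>"
  shows "r \<le> card {y. 1 \<le> l1_norm y \<and> l1_norm y \<le> int r \<and> (\<exists>j\<le>n. p j = y)}" (is "r \<le> card ?V")
proof -
  have "{1..int r} \<subseteq> l1_norm ` ?V"
  proof
    fix m assume m: "m \<in> {1..int r}"
    have "\<exists>j'\<le>j. l1_norm (p j') = m"
    proof (rule nat0_intermed_int_val)
      show "\<forall>l<j. \<bar>l1_norm (p (l + 1)) - l1_norm (p l)\<bar> \<le> 1"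
      proof (intro allI impI)
        fix l assume "l < j"
        then have "p (Suc l) - p l \<in> unit_steps" using p(2) j(1) by simp
        from l1_norm_step_le[OF this, of "p l"] show "\<bar>l1_norm (p (l + 1)) - l1_norm (p l)\<bar> \<le> 1"
          by simp
      qed
      show "l1_norm (p 0) \<le> m" using m p(1) by simp
      show "m \<le> l1_norm (p j)" using m j(2) abs_vec_nth_le_l1_norm[of "p j" i] by simp
    qed
    then obtain j' where "j' \<le> j" "l1_norm (p j') = m" by blast
    then show "m \<in> l1_norm ` ?V"
      using m j(1) by (intro image_eqI[of _ _ "p j'"]) (auto intro!: exI[of _ j'])
  qed
  moreover have fin: "finite ?V"
    by (rule finite_subset[OF _ finite_l1_ball[of 0 "int r"]]) auto
  ultimately have "card {1..int r} \<le> card (l1_norm ` ?V)" by (intro card_mono) auto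
  also have "\<dots> \<le> card ?V" by (rule card_image_le[OF fin])
  finally show ?thesis by simp
qed

text \<open>Sites of the region \<open>D k\<close> woken in stage \<open>k\<close>, every walk
  running for \<open>n\<close> steps of its own. Only transitions from one region to the next are
  recorded, so that the walks started in \<open>D k\<close> are still unexplored when stage
  \<open>k\<close> has been determined.\<close>

primrec active ::
  "(int ^ 'd \<Rightarrow> nat \<Rightarrow> 'w \<Rightarrow> int ^ 'd) \<Rightarrow> (nat \<Rightarrow> (int ^ 'd) set) \<Rightarrow> nat \<Rightarrow> nat \<Rightarrow> 'w \<Rightarrow> (int ^ 'd) set"
where
  "active S D n 0 \<omega> = {y \<in> D 0. \<exists>j\<le>n. S 0 j \<omega> = y}"
| "active S D n (Suc k) \<omega> = {y \<in> D (Suc k). \<exists>a\<in>active S D n k \<omega>. \<exists>j\<le>n. S a j \<omega> = y}"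

lemma active_subset: "active S D n k \<omega> \<subseteq> D k"
  by (cases k) auto

lemma first_passage_time_le_add:
  assumes "first_passage_time S \<omega> x a \<le> enat m" "\<exists>j\<le>n. S a j \<omega> = y"
  shows "first_passage_time S \<omega> x y \<le> enat (m + n)"
proof -
  have "first_passage_time S \<omega> a y \<le> enat n"
    using assms(2) first_passage_time_le_hitting_time[of S \<omega> a y] hitting_time_le_iff[of S \<omega> a y n]
    by (auto intro: order_trans)
  with assms(1) have "first_passage_time S \<omega> x a + first_passage_time S \<omega> a y \<le> enat m + enat n"
    by (rule add_mono)
  then show ?thesis
    using first_passage_time_triangle[of S \<omega> x y a] by (auto intro: order_trans)
qed

lemma first_passage_time_le_active:
  "y \<in> active S D n k \<omega> \<Longrightarrow> first_passage_time S \<omega> 0 y \<le> enat (Suc k * n)"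
proof (induction k arbitrary: y)
  case 0
  then show ?case
    using first_passage_time_le_add[of S \<omega> 0 0 0 n y] by (auto simp: first_passage_time_refl)
next
  case (Suc k)
  then obtain a where "a \<in> active S D n k \<omega>" "\<exists>j\<le>n. S a j \<omega> = y" by auto
  with first_passage_time_le_add[OF Suc.IH] show ?case by (simp add: add.commute)
qed

text \<open>Generation \<open>k\<close> is determined by the walks from the origin and from earlier
  regions; this is the locality that \<open>hit_stage\<close> requires.\<close>

lemma active_cong:
  assumes "\<And>x j. x \<in> insert 0 (\<Union>i<k. D i) \<Longrightarrow> j \<le> n \<Longrightarrow> S x j \<omega> = S x j \<omega>'"
  shows "active S D n k \<omega> = active S D n k \<omega>'"
  using assms
proof (induction k)
  case 0
  then show ?case by auto
next
  case (Suc k)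
  have IH: "active S D n k \<omega> = active S D n k \<omega>'"
  proof (rule Suc.IH)
    fix x j assume "x \<in> insert 0 (\<Union>i<k. D i)" "j \<le> n"
    then show "S x j \<omega> = S x j \<omega>'" by (intro Suc.prems) (auto intro: less_SucI)
  qed
  have "S a j \<omega> = S a j \<omega>'" if "a \<in> active S D n k \<omega>'" "j \<le> n" for a j
    using that active_subset[of S D n k \<omega>'] Suc.prems[of a j] by auto
  then show ?case unfolding active.simps IH by (intro Collect_cong) (metis (full_types))
qed

context independent_simple_random_walks
begin

text \<open>By \<open>card_visited_ge\<close> a walk that sees fewer than \<open>r\<close> of these
  sites stays in a slab of half-width \<open>r\<close>, which \<open>stay_prob_slab_le\<close> makes
  unlikely.\<close>

lemma prob_first_stage_le:
  assumes "r \<ge> 1" and D0: "D 0 = {y. 1 \<le> l1_norm y \<and> l1_norm y \<le> int r}"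
  shows "prob {\<omega> \<in> space M. card (active S D n 0 \<omega>) < r}
    \<le> 2 * exp (- real n / (2 * real CARD('d) * real r ^ 2))"
proof -
  obtain i :: 'd where True by blast
  let ?Q = "\<lambda>w :: nat \<Rightarrow> int ^ 'd. card {y \<in> D 0. \<exists>j\<le>n. w j = y} < r"
  have "prob {\<omega> \<in> space M. card (active S D n 0 \<omega>) < r} = prob {\<omega> \<in> space M. ?Q (\<lambda>j. S 0 j \<omega>)}"
    by simp
  also have "\<dots> = walk_mean n (\<lambda>vs. of_bool (?Q (\<lambda>j. 0 + sum_list (take j vs))))"
  proof (rule simple_random_walk.prob_walk[OF walk])
    fix w w' :: "nat \<Rightarrow> int ^ 'd" assume "\<And>j. j \<le> n \<Longrightarrow> w j = w' j"
    then have "{y \<in> D 0. \<exists>j\<le>n. w j = y} = {y \<in> D 0. \<exists>j\<le>n. w' j = y}" by auto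
    then show "?Q w \<longleftrightarrow> ?Q w'" by simp
  qed
  also have "\<dots> \<le> walk_mean n (\<lambda>vs. of_bool (\<forall>j\<le>n. 0 + sum_list (take j vs) \<in> {y. \<bar>y $ i\<bar> < int r}))"
  proof (rule walk_mean_mono)
    fix vs :: "(int ^ 'd) list" assume vs: "set vs \<subseteq> unit_steps" "length vs = n"
    let ?p = "\<lambda>j. 0 + sum_list (take j vs)"
    have "\<not> ?Q ?p" if "\<not> (\<forall>j\<le>n. ?p j \<in> {y. \<bar>y $ i\<bar> < int r})"
    proof -
      from that obtain j where j: "j \<le> n" "int r \<le> \<bar>?p j $ i\<bar>" by auto
      have "?p (Suc l) - ?p l \<in> unit_steps" if "l < n" for l
        using that vs by (auto simp: take_Suc_conv_app_nth)
      from card_visited_ge[of ?p, OF _ this j] show ?thesis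
        by (simp add: D0 not_less conj_assoc)
    qed
    then show "of_bool (?Q ?p) \<le> (of_bool (\<forall>j\<le>n. ?p j \<in> {y. \<bar>y $ i\<bar> < int r}) :: real)"
      by (auto simp: of_bool_def)
  qed
  also have "\<dots> = stay_prob n {y. \<bar>y $ i\<bar> < int r} 0" by (simp add: stay_prob_def)
  also have "\<dots> \<le> 2 * exp (- real n / (2 * real CARD('d) * real r ^ 2))"
    by (rule stay_prob_slab_le[OF assms(1)])
  finally show ?thesis .
qed

text \<open>Union bound over the ways to fail: the first generation is too small, some stage misses
  one of its targets, or the last generation misses \<open>y\<close>. The factor
  \<open>K + 2\<close> counts the stages \<open>0\<close> to \<open>K\<close> and the final
  hop.\<close>

lemma prob_passage_by_stages:
  assumes fin: "\<And>k. finite (D k)" "\<And>k. finite (I k)" and disj: "disjoint_family D" "\<And>k. 0 \<notin> D k"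
    and Q: "\<And>k i. k < K \<Longrightarrow> i \<in> I (Suc k) \<Longrightarrow> Q (Suc k) i \<subseteq> D (Suc k)"
      "\<And>k. disjoint_family_on (Q (Suc k)) (I (Suc k))"
    and N: "\<And>k. k < K \<Longrightarrow> N (Suc k) \<le> card (I (Suc k))"
    and p: "\<And>k a i. k < K \<Longrightarrow> a \<in> D k \<Longrightarrow> i \<in> I (Suc k) \<Longrightarrow> p (Suc k) \<le> hit_prob n (Q (Suc k) i) a"
      "\<And>k. k < K \<Longrightarrow> 0 \<le> p (Suc k)" "\<And>k. k < K \<Longrightarrow> p (Suc k) \<le> 1"
    and p': "\<And>a. a \<in> D K \<Longrightarrow> p' \<le> hit_prob n {y} a" "0 \<le> p'" "p' \<le> 1"
  shows "prob (slow_passage M S 0 y ((K + 2) * n))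
    \<le> prob {\<omega> \<in> space M. card (active S D n 0 \<omega>) < N 0}
      + (\<Sum>k<K. real (card (I (Suc k))) * (1 - p (Suc k)) ^ N k) + (1 - p') ^ N K"
proof -
  define A where "A k \<omega> = active S D n k \<omega>" for k \<omega>
  define bad where "bad k = {\<omega> \<in> space M. N k \<le> card (A k \<omega>) \<and>
      (\<exists>i\<in>I (Suc k). \<forall>a\<in>A k \<omega>. \<forall>j\<le>n. S a j \<omega> \<notin> Q (Suc k) i)}" for k
  \<comment> \<open>The one-point index set lets \<open>hit_stage\<close> treat the final hop as a
    stage with the single target \<open>y\<close>.\<close>
  define bad' where "bad' = {\<omega> \<in> space M. N K \<le> card (A K \<omega>) \<and>
      (\<exists>i\<in>{()}. \<forall>a\<in>A K \<omega>. \<forall>j\<le>n. S a j \<omega> \<notin> {y})}"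
  define bad0 where "bad0 = {\<omega> \<in> space M. card (A 0 \<omega>) < N 0}"
  have fU: "finite (insert 0 (\<Union>i<k. D i))" for k using fin by auto
  have A_cong: "A k \<omega> = A k \<omega>'" if "\<And>x j. x \<in> insert 0 (\<Union>i<k. D i) \<Longrightarrow> j \<le> n \<Longrightarrow> S x j \<omega> = S x j \<omega>'" for k \<omega> \<omega>'
    unfolding A_def using that by (rule active_cong)
  have A_sub: "A k \<omega> \<subseteq> D k" for k \<omega> by (simp add: A_def active_subset)
  have UD: "insert 0 (\<Union>i<k. D i) \<inter> D k = {}" for k
  proof -
    have "D i \<inter> D k = {}" if "i < k" for i
      using disj(1) that unfolding disjoint_family_on_def by simp
    then show ?thesis using disj(2)[of k] by blast
  qed
  have bad_ev: "{\<omega> \<in> space M. N k \<le> card (A k \<omega>) \<and> (\<exists>i\<in>J. \<forall>a\<in>A k \<omega>. \<forall>j\<le>n. S a j \<omega> \<notin> R i)} \<in> events" for k J and R :: "'j \<Rightarrow> _"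
  proof -
    let ?f = "\<lambda>\<omega>. N k \<le> card (A k \<omega>) \<and> (\<exists>i\<in>J. \<forall>a\<in>A k \<omega>. \<forall>j\<le>n. S a j \<omega> \<notin> R i)"
    have "?f \<in> measurable M (count_space UNIV)"
    proof (rule local_measurable[OF fU[of "Suc k"]])
      fix \<omega> \<omega>' assume agree: "\<And>x j. x \<in> insert 0 (\<Union>i<Suc k. D i) \<Longrightarrow> j \<le> n \<Longrightarrow> S x j \<omega> = S x j \<omega>'"
      have "A k \<omega> = A k \<omega>'"
      proof (rule A_cong)
        fix x j assume "x \<in> insert 0 (\<Union>i<k. D i)" "j \<le> n"
        then show "S x j \<omega> = S x j \<omega>'" by (intro agree) (auto intro: less_SucI)
      qed
      moreover have "S a j \<omega> = S a j \<omega>'" if "a \<in> A k \<omega>'" "j \<le> n" for a j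
        using that A_sub[of k \<omega>'] by (intro agree) auto
      ultimately show "?f \<omega> = ?f \<omega>'" by auto
    qed
    then show ?thesis by (simp add: pred_def[symmetric] measurable_sets_Collect pred_sets1)
  qed
  have bad0_ev: "bad0 \<in> events"
  proof -
    have "(\<lambda>\<omega>. card (A 0 \<omega>)) \<in> measurable M (count_space UNIV)"
      by (rule local_measurable[OF fU[of 0], of n]) (use A_cong[of 0] in metis)
    from measurable_sets_Collect[OF this, of "\<lambda>c. c < N 0"] show ?thesis by (simp add: bad0_def)
  qed
  have bE: "bad k \<in> events" for k unfolding bad_def by (rule bad_ev)
  have bE': "bad' \<in> events" unfolding bad'_def by (rule bad_ev)
  have A_cong': "A k \<omega> = A k \<omega>'" if "\<omega> \<in> space M" "\<omega>' \<in> space M"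
      "\<And>x j. x \<in> insert 0 (\<Union>i<k. D i) \<Longrightarrow> j \<le> n \<Longrightarrow> S x j \<omega> = S x j \<omega>'" for k \<omega> \<omega>'
    using that(3) by (rule A_cong)
  have bad_le: "prob (bad k) \<le> real (card (I (Suc k))) * (1 - p (Suc k)) ^ N k" if "k < K" for k
    unfolding bad_def
    by (rule hit_stage[OF fU[of k] fin(1)[of k] fin(2)[of "Suc k"] UD A_cong' A_sub])
      (use that p in auto)
  have bad'_le: "prob bad' \<le> (1 - p') ^ N K"
  proof -
    have "prob bad' \<le> real (card {()}) * (1 - p') ^ N K"
      unfolding bad'_def
      by (rule hit_stage[OF fU[of K] fin(1)[of K] _ UD A_cong' A_sub]) (use p' in auto)
    then show ?thesis by simp
  qed
  have good: "first_passage_time S \<omega> 0 y \<le> enat ((K + 2) * n)"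
    if \<omega>: "\<omega> \<in> space M" "\<omega> \<notin> bad0" "\<And>k. k < K \<Longrightarrow> \<omega> \<notin> bad k" "\<omega> \<notin> bad'" for \<omega>
  proof -
    have "N k \<le> card (A k \<omega>)" if "k \<le> K" for k
      using that
    proof (induction k)
      case 0
      then show ?case using \<omega> by (auto simp: bad0_def)
    next
      case (Suc k)
      then have "\<forall>i\<in>I (Suc k). \<exists>a\<in>A k \<omega>. \<exists>j\<le>n. S a j \<omega> \<in> Q (Suc k) i"
        using \<omega>(1) \<omega>(3)[of k] by (auto simp: bad_def)
      then have "\<exists>z. z \<in> A (Suc k) \<omega> \<and> z \<in> Q (Suc k) i" if "i \<in> I (Suc k)" for i
        using Q(1)[of k i] Suc.prems that unfolding A_def by fastforce
      then obtain g where g: "\<And>i. i \<in> I (Suc k) \<Longrightarrow> g i \<in> A (Suc k) \<omega> \<and> g i \<in> Q (Suc k) i"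
        by metis
      \<comment> \<open>Disjoint targets yield distinct woken sites, one for each index.\<close>
      have "inj_on g (I (Suc k))"
        using g Q(2)[of k] unfolding inj_on_def disjoint_family_on_def by (metis IntI empty_iff)
      then have "card (I (Suc k)) \<le> card (A (Suc k) \<omega>)"
        using g finite_subset[OF A_sub fin(1)] by (intro card_inj_on_le[of g]) auto
      then show ?case using N[of k] Suc.prems by simp
    qed
    then have "\<exists>a\<in>A K \<omega>. \<exists>j\<le>n. S a j \<omega> = y"
      using \<omega>(1,4) by (auto simp: bad'_def)
    then obtain a where a: "a \<in> active S D n K \<omega>" "\<exists>j\<le>n. S a j \<omega> = y" by (auto simp: A_def)
    show ?thesis
      using first_passage_time_le_add[OF first_passage_time_le_active[OF a(1)] a(2)]
      by (simp add: algebra_simps)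
  qed
  have "(slow_passage M S 0 y ((K + 2) * n))
      \<subseteq> bad0 \<union> (\<Union>k<K. bad k) \<union> bad'"
    using good by blast
  then have "prob (slow_passage M S 0 y ((K + 2) * n))
      \<le> prob (bad0 \<union> (\<Union>k<K. bad k) \<union> bad')"
    using bad0_ev bE bE' by (intro finite_measure_mono) auto
  also have "\<dots> \<le> prob (bad0 \<union> (\<Union>k<K. bad k)) + prob bad'"
    using bad0_ev bE bE' by (intro measure_Un_le) auto
  also have "prob (bad0 \<union> (\<Union>k<K. bad k)) \<le> prob bad0 + prob (\<Union>k<K. bad k)"
    using bad0_ev bE bE' by (intro measure_Un_le) auto
  also have "prob (\<Union>k<K. bad k) \<le> (\<Sum>k<K. prob (bad k))"
    using bE by (intro finite_measure_subadditive_finite) auto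
  also have "\<dots> \<le> (\<Sum>k<K. real (card (I (Suc k))) * (1 - p (Suc k)) ^ N k)"
    using bad_le by (intro sum_mono) auto
  also note bad'_le
  finally show ?thesis by (simp add: bad0_def A_def)
qed

end

section \<open>The cascade with explicit scales\<close>

lemma one_minus_power_le_exp:
  fixes p :: real
  assumes "0 \<le> p" "p \<le> 1"
  shows "(1 - p) ^ N \<le> exp (- (p * real N))"
proof -
  have "1 - p \<le> exp (- p)" using exp_ge_add_one_self[of "- p"] by simp
  then have "(1 - p) ^ N \<le> exp (- p) ^ N" using assms by (intro power_mono) auto
  then show ?thesis by (simp add: exp_of_nat_mult[symmetric] mult.commute)
qed

text \<open>Scales of the cascade: the boxes have side about \<open>r = q ^ (2 d\<^sup>2)\<close> and in stage \<open>k\<close> there are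
  \<open>m k = q ^ (2 d + k)\<close> cells of radius \<open>r / m k\<close> per side. The \<open>m k ^ d\<close> walks awake in stage \<open>k\<close> each
  hit a given cell of stage \<open>k + 1\<close> with probability about \<open>m (k + 1) ^ - (d - 1)\<close>, and
  \<open>m k ^ d \<ge> q * m (k + 1) ^ (d - 1)\<close>. The initial \<open>r = m 0 ^ d\<close> sites start the cascade, and after
  \<open>K = 2 d\<^sup>2 - 2 d\<close> stages \<open>m K = r\<close>.\<close>

lemma ex_neighbour_tail:
  assumes d: "CARD('d::finite) \<ge> 2"
  shows "\<exists>A b e (B :: real) (c :: real) q0. c > 0 \<and> A \<ge> 1 \<and> b \<ge> 1 \<and>
    (\<forall>q\<ge>q0. \<forall>(M :: 'w measure) (S :: int ^ 'd \<Rightarrow> nat \<Rightarrow> 'w \<Rightarrow> int ^ 'd).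
      independent_simple_random_walks M S \<longrightarrow> (\<forall>y. l1_norm y \<le> 1 \<longrightarrow>
        measure M (slow_passage M S 0 y (A * q ^ b))
          \<le> B * real q ^ e * exp (- c * real q)))"
proof -
  define d where "d = CARD('d)"
  have d2: "d \<ge> 2" using assms by (simp add: d_def)
  define K where "K = 2 * d * d - 2 * d"
  have K: "2 * d + K = 2 * d * d" using d2 by (simp add: K_def)
  obtain c0 r0 where c0: "c0 > 0" "c0 \<le> 1" and hit: "\<And>r \<rho> x. r \<ge> r0 \<Longrightarrow> \<rho> \<le> r \<Longrightarrow> l1_norm (x :: int ^ 'd) \<le> int r \<Longrightarrow>
      c0 * ((real \<rho> + 1) / real r) ^ (d - 1) \<le> hit_prob (r ^ (d + 3)) {y. sq_norm y \<le> int \<rho> ^ 2} x"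
    using ex_hit_prob_bound[OF assms] unfolding d_def by blast
  \<comment> \<open>All boxes have coordinates bounded by \<open>(5 * K + 3) * r\<close>, so any two
    of their points are at l1 distance at most
    \<open>d * 2 * (5 * K + 3) * r = \<kappa> * r\<close>. The hitting bound is therefore used at
    radius \<open>\<kappa> * r\<close>.\<close>
  define \<kappa> where "\<kappa> = d * (10 * K + 6)"
  have "2 * 6 \<le> d * (10 * K + 6)" using d2 by (intro mult_le_mono) auto
  then have \<kappa>: "\<kappa> \<ge> 2" by (simp add: \<kappa>_def)
  define c1 where "c1 = c0 / real \<kappa> ^ (d - 1)"
  have c1: "c1 > 0" using c0 \<kappa> by (simp add: c1_def)
  define c where "c = min c1 (1 / (2 * real d))"
  have c: "c > 0" "c \<le> c1" "c \<le> 1 / (2 * real d)" using c1 d2 by (auto simp: c_def)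
  \<comment> \<open>With \<open>r = q ^ (2 * d * d)\<close> and
    \<open>n = (\<kappa> * r) ^ (d + 3)\<close> below, \<open>A * q ^ b\<close> is exactly
    \<open>(K + 2) * n\<close>; and \<open>q ^ e = r ^ d\<close> bounds the number of cells in a
    stage.\<close>
  define A where "A = (K + 2) * \<kappa> ^ (d + 3)"
  define b where "b = 2 * d * d * (d + 3)"
  define e where "e = 2 * d * d * d"
  have main: "measure M (slow_passage M S 0 y (A * q ^ b))
      \<le> real (K + 3) * real q ^ e * exp (- c * real q)"
    if q: "q \<ge> r0 + 1" and ind: "independent_simple_random_walks M S" and y: "l1_norm y \<le> 1"
    for q and M :: "'w measure" and S :: "int ^ 'd \<Rightarrow> nat \<Rightarrow> 'w \<Rightarrow> int ^ 'd" and y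
  proof -
    interpret independent_simple_random_walks M S by (rule ind)
    obtain i :: 'd where True by blast
    have q1: "q \<ge> 1" using q by simp
    define r where "r = q ^ (2 * d * d)"
    define m where "m k = q ^ (2 * d + k)" for k
    define \<rho> where "\<rho> k = q ^ (K - k)" for k
    define n where "n = (\<kappa> * r) ^ (d + 3)"
    have r_eq: "r = m k * \<rho> k" if "k \<le> K" for k
      using that by (simp add: r_def m_def \<rho>_def power_add[symmetric] K)
    have pos: "r \<ge> 1" "m k \<ge> 1" "\<rho> k \<ge> 1" for k
      using q1 by (simp_all add: r_def m_def \<rho>_def)
    have qr: "q \<le> r" unfolding r_def using q1 d2 by (intro self_le_power) auto
    have m_le: "m k \<le> r" and \<rho>_le: "\<rho> k \<le> r" if "k \<le> K" for k
      using r_eq[OF that] pos(2)[of k] pos(3)[of k] by simp_all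
    have \<kappa>r: "\<kappa> * r \<ge> 2 * r" using \<kappa> by simp
    have R_ge: "\<kappa> * r \<ge> r0" using \<kappa>r qr q by linarith
    define I where "I k = (grid (m k) :: (int ^ 'd) set)" for k
    \<comment> \<open>Up to the shift, a box has coordinates between \<open>- r\<close> and
      \<open>3 * r\<close>, so shifts by multiples of \<open>5 * r\<close> along one axis keep the
      boxes disjoint and away from the origin.\<close>
    define Q where "Q k v = cell (centre i (5 * int r * int k) (\<rho> k) v) (\<rho> k)" for k v
    define D where "D k = (if k = 0 then {y. 1 \<le> l1_norm y \<and> l1_norm y \<le> int r}
        else if k \<le> K then (\<Union>v\<in>I k. Q k v) else {})" for k
    define N where "N k = m k ^ d" for k
    define p where "p k = c0 * ((real (\<rho> k) + 1) / real (\<kappa> * r)) ^ (d - 1)" for k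
    \<comment> \<open>The hitting bound for \<open>\<rho> = 0\<close>, that is, for a single
      site.\<close>
    define p' where "p' = c0 * ((real 0 + 1) / real (\<kappa> * r)) ^ (d - 1)"

    have Q_coord: "z $ j - (if j = i then 5 * int r * int k else 0) \<in> {- int r..3 * int r}"
      if "k \<le> K" "v \<in> I k" "z \<in> Q k v" for z j k v
    proof -
      have v: "0 \<le> v $ j" "v $ j \<le> int (m k) - 1" using that(2) by (auto simp: I_def grid_def)
      have mr: "int (m k) * int (\<rho> k) = int r" using r_eq[OF that(1)] by simp
      have "(2 * int (\<rho> k) + 1) * v $ j \<le> (2 * int (\<rho> k) + 1) * (int (m k) - 1)"
        using v by (intro mult_left_mono) auto
      also have "\<dots> = 2 * (int (m k) * int (\<rho> k)) + int (m k) - 2 * int (\<rho> k) - 1"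
        by (simp add: algebra_simps)
      also have "\<dots> \<le> 3 * int r - int (\<rho> k)" using mr m_le[OF that(1)] by simp
      finally have "(2 * int (\<rho> k) + 1) * v $ j \<le> 3 * int r - int (\<rho> k)" .
      moreover have "0 \<le> (2 * int (\<rho> k) + 1) * v $ j" using v by simp
      moreover have "\<bar>z $ j - ((2 * int (\<rho> k) + 1) * v $ j + (if j = i then 5 * int r * int k else 0))\<bar> \<le> int (\<rho> k)"
        using abs_le_of_mem_cell[of z _ "\<rho> k" j] that(3) by (fastforce simp: Q_def centre_def)
      ultimately show ?thesis using \<rho>_le[OF that(1)] by (simp add: abs_le_iff)
    qed
    have D_coord: "z $ j - (if j = i then 5 * int r * int k else 0) \<in> {- int r..3 * int r}"
      if "z \<in> D k" for z j k
    proof (cases "k = 0")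
      case True
      then show ?thesis
        using that abs_vec_nth_le_l1_norm[of z j] by (auto simp: D_def abs_le_iff)
    next
      case False
      then show ?thesis using that Q_coord[of k _ z j] by (auto simp: D_def split: if_splits)
    qed
    have shift_le: "5 * int r * int k \<le> 5 * int r * int K" if "k \<le> K" for k
      using that by (intro mult_left_mono) auto
    have abs_le: "\<bar>z $ j\<bar> \<le> 5 * int r * int K + 3 * int r"
      if "k \<le> K" "z $ j - (if j = i then 5 * int r * int k else 0) \<in> {- int r..3 * int r}" for z :: "int ^ 'd" and j k
    proof -
      have "0 \<le> 5 * int r * int k" "0 \<le> 5 * int r * int K" by simp_all
      moreover have "- int r \<le> z $ j - (if j = i then 5 * int r * int k else 0)"
        "z $ j - (if j = i then 5 * int r * int k else 0) \<le> 3 * int r"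
        using that(2) by simp_all
      ultimately show ?thesis
        using shift_le[OF that(1)] unfolding abs_le_iff by (smt (verit))
    qed
    have l1_le: "l1_norm (a - z) \<le> int (\<kappa> * r)"
      if "\<And>j. \<bar>a $ j\<bar> \<le> 5 * int r * int K + 3 * int r" "\<And>j. \<bar>z $ j\<bar> \<le> 5 * int r * int K + 3 * int r" for a z :: "int ^ 'd"
    proof -
      have "l1_norm (a - z) \<le> int CARD('d) * (2 * (5 * int r * int K + 3 * int r))"
      proof (rule l1_norm_le_card_times)
        fix j show "\<bar>(a - z) $ j\<bar> \<le> 2 * (5 * int r * int K + 3 * int r)"
          using that(1)[of j] that(2)[of j] by simp
      qed
      also have "\<dots> = int (\<kappa> * r)" by (simp add: \<kappa>_def d_def[symmetric] algebra_simps)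
      finally show ?thesis .
    qed
    have p_bounds: "0 \<le> p k" "p k \<le> 1" if "k \<le> K" for k
    proof -
      have "\<rho> k + 1 \<le> \<kappa> * r" using \<rho>_le[OF that] pos(1) \<kappa>r by linarith
      then have "real (\<rho> k) + 1 \<le> real (\<kappa> * r)" by (metis of_nat_1 of_nat_add of_nat_le_iff)
      then have "((real (\<rho> k) + 1) / real (\<kappa> * r)) ^ (d - 1) \<le> 1"
        using \<kappa> pos(1) by (intro power_le_one) (auto simp: divide_le_eq_1)
      then show "p k \<le> 1" unfolding p_def using c0 mult_mono[of c0 1 _ 1] by simp
      show "0 \<le> p k" using c0 by (simp add: p_def)
    qed
    have p'_bounds: "0 \<le> p'" "p' \<le> 1"
    proof -
      have "1 \<le> \<kappa> * r" using pos(1) \<kappa>r by linarith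
      then have "real 0 + 1 \<le> real (\<kappa> * r)" by (metis add_0 of_nat_0 of_nat_1 of_nat_le_iff)
      then have "((real 0 + 1) / real (\<kappa> * r)) ^ (d - 1) \<le> 1"
        using \<kappa> pos(1) by (intro power_le_one) (auto simp: divide_le_eq_1)
      then show "p' \<le> 1" unfolding p'_def using c0 mult_mono[of c0 1 _ 1] by simp
      show "0 \<le> p'" using c0 by (simp add: p'_def)
    qed
    have stages: "prob (slow_passage M S 0 y ((K + 2) * n))
      \<le> prob {\<omega> \<in> space M. card (active S D n 0 \<omega>) < N 0}
        + (\<Sum>k<K. real (card (I (Suc k))) * (1 - p (Suc k)) ^ N k) + (1 - p') ^ N K"
    proof (rule prob_passage_by_stages)
      show "finite (I k)" for k by (simp add: I_def finite_grid)
      then show "finite (D k)" for k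
        using finite_subset[OF _ finite_l1_ball[of 0 "int r"], of "{y. 1 \<le> l1_norm y \<and> l1_norm y \<le> int r}"]
        by (auto simp: D_def Q_def finite_cell)
      show "0 \<notin> D k" for k
      proof
        assume "0 \<in> D k"
        then have "k \<noteq> 0" by (cases "k = 0") (auto simp: D_def)
        have "- (5 * int r * int k) \<in> {- int r..3 * int r}"
          using D_coord[OF \<open>0 \<in> D k\<close>, of i] by simp
        moreover have "5 * int r * int k \<ge> 5 * int r * 1" using \<open>k \<noteq> 0\<close> by (intro mult_left_mono) auto
        ultimately show False using pos(1) by simp
      qed
      have "D k \<inter> D k' = {}" if "k < k'" for k k'
      proof -
        have False if "z \<in> D k" "z \<in> D k'" for z
        proof -
          have "5 * int r * (int k + 1) \<le> 5 * int r * int k'" using \<open>k < k'\<close> by (intro mult_left_mono) auto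
          then show False using D_coord[OF that(1), of i] D_coord[OF that(2), of i] pos(1)
            by (simp add: algebra_simps)
        qed
        then show ?thesis by blast
      qed
      then show "disjoint_family D"
        unfolding disjoint_family_on_def by (metis inf_commute linorder_neqE_nat)
      show "Q (Suc k) v \<subseteq> D (Suc k)" if "k < K" "v \<in> I (Suc k)" for k v
        using that by (auto simp: D_def)
      show "disjoint_family_on (Q (Suc k)) (I (Suc k))" for k
        using mem_cell_centre_unique unfolding disjoint_family_on_def Q_def by blast
      show "N (Suc k) \<le> card (I (Suc k))" if "k < K" for k
        by (simp add: N_def I_def card_grid d_def)
      show "p (Suc k) \<le> hit_prob n (Q (Suc k) v) a" if "k < K" "a \<in> D k" "v \<in> I (Suc k)" for k a v
      proof -
        let ?z = "centre i (5 * int r * int (Suc k)) (\<rho> (Suc k)) v"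
        have "?z \<in> Q (Suc k) v" by (simp add: Q_def cell_def)
        then have "l1_norm (a - ?z) \<le> int (\<kappa> * r)"
          using that by (intro l1_le abs_le[OF _ Q_coord] abs_le[OF _ D_coord]) auto
        moreover have "\<rho> (Suc k) \<le> \<kappa> * r" using \<rho>_le[of "Suc k"] \<kappa>r that by linarith
        ultimately show ?thesis
          unfolding Q_def hit_prob_cell p_def n_def by (intro hit R_ge)
      qed
      show "0 \<le> p (Suc k)" "p (Suc k) \<le> 1" if "k < K" for k using p_bounds[of "Suc k"] that by auto
      show "0 \<le> p'" "p' \<le> 1" by (fact p'_bounds)+
      show "p' \<le> hit_prob n {y} a" if "a \<in> D K" for a
      proof -
        have "\<bar>y $ j\<bar> \<le> 5 * int r * int K + 3 * int r" for j
        proof -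
          have "0 \<le> 5 * int r * int K" by simp
          then show ?thesis using abs_vec_nth_le_l1_norm[of y j] y pos(1) by linarith
        qed
        with abs_le[OF order_refl D_coord[OF that]] have "l1_norm (a - y) \<le> int (\<kappa> * r)"
          by (rule l1_le)
        then have "p' \<le> hit_prob n {x. sq_norm x \<le> int 0 ^ 2} (a - y)"
          unfolding p'_def n_def by (intro hit R_ge) auto
        also have "\<dots> = hit_prob n (cell y 0) a" by (simp add: hit_prob_cell)
        also have "cell y 0 = {y}"
        proof -
          have "x = y" if "sq_norm (x - y) \<le> 0" for x
            using that sq_norm_nonneg[of "x - y"] sq_norm_eq_0[of "x - y"] by simp
          then show ?thesis by (auto simp: cell_def)
        qed
        finally show ?thesis .
      qed
    qed
    have Mfirst: "prob {\<omega> \<in> space M. card (active S D n 0 \<omega>) < N 0} \<le> 2 * exp (- c * real q)"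
    proof -
      have N0: "N 0 = r" by (simp add: N_def m_def r_def power_mult[symmetric])
      have "prob {\<omega> \<in> space M. card (active S D n 0 \<omega>) < r} \<le> 2 * exp (- real n / (2 * real d * real r ^ 2))"
        unfolding d_def by (rule prob_first_stage_le[OF pos(1)]) (simp add: D_def)
      also have "\<dots> \<le> 2 * exp (- c * real q)"
      proof -
        have "r * r * q \<le> (\<kappa> * r) * (\<kappa> * r) * (\<kappa> * r)"
          using \<kappa>r qr by (intro mult_le_mono) linarith+
        also have "\<dots> = (\<kappa> * r) ^ 3" by (simp add: power3_eq_cube)
        also have "\<dots> \<le> n" unfolding n_def using \<kappa> pos(1) by (intro power_increasing) auto
        finally have "real (r * r * q) \<le> real n" by (simp only: of_nat_le_iff)
        then have "real q / (2 * real d) \<le> real n / (2 * real d * real r ^ 2)"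
          using pos(1) d2 by (simp add: field_simps power2_eq_square)
        moreover have "c * real q \<le> real q / (2 * real d)"
          using mult_right_mono[OF c(3), of "real q"] by simp
        ultimately show ?thesis by simp
      qed
      finally show ?thesis by (simp add: N0)
    qed
    \<comment> \<open>The exponent of \<open>q\<close> on the right exceeds that on the left by
      \<open>d + k\<close>, which is where the growth of \<open>m\<close> by only one factor
      \<open>q\<close> per stage is used.\<close>
    have expo: "q * m (Suc k) ^ (d - 1) \<le> m k ^ d" for k
    proof -
      obtain f where f: "d = Suc f" using d2 by (cases d) auto
      have "1 + (2 * d + Suc k) * (d - 1) \<le> (2 * d + k) * d" by (simp add: f algebra_simps)
      then have "q ^ (1 + (2 * d + Suc k) * (d - 1)) \<le> q ^ ((2 * d + k) * d)"
        using q1 by (intro power_increasing) auto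
      then show ?thesis by (simp only: m_def power_mult plus_1_eq_Suc power_Suc)
    qed
    have stage_le: "(1 - p (Suc k)) ^ N k \<le> exp (- c * real q)" if "k < K" for k
    proof -
      have "c1 * (1 / real (m (Suc k))) ^ (d - 1) \<le> p (Suc k)"
      proof -
        have "real r = real (m (Suc k)) * real (\<rho> (Suc k))" using r_eq[of "Suc k"] that by simp
        then have "1 / real (m (Suc k)) = real (\<rho> (Suc k)) / real r"
          using pos(3)[of "Suc k"] by simp
        also have "\<dots> \<le> (real (\<rho> (Suc k)) + 1) / real r" by (intro divide_right_mono) auto
        finally have "(1 / real (m (Suc k))) ^ (d - 1) \<le> ((real (\<rho> (Suc k)) + 1) / real r) ^ (d - 1)"
          by (intro power_mono) auto
        then have "c1 * (1 / real (m (Suc k))) ^ (d - 1) \<le> c1 * ((real (\<rho> (Suc k)) + 1) / real r) ^ (d - 1)"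
          using c1 by (intro mult_left_mono) auto
        also have "\<dots> = p (Suc k)" by (simp add: p_def c1_def power_divide power_mult_distrib)
        finally show ?thesis .
      qed
      then have "c1 * (1 / real (m (Suc k))) ^ (d - 1) * real (N k) \<le> p (Suc k) * real (N k)"
        by (intro mult_right_mono) auto
      moreover have "c1 * real q \<le> c1 * (1 / real (m (Suc k))) ^ (d - 1) * real (N k)"
      proof -
        have "real (q * m (Suc k) ^ (d - 1)) \<le> real (N k)" using expo by (simp only: of_nat_le_iff N_def)
        then have "real q \<le> (1 / real (m (Suc k))) ^ (d - 1) * real (N k)"
          using pos(2)[of "Suc k"] by (simp add: field_simps power_divide)
        then show ?thesis using c1 by (simp add: mult.assoc)
      qed
      moreover have "c * real q \<le> c1 * real q" using c(2) by (intro mult_right_mono) auto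
      ultimately have "c * real q \<le> p (Suc k) * real (N k)" by linarith
      then show ?thesis
        using one_minus_power_le_exp[of "p (Suc k)" "N k"] p_bounds[of "Suc k"] that
        by (smt (verit, best) Suc_leI exp_le_cancel_iff mult_minus_left)
    qed
    have last_le: "(1 - p') ^ N K \<le> exp (- c * real q)"
    proof -
      have "p' = c1 * (1 / real r) ^ (d - 1)"
        by (simp add: p'_def c1_def power_divide power_mult_distrib)
      moreover have "N K = r * r ^ (d - 1)"
      proof -
        have "m K = r" by (simp only: m_def r_def K)
        then show ?thesis using d2 by (cases d) (auto simp: N_def)
      qed
      ultimately have "p' * real (N K) = c1 * real r"
        using pos(1) by (simp add: power_divide)
      moreover have "c * real q \<le> c1 * real r" using c c1 qr by (intro mult_mono) auto
      ultimately have "c * real q \<le> p' * real (N K)" by simp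
      then show ?thesis
        using one_minus_power_le_exp[of p' "N K"] p'_bounds
        by (smt (verit, best) exp_le_cancel_iff mult_minus_left)
    qed
    have "(\<Sum>k<K. real (card (I (Suc k))) * (1 - p (Suc k)) ^ N k) \<le> (\<Sum>k<K. real q ^ e * exp (- c * real q))"
    proof (rule sum_mono)
      fix k assume "k \<in> {..<K}"
      then have "k < K" by simp
      have "card (I (Suc k)) = m (Suc k) ^ d" by (simp add: I_def card_grid d_def)
      also have "\<dots> \<le> r ^ d" using m_le[of "Suc k"] \<open>k < K\<close> by (intro power_mono) auto
      also have "\<dots> = q ^ e" by (simp add: r_def e_def power_mult[symmetric])
      finally have "real (card (I (Suc k))) \<le> real q ^ e" by (metis of_nat_le_iff of_nat_power)
      then show "real (card (I (Suc k))) * (1 - p (Suc k)) ^ N k \<le> real q ^ e * exp (- c * real q)"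
        using stage_le[OF \<open>k < K\<close>] p_bounds[of "Suc k"] \<open>k < K\<close> by (intro mult_mono) auto
    qed
    then have "(\<Sum>k<K. real (card (I (Suc k))) * (1 - p (Suc k)) ^ N k) \<le> real K * (real q ^ e * exp (- c * real q))"
      by simp
    moreover have "1 * exp (- c * real q) \<le> real q ^ e * exp (- c * real q)"
      using q1 by (intro mult_right_mono one_le_power) auto
    ultimately have "prob (slow_passage M S 0 y ((K + 2) * n))
      \<le> 3 * (real q ^ e * exp (- c * real q)) + real K * (real q ^ e * exp (- c * real q))"
      using stages Mfirst last_le by linarith
    moreover have "(K + 2) * n = A * q ^ b"
      by (simp only: A_def b_def n_def r_def power_mult_distrib power_mult[symmetric] mult.assoc)
    ultimately show ?thesis by (simp add: algebra_simps)
  qed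
  have "\<kappa> ^ (d + 3) \<ge> 1" using \<kappa> by (intro one_le_power) simp
  then have "(K + 2) * \<kappa> ^ (d + 3) \<ge> 1 * 1" by (intro mult_le_mono) auto
  then have A1: "A \<ge> 1" by (simp only: A_def mult_1)
  have b1: "b \<ge> 1" using d2 by (simp add: b_def)
  show ?thesis
    by (rule exI[of _ A], rule exI[of _ b], rule exI[of _ e], rule exI[of _ "real (K + 3)"],
        rule exI[of _ c], rule exI[of _ "r0 + 1"], intro conjI allI impI main c(1) A1 b1)
qed

section \<open>Paths with few vertices are slow\<close>

lemma walk_mean_cong:
  fixes F G :: "(int ^ 'd) list \<Rightarrow> real"
  assumes "\<And>vs. set vs \<subseteq> unit_steps \<Longrightarrow> length vs = n \<Longrightarrow> F vs = G vs"
  shows "walk_mean n F = walk_mean n G"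
  using walk_mean_mono[of n F G] walk_mean_mono[of n G F] assms by (simp add: order.antisym)

text \<open>The \<open>j\<close>-step transition probability. In the union bound it stands in for
  the smaller probability of a first hit at time \<open>j\<close>.\<close>

definition step_kernel :: "nat \<Rightarrow> int ^ 'd \<Rightarrow> real" where
  "step_kernel j w = walk_mean j (\<lambda>vs. of_bool (sum_list vs = w))"

lemma step_kernel_nonneg: "0 \<le> step_kernel j w"
  unfolding step_kernel_def by (rule walk_mean_nonneg) simp

text \<open>An eigenfunction of the random walk with eigenvalue \<open>cosh \<mu>\<close>, comparable to
  \<open>exp (\<mu> * l1_norm x)\<close>.\<close>

definition cosh_prod :: "real \<Rightarrow> int ^ 'd \<Rightarrow> real" where
  "cosh_prod \<mu> x = (\<Prod>i\<in>UNIV. cosh (\<mu> * real_of_int (x $ i)))"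

text \<open>A step changes one factor of the product, and \<open>cosh (a + \<mu>) + cosh (a - \<mu>)
  = 2 * cosh \<mu> * cosh a\<close>.\<close>

lemma sum_cosh_prod:
  fixes x :: "int ^ 'd"
  shows "(\<Sum>v\<in>unit_steps. cosh_prod \<mu> (x + v)) = 2 * real CARD('d) * (cosh \<mu> * cosh_prod \<mu> x)"
proof -
  have "cosh_prod \<mu> (x + axis k 1) + cosh_prod \<mu> (x + axis k (-1)) = 2 * (cosh \<mu> * cosh_prod \<mu> x)" for k
  proof -
    have split: "cosh_prod \<mu> (x + axis k s) =
        cosh (\<mu> * real_of_int (x $ k + s)) * (\<Prod>i\<in>UNIV - {k}. cosh (\<mu> * real_of_int (x $ i)))" for s
    proof -
      have "cosh_prod \<mu> (x + axis k s) = cosh (\<mu> * real_of_int ((x + axis k s) $ k))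
          * (\<Prod>i\<in>UNIV - {k}. cosh (\<mu> * real_of_int ((x + axis k s) $ i)))"
        unfolding cosh_prod_def by (rule prod.remove) auto
      also have "(\<Prod>i\<in>UNIV - {k}. cosh (\<mu> * real_of_int ((x + axis k s) $ i)))
          = (\<Prod>i\<in>UNIV - {k}. cosh (\<mu> * real_of_int (x $ i)))"
        by (intro prod.cong refl) (auto simp: axis_def)
      finally show ?thesis by (simp add: axis_def)
    qed
    have "cosh (\<mu> * real_of_int (x $ k + 1)) + cosh (\<mu> * real_of_int (x $ k + -1))
        = 2 * (cosh \<mu> * cosh (\<mu> * real_of_int (x $ k)))"
      by (simp add: distrib_left right_diff_distrib cosh_add cosh_diff)
    then have "cosh_prod \<mu> (x + axis k 1) + cosh_prod \<mu> (x + axis k (-1))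
        = 2 * (cosh \<mu> * (cosh (\<mu> * real_of_int (x $ k)) * (\<Prod>i\<in>UNIV - {k}. cosh (\<mu> * real_of_int (x $ i)))))"
      by (simp only: split distrib_right[symmetric] mult.assoc[symmetric])
    also have "cosh (\<mu> * real_of_int (x $ k)) * (\<Prod>i\<in>UNIV - {k}. cosh (\<mu> * real_of_int (x $ i))) = cosh_prod \<mu> x"
      using split[of 0] by (simp add: axis_def zero_vec_def[symmetric])
    finally show ?thesis .
  qed
  then show ?thesis by (simp add: sum_unit_steps)
qed

lemma walk_mean_cosh_prod:
  fixes x :: "int ^ 'd"
  shows "walk_mean n (\<lambda>vs. cosh_prod \<mu> (x + sum_list vs)) = cosh \<mu> ^ n * cosh_prod \<mu> x"
proof (induction n arbitrary: x)
  case (Suc n)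
  have "walk_mean (Suc n) (\<lambda>vs. cosh_prod \<mu> (x + sum_list vs))
      = (\<Sum>v\<in>unit_steps. cosh \<mu> ^ n * cosh_prod \<mu> (x + v)) / (2 * real CARD('d))"
    by (simp add: Suc[symmetric] add.assoc)
  then show ?case by (simp add: sum_distrib_left[symmetric] sum_cosh_prod)
qed simp

lemma exp_l1_norm_le_cosh_prod:
  fixes x :: "int ^ 'd"
  assumes "\<mu> \<ge> 0"
  shows "exp (\<mu> * real_of_int (l1_norm x)) \<le> 2 ^ CARD('d) * cosh_prod \<mu> x"
proof -
  have "exp (\<mu> * real_of_int (l1_norm x)) = (\<Prod>i\<in>UNIV. exp (\<mu> * \<bar>real_of_int (x $ i)\<bar>))"
    by (simp add: l1_norm_def exp_sum[symmetric] sum_distrib_left)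
  also have "\<dots> \<le> (\<Prod>i\<in>UNIV. 2 * cosh (\<mu> * real_of_int (x $ i)))"
  proof (rule prod_mono)
    fix i
    have "exp (\<mu> * \<bar>t\<bar>) \<le> 2 * cosh (\<mu> * t)" for t :: real
      by (cases "t \<ge> 0") (auto simp: cosh_def)
    then show "0 \<le> exp (\<mu> * \<bar>real_of_int (x $ i)\<bar>) \<and>
        exp (\<mu> * \<bar>real_of_int (x $ i)\<bar>) \<le> 2 * cosh (\<mu> * real_of_int (x $ i))" by simp
  qed
  also have "\<dots> = 2 ^ CARD('d) * cosh_prod \<mu> x"
    by (simp add: cosh_prod_def prod.distrib)
  finally show ?thesis .
qed

text \<open>The exponential moment of the l1 norm after \<open>j\<close> steps, bounded through the
  eigenfunction \<open>cosh_prod\<close>; a finite set \<open>B\<close> of endpoints keeps the sum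
  finite.\<close>

lemma sum_exp_step_kernel_le:
  fixes B :: "(int ^ 'd) set"
  assumes "finite B" "\<mu> \<ge> 0"
  shows "(\<Sum>w\<in>B. exp (\<mu> * real_of_int (l1_norm w)) * step_kernel j w) \<le> 2 ^ CARD('d) * cosh \<mu> ^ j"
proof -
  have cp: "0 \<le> cosh_prod \<mu> w" for w :: "int ^ 'd"
    unfolding cosh_prod_def by (intro prod_nonneg) (simp add: less_imp_le cosh_real_pos)
  have "(\<Sum>w\<in>B. exp (\<mu> * real_of_int (l1_norm w)) * step_kernel j w)
      = walk_mean j (\<lambda>vs. \<Sum>w\<in>B. exp (\<mu> * real_of_int (l1_norm w)) * of_bool (sum_list vs = w))"
    by (simp add: walk_mean_sum step_kernel_def walk_mean_cmult)
  also have "\<dots> \<le> walk_mean j (\<lambda>vs :: (int ^ 'd) list. 2 ^ CARD('d) * cosh_prod \<mu> (0 + sum_list vs))"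
  proof (rule walk_mean_mono)
    fix vs :: "(int ^ 'd) list"
    have "(\<Sum>w\<in>B. exp (\<mu> * real_of_int (l1_norm w)) * of_bool (sum_list vs = w))
        = (if sum_list vs \<in> B then exp (\<mu> * real_of_int (l1_norm (sum_list vs))) else 0)"
      using assms(1) by (simp add: of_bool_def if_distrib sum.delta' cong: if_cong)
    also have "\<dots> \<le> 2 ^ CARD('d) * cosh_prod \<mu> (sum_list vs)"
      using exp_l1_norm_le_cosh_prod[OF assms(2), of "sum_list vs"] cp by auto
    finally show "(\<Sum>w\<in>B. exp (\<mu> * real_of_int (l1_norm w)) * of_bool (sum_list vs = w))
        \<le> 2 ^ CARD('d) * cosh_prod \<mu> (0 + sum_list vs)" by simp
  qed
  also have "\<dots> = 2 ^ CARD('d) * cosh \<mu> ^ j"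
    unfolding walk_mean_cmult walk_mean_cosh_prod by (simp add: cosh_prod_def)
  finally show ?thesis .
qed

text \<open>Termwise comparison of the power series, by
  \<open>2 ^ n * fact n \<le> fact (2 * n)\<close>.\<close>

lemma cosh_le_exp_half_square: "cosh x \<le> exp (x\<^sup>2 / 2)" for x :: real
proof -
  have s1: "(\<lambda>n. x ^ (2 * n) / fact (2 * n)) sums cosh x"
  proof -
    have "(\<lambda>n. if even n then x ^ n /\<^sub>R fact n else 0) sums cosh x" by (rule cosh_converges)
    then have "(\<lambda>n. (\<lambda>n. if even n then x ^ n /\<^sub>R fact n else 0) (2 * n)) sums cosh x"
      by (subst sums_mono_reindex) (auto simp: strict_mono_def elim!: evenE)
    then show ?thesis by (simp add: divide_inverse mult.commute)
  qed
  have s2: "(\<lambda>n. (x\<^sup>2 / 2) ^ n /\<^sub>R fact n) sums exp (x\<^sup>2 / 2)" by (rule exp_converges)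
  have le: "x ^ (2 * n) / fact (2 * n) \<le> (x\<^sup>2 / 2) ^ n /\<^sub>R fact n" for n
  proof -
    have "(2 :: nat) ^ n * fact n \<le> fact (2 * n)"
    proof (induction n)
      case (Suc n)
      have "(2 :: nat) ^ Suc n * fact (Suc n) = (2 * Suc n) * (2 ^ n * fact n)" by (simp add: algebra_simps)
      also have "\<dots> \<le> (2 * Suc n) * fact (2 * n)" using Suc by (rule mult_left_mono) simp
      also have "\<dots> \<le> (2 * Suc n) * (Suc (2 * n) * fact (2 * n))" by (intro mult_left_mono) auto
      also have "\<dots> = fact (2 * Suc n)" by (simp add: algebra_simps)
      finally show ?case .
    qed simp
    then have "(2 :: real) ^ n * fact n \<le> fact (2 * n)"
      by (metis (mono_tags, lifting) of_nat_fact of_nat_le_iff of_nat_mult of_nat_numeral of_nat_power)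
    then have "(x\<^sup>2) ^ n / fact (2 * n) \<le> (x\<^sup>2) ^ n / (2 ^ n * fact n)"
      by (intro divide_left_mono) auto
    then show ?thesis by (simp only: power_mult power_divide) (simp add: divide_inverse mult_ac)
  qed
  show ?thesis by (rule sums_le[OF le s1 s2])
qed

text \<open>\<open>cosh \<mu> ^ j\<close> costs at most half of the discount
  \<open>\<mu>\<^sup>2 * j\<close>, so a geometric series remains. The bound is uniform in
  \<open>B\<close> and \<open>H\<close>: each hop of a chain costs a constant factor.\<close>

lemma sum_path_weight_le:
  fixes B :: "(int ^ 'd) set"
  assumes "finite B" "\<mu> > 0"
  shows "(\<Sum>(w, j)\<in>B \<times> {..H}. exp (\<mu> * real_of_int (l1_norm w) - \<mu>\<^sup>2 * real j) * step_kernel j w)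
    \<le> 2 ^ CARD('d) / (1 - exp (- \<mu>\<^sup>2 / 2))"
proof -
  define z where "z = exp (- \<mu>\<^sup>2 / 2)"
  have z: "0 \<le> z" "z < 1" using assms(2) by (auto simp: z_def)
  have "(\<Sum>(w, j)\<in>B \<times> {..H}. exp (\<mu> * real_of_int (l1_norm w) - \<mu>\<^sup>2 * real j) * step_kernel j w)
      = (\<Sum>j\<le>H. \<Sum>w\<in>B. exp (\<mu> * real_of_int (l1_norm w) - \<mu>\<^sup>2 * real j) * step_kernel j w)"
    by (simp add: sum.cartesian_product[symmetric] sum.swap[of _ B])
  also have "\<dots> = (\<Sum>j\<le>H. exp (- \<mu>\<^sup>2 * real j) * (\<Sum>w\<in>B. exp (\<mu> * real_of_int (l1_norm w)) * step_kernel j w))"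
    by (simp add: sum_distrib_left exp_diff exp_minus field_simps)
  also have "\<dots> \<le> (\<Sum>j\<le>H. 2 ^ CARD('d) * z ^ j)"
  proof (rule sum_mono)
    fix j
    have "exp (- \<mu>\<^sup>2 * real j) * (\<Sum>w\<in>B. exp (\<mu> * real_of_int (l1_norm w)) * step_kernel j w)
        \<le> exp (- \<mu>\<^sup>2 * real j) * (2 ^ CARD('d) * exp (\<mu>\<^sup>2 / 2) ^ j)"
    proof (intro mult_left_mono order_trans[OF sum_exp_step_kernel_le[OF assms(1)]])
      show "cosh \<mu> ^ j \<le> exp (\<mu>\<^sup>2 / 2) ^ j"
        using cosh_le_exp_half_square[of \<mu>] by (intro power_mono) (simp_all add: less_imp_le cosh_real_pos)
    qed (use assms(2) in auto)
    also have "\<dots> = 2 ^ CARD('d) * z ^ j"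
    proof -
      have "exp (- \<mu>\<^sup>2 * real j) * exp (real j * (\<mu>\<^sup>2 / 2)) = exp (real j * (- \<mu>\<^sup>2 / 2))"
        unfolding exp_add[symmetric] by (intro arg_cong[where f = exp]) (simp add: field_simps)
      then show ?thesis by (simp only: z_def exp_of_nat_mult mult.left_commute)
    qed
    finally show "exp (- \<mu>\<^sup>2 * real j) * (\<Sum>w\<in>B. exp (\<mu> * real_of_int (l1_norm w)) * step_kernel j w)
      \<le> 2 ^ CARD('d) * z ^ j" .
  qed
  also have "\<dots> = 2 ^ CARD('d) * (\<Sum>j\<le>H. z ^ j)" by (simp add: sum_distrib_left)
  also have "\<dots> \<le> 2 ^ CARD('d) * (1 / (1 - z))"
  proof (intro mult_left_mono)
    have "(\<Sum>j\<le>H. z ^ j) = (1 - z ^ Suc H) / (1 - z)"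
      using z by (simp add: sum_gp0)
    also have "\<dots> \<le> 1 / (1 - z)" using z by (intro divide_right_mono) auto
    finally show "(\<Sum>j\<le>H. z ^ j) \<le> 1 / (1 - z)" .
  qed simp
  finally show ?thesis by (simp add: z_def)
qed

section \<open>Union bound over chains of hops\<close>

lemma l1_norm_sum_le: "finite A \<Longrightarrow> l1_norm (\<Sum>i\<in>A. f i) \<le> (\<Sum>i\<in>A. l1_norm (f i))"
  by (induction A rule: finite_induct) (auto intro: order_trans[OF l1_norm_triangle])

lemma l1_norm_walk_le:
  assumes "\<And>j. S x (Suc j) \<omega> - S x j \<omega> \<in> unit_steps" "S x 0 \<omega> = x"
  shows "l1_norm (S x j \<omega> - x) \<le> int j"
proof (induction j)
  case (Suc j)
  have "l1_norm (S x (Suc j) \<omega> - x) \<le> l1_norm (S x j \<omega> - x) + l1_norm (S x (Suc j) \<omega> - S x j \<omega>)"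
    using l1_norm_triangle[of "S x j \<omega> - x" "S x (Suc j) \<omega> - S x j \<omega>"] by simp
  then show ?case using Suc assms(1)[of j] by (simp add: unit_steps_def)
qed (simp add: assms)

lemma ex_times_of_chain_time_le:
  assumes "chain_time S \<omega> ys \<le> enat H"
  obtains j where "\<And>i. i < length ys - 1 \<Longrightarrow> S (ys ! i) (j i) \<omega> = ys ! Suc i"
    "(\<Sum>i<length ys - 1. j i) \<le> H"
proof -
  let ?t = "\<lambda>i. hitting_time S \<omega> (ys ! i) (ys ! Suc i)"
  have le: "?t i \<le> chain_time S \<omega> ys" if "i < length ys - 1" for i
    unfolding chain_time_def using that by (intro member_le_sum) auto
  have "\<exists>j. S (ys ! i) j \<omega> = ys ! Suc i \<and> enat j \<le> ?t i" if i: "i < length ys - 1" for i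
  proof -
    obtain m where m: "?t i = enat m" using le[OF i] assms by (cases "?t i") auto
    then obtain j where "j \<le> m" "S (ys ! i) j \<omega> = ys ! Suc i"
      using hitting_time_le_iff[of S \<omega> "ys ! i" "ys ! Suc i" m] by auto
    then show ?thesis using m by auto
  qed
  then obtain j where j: "\<And>i. i < length ys - 1 \<Longrightarrow> S (ys ! i) (j i) \<omega> = ys ! Suc i \<and> enat (j i) \<le> ?t i"
    by metis
  have "enat (\<Sum>i<n. j i) = (\<Sum>i<n. enat (j i))" for n
    by (induction n) (auto simp: zero_enat_def plus_enat_simps(1)[symmetric] simp del: plus_enat_simps(1))
  then have "enat (\<Sum>i<length ys - 1. j i) = (\<Sum>i<length ys - 1. enat (j i))" .
  also have "\<dots> \<le> chain_time S \<omega> ys"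
    unfolding chain_time_def using j by (intro sum_mono) auto
  also have "\<dots> \<le> enat H" by (rule assms)
  finally show ?thesis using j that by auto
qed

abbreviation quick_path ::
  "'w measure \<Rightarrow> (int ^ 'd \<Rightarrow> nat \<Rightarrow> 'w \<Rightarrow> int ^ 'd) \<Rightarrow> int ^ 'd \<Rightarrow> real \<Rightarrow> nat \<Rightarrow> 'w set" where
  "quick_path M S x a H \<equiv> {\<omega> \<in> space M. \<exists>ys. ys \<noteq> [] \<and> distinct ys \<and> hd ys = 0 \<and> last ys = x \<and>
    real (length ys) < a \<and> chain_time S \<omega> ys \<le> enat H}"

context independent_simple_random_walks
begin

lemma prob_step_eq: "prob {\<omega> \<in> space M. S y j \<omega> = z} = step_kernel j (z - y)"
proof -
  have "prob {\<omega> \<in> space M. (\<lambda>j. S y j \<omega>) j = z} = walk_mean j (\<lambda>vs. of_bool (y + sum_list (take j vs) = z))"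
    by (rule simple_random_walk.prob_walk[OF walk, of j "\<lambda>w. w j = z"]) simp
  also have "\<dots> = step_kernel j (z - y)"
    unfolding step_kernel_def by (rule walk_mean_cong) (auto simp: algebra_simps)
  finally show ?thesis by simp
qed

text \<open>A chain with distinct vertices uses a different, hence independent, walk for each hop.
  Its probability is a product of transition probabilities, and with exponential weights the sum
  over all chains of \<open>k\<close> hops factorises into \<open>k\<close> sums of
  \<open>sum_path_weight_le\<close>. Fewer than \<open>a \<le> m + 2\<close> vertices mean at most
  \<open>m\<close> hops.\<close>

lemma prob_short_path_le:
  fixes x :: "int ^ 'd"
  assumes \<mu>: "\<mu> > 0" and a: "a \<le> real m + 2"
  shows "prob (quick_path M S x a H)
    \<le> real (Suc m) * (2 ^ CARD('d) / (1 - exp (- \<mu>\<^sup>2 / 2))) ^ m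
      * exp (\<mu>\<^sup>2 * real H - \<mu> * real_of_int (l1_norm x))"
proof -
  define Z :: real where "Z = 2 ^ CARD('d) / (1 - exp (- \<mu>\<^sup>2 / 2))"
  define B where "B = {w :: int ^ 'd. l1_norm (w - 0) \<le> int H}"
  have finB: "finite B" unfolding B_def by (rule finite_l1_ball)
  define y where "y g i = (\<Sum>l<i. fst (g l))" for g :: "nat \<Rightarrow> (int ^ 'd) \<times> nat" and i
  \<comment> \<open>A chain of \<open>k\<close> hops from the origin is coded by the displacement
    and the duration of each hop. Injectivity stops before the last vertex, from which no walk is
    used.\<close>
  define G where "G k = {g \<in> PiE {..<k} (\<lambda>_. B \<times> {..H}).
      (\<Sum>i<k. snd (g i)) \<le> H \<and> y g k = x \<and> inj_on (y g) {..<k}}" for k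
  define E where "E k g = {\<omega> \<in> space M. \<forall>i\<in>{..<k}. S (y g i) (snd (g i)) \<omega> = y g (Suc i)}" for k g
  have finG: "finite (G k)" for k
    unfolding G_def using finB by (intro finite_subset[OF _ finite_PiE[of "{..<k}" "\<lambda>_. B \<times> {..H}"]]) auto
  have mS: "{\<omega> \<in> space M. S a j \<omega> = b} \<in> events" for a j b
    by (rule measurable_sets_Collect[OF measurable_S, of "\<lambda>z. z = b"]) auto
  have E_ev: "E k g \<in> events" for k g
  proof -
    have "E k g = space M \<inter> (\<Inter>i\<in>{..<k}. {\<omega> \<in> space M. S (y g i) (snd (g i)) \<omega> = y g (Suc i)})"
      by (auto simp: E_def)
    also have "\<dots> \<in> events"
      using mS by (cases "k = 0") (auto intro!: sets.Int sets.finite_INT)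
    finally show ?thesis .
  qed
  have UE: "(\<Union>g\<in>G k. E k g) \<in> events" for k
    using E_ev finG by (intro sets.finite_UN) auto
  have Z1: "Z \<ge> 1"
  proof -
    define t where "t = exp (- \<mu>\<^sup>2 / 2)"
    have t: "0 < t" "t < 1" using \<mu> by (simp_all add: t_def)
    have "1 \<le> (2 :: real) ^ CARD('d)" by (intro one_le_power) simp
    then have "1 - t \<le> 2 ^ CARD('d)" using t by linarith
    then have "1 \<le> 2 ^ CARD('d) / (1 - t)" using t by (subst le_divide_eq_1_pos) auto
    then show ?thesis by (simp only: Z_def t_def)
  qed
  have E_prob: "prob (E k g) \<le> (\<Prod>i<k. step_kernel (snd (g i)) (fst (g i)))" if g: "g \<in> G k" for k g
  proof (cases "k = 0")
    case False
    let ?f = "\<lambda>i \<omega>. S (y g i) (snd (g i)) \<omega> = y g (Suc i)"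
    have inj: "inj_on (y g) {..<k}" using g by (simp add: G_def)
    have snd_le: "snd (g i) \<le> H" if "i < k" for i
      using g that by (fastforce simp: G_def PiE_def Pi_def)
    have ind: "indep_vars (\<lambda>_. count_space UNIV) ?f {..<k}"
    proof (rule indep_vars_local[of _ "\<lambda>i. {y g i}" H])
      show "disjoint_family_on (\<lambda>i. {y g i}) {..<k}"
        using inj by (auto simp: disjoint_family_on_def inj_on_def)
      fix i \<omega> \<omega>' assume i: "i \<in> {..<k}"
        and "\<And>a j. a \<in> {y g i} \<Longrightarrow> j \<le> H \<Longrightarrow> S a j \<omega> = S a j \<omega>'"
      then have "S (y g i) (snd (g i)) \<omega> = S (y g i) (snd (g i)) \<omega>'" using snd_le by simp
      then show "?f i \<omega> = ?f i \<omega>'" by simp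
    qed simp
    have "E k g = (\<Inter>i\<in>{..<k}. ?f i -` {True} \<inter> space M)"
      using False by (auto simp: E_def)
    also have "prob \<dots> = (\<Prod>i<k. prob (?f i -` {True} \<inter> space M))"
      using False by (intro indep_varsD_finite[OF ind]) auto
    also have "\<dots> = (\<Prod>i<k. step_kernel (snd (g i)) (fst (g i)))"
    proof (intro prod.cong refl)
      fix i
      have "?f i -` {True} \<inter> space M = {\<omega> \<in> space M. S (y g i) (snd (g i)) \<omega> = y g (Suc i)}" by auto
      then show "prob (?f i -` {True} \<inter> space M) = step_kernel (snd (g i)) (fst (g i))"
        by (simp add: prob_step_eq y_def)
    qed
    finally show ?thesis by simp
  qed simp
  have k_le: "(\<Sum>g\<in>G k. prob (E k g)) \<le> Z ^ k * exp (\<mu>\<^sup>2 * real H - \<mu> * real_of_int (l1_norm x))" for k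
  proof -
    let ?a = "exp (\<mu>\<^sup>2 * real H - \<mu> * real_of_int (l1_norm x))"
    let ?F = "\<lambda>(w, j). exp (\<mu> * real_of_int (l1_norm w) - \<mu>\<^sup>2 * real j) * step_kernel j w"
    have F_nn: "0 \<le> ?F p" for p
      by (cases p) (simp add: step_kernel_nonneg)
    have "prob (E k g) \<le> ?a * (\<Prod>i<k. ?F (g i))" if g: "g \<in> G k" for g
    proof -
      have "(\<Sum>i<k. real (snd (g i))) \<le> real H"
        using g by (simp add: G_def flip: of_nat_sum)
      then have "\<mu>\<^sup>2 * (\<Sum>i<k. real (snd (g i))) \<le> \<mu>\<^sup>2 * real H" by (intro mult_left_mono) auto
      moreover have "real_of_int (l1_norm x) \<le> (\<Sum>i<k. real_of_int (l1_norm (fst (g i))))"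
      proof -
        have "l1_norm x \<le> (\<Sum>i<k. l1_norm (fst (g i)))"
          using g l1_norm_sum_le[of "{..<k}" "\<lambda>i. fst (g i)"] by (auto simp: G_def y_def)
        then show ?thesis by (metis of_int_le_iff of_int_sum)
      qed
      then have "\<mu> * real_of_int (l1_norm x) \<le> \<mu> * (\<Sum>i<k. real_of_int (l1_norm (fst (g i))))"
        using \<mu> by (intro mult_left_mono) auto
      \<comment> \<open>Exponential Chebyshev: the displacements add up to \<open>x\<close> and the
        durations to at most \<open>H\<close>, so \<open>?a\<close> times the product of the
        exponential weights is at least 1.\<close>
      ultimately have "1 \<le> ?a * exp (\<Sum>i<k. \<mu> * real_of_int (l1_norm (fst (g i))) - \<mu>\<^sup>2 * real (snd (g i)))"
        by (simp add: exp_add[symmetric] sum_subtractf sum_distrib_left[symmetric])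
      then have "1 * (\<Prod>i<k. step_kernel (snd (g i)) (fst (g i)))
          \<le> ?a * exp (\<Sum>i<k. \<mu> * real_of_int (l1_norm (fst (g i))) - \<mu>\<^sup>2 * real (snd (g i)))
            * (\<Prod>i<k. step_kernel (snd (g i)) (fst (g i)))"
        by (intro mult_right_mono prod_nonneg) (auto simp: step_kernel_nonneg)
      also have "\<dots> = ?a * (\<Prod>i<k. ?F (g i))"
        by (simp add: exp_sum prod.distrib case_prod_unfold mult.assoc)
      finally show ?thesis using E_prob[OF g] by simp
    qed
    then have "(\<Sum>g\<in>G k. prob (E k g)) \<le> (\<Sum>g\<in>G k. ?a * (\<Prod>i<k. ?F (g i)))" by (rule sum_mono)
    also have "\<dots> \<le> (\<Sum>g\<in>PiE {..<k} (\<lambda>_. B \<times> {..H}). ?a * (\<Prod>i<k. ?F (g i)))"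
    proof (rule sum_mono2)
      show "finite (PiE {..<k} (\<lambda>_. B \<times> {..H}))" using finB by (intro finite_PiE) auto
      show "0 \<le> ?a * (\<Prod>i<k. ?F (g i))" for g
        by (intro mult_nonneg_nonneg prod_nonneg ballI F_nn) simp
    qed (auto simp: G_def)
    also have "\<dots> = ?a * (\<Prod>i<k. \<Sum>p\<in>B \<times> {..H}. ?F p)"
      using finB by (subst prod_sum_PiE) (auto simp: sum_distrib_left)
    also have "\<dots> \<le> ?a * Z ^ k"
    proof -
      have "(\<Sum>p\<in>B \<times> {..H}. ?F p) \<le> Z" using sum_path_weight_le[OF finB \<mu>] by (simp add: Z_def)
      moreover have "0 \<le> (\<Sum>p\<in>B \<times> {..H}. ?F p)" using F_nn by (intro sum_nonneg)
      ultimately show ?thesis by (simp add: power_mono)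
    qed
    finally show ?thesis by (simp add: mult.commute)
  qed
  \<comment> \<open>The inclusion is only almost sure, because a hop within time \<open>H\<close>
    has displacement in \<open>B\<close> only if all steps are unit steps.\<close>
  have "AE \<omega> in M. \<omega> \<in> (quick_path M S x a H) \<longrightarrow> \<omega> \<in> (\<Union>k\<in>{..m}. \<Union>g\<in>G k. E k g)"
    using AE_unit_steps
  proof eventually_elim
    case (elim \<omega>)
    show ?case
    proof
      assume "\<omega> \<in> (quick_path M S x a H)"
      then obtain ys where \<omega>: "\<omega> \<in> space M" and ys: "ys \<noteq> []" "distinct ys" "hd ys = 0" "last ys = x"
        "real (length ys) < a" "chain_time S \<omega> ys \<le> enat H" by auto
      define k where "k = length ys - 1"
      obtain j where j: "\<And>i. i < k \<Longrightarrow> S (ys ! i) (j i) \<omega> = ys ! Suc i" "(\<Sum>i<k. j i) \<le> H"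
        using ex_times_of_chain_time_le[OF ys(6)] unfolding k_def by blast
      define g where "g = restrict (\<lambda>i. (ys ! Suc i - ys ! i, j i)) {..<k}"
      have yg: "y g i = ys ! i" if "i \<le> k" for i
      proof -
        have "y g i = (\<Sum>l<i. ys ! Suc l - ys ! l)"
          unfolding y_def using that by (intro sum.cong) (auto simp: g_def)
        also have "\<dots> = ys ! i - ys ! 0" by (rule sum_lessThan_telescope)
        also have "ys ! 0 = 0" using ys by (simp add: hd_conv_nth)
        finally show ?thesis by simp
      qed
      have j_le: "j i \<le> H" if "i < k" for i
        using that j(2) member_le_sum[of i "{..<k}" j] by simp
      have "l1_norm (ys ! Suc i - ys ! i) \<le> int H" if "i < k" for i
      proof -
        have "l1_norm (S (ys ! i) (j i) \<omega> - ys ! i) \<le> int (j i)"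
          using elim start[OF \<omega>] by (intro l1_norm_walk_le) auto
        then show ?thesis using j(1)[OF that] j_le[OF that] by simp
      qed
      then have "g \<in> PiE {..<k} (\<lambda>_. B \<times> {..H})"
        using j_le by (intro PiE_I) (simp_all add: g_def B_def)
      moreover have "(\<Sum>i<k. snd (g i)) \<le> H" using j(2) by (simp add: g_def)
      moreover have "y g k = x" using yg[of k] ys by (simp add: k_def last_conv_nth)
      moreover have "inj_on (y g) {..<k}"
      proof (rule inj_onI)
        fix i l assume "i \<in> {..<k}" "l \<in> {..<k}" "y g i = y g l"
        then show "i = l" using yg[of i] yg[of l] ys(2) by (simp add: k_def nth_eq_iff_index_eq)
      qed
      ultimately have "g \<in> G k" by (simp add: G_def)
      moreover have "\<omega> \<in> E k g"
      proof -
        have "snd (g i) = j i" if "i < k" for i using that by (simp add: g_def)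
        then show ?thesis using \<omega> j(1) yg by (simp add: E_def)
      qed
      moreover have "k \<le> m" using ys(5) a by (simp add: k_def)
      ultimately show "\<omega> \<in> (\<Union>k\<in>{..m}. \<Union>g\<in>G k. E k g)" by blast
    qed
  qed
  then have "prob (quick_path M S x a H) \<le> prob (\<Union>k\<in>{..m}. \<Union>g\<in>G k. E k g)"
    by (rule finite_measure_mono_AE) (intro sets.finite_UN UE finite_atMost)
  also have "\<dots> \<le> (\<Sum>k\<in>{..m}. prob (\<Union>g\<in>G k. E k g))"
    using E_ev finG by (intro finite_measure_subadditive_finite) auto
  also have "\<dots> \<le> (\<Sum>k\<in>{..m}. \<Sum>g\<in>G k. prob (E k g))"
    using E_ev finG by (intro sum_mono finite_measure_subadditive_finite) auto
  also have "\<dots> \<le> (\<Sum>k\<in>{..m}. Z ^ m * exp (\<mu>\<^sup>2 * real H - \<mu> * real_of_int (l1_norm x)))"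
  proof (rule sum_mono)
    fix k assume "k \<in> {..m}"
    then have "Z ^ k \<le> Z ^ m" using Z1 by (intro power_increasing) auto
    then show "(\<Sum>g\<in>G k. prob (E k g)) \<le> Z ^ m * exp (\<mu>\<^sup>2 * real H - \<mu> * real_of_int (l1_norm x))"
      using order_trans[OF k_le[of k] mult_right_mono] by simp
  qed
  finally show ?thesis by (simp add: Z_def mult.assoc)
qed

end

section \<open>Linear growth of the passage time\<close>

lemma hitting_time_shift:
  "hitting_time (\<lambda>x j \<omega>. S (x + z) j \<omega> - z) \<omega> x y = hitting_time S \<omega> (x + z) (y + z)"
  by (simp add: hitting_time_def diff_eq_eq)

lemma first_passage_time_shift_le:
  "first_passage_time S \<omega> z (y + z) \<le> first_passage_time (\<lambda>x j \<omega>. S (x + z) j \<omega> - z) \<omega> 0 y"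
proof -
  let ?S = "\<lambda>x j \<omega>. S (x + z) j \<omega> - z"
  obtain ys where ys: "ys \<noteq> []" "hd ys = 0" "last ys = y" "chain_time ?S \<omega> ys = first_passage_time ?S \<omega> 0 y"
    by (rule chain_time_attains)
  have "chain_time S \<omega> (map (\<lambda>x. x + z) ys) = chain_time ?S \<omega> ys"
    by (simp add: chain_time_def hitting_time_shift)
  moreover have "first_passage_time S \<omega> z (y + z) \<le> chain_time S \<omega> (map (\<lambda>x. x + z) ys)"
    using ys by (intro first_passage_time_le_chain_time) (simp_all add: hd_map last_map)
  ultimately show ?thesis by (simp add: ys)
qed

text \<open>Confining the chain to a finite \<open>B\<close> makes the event depend on finitely many
  walks up to time \<open>m\<close>, which the passage time itself does not do.\<close>

definition passage_within ::
  "(int ^ 'd \<Rightarrow> nat \<Rightarrow> 'w \<Rightarrow> int ^ 'd) \<Rightarrow> (int ^ 'd) set \<Rightarrow> nat \<Rightarrow> int ^ 'd \<Rightarrow> int ^ 'd \<Rightarrow> 'w \<Rightarrow> bool" where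
  "passage_within S B m x y \<omega> \<longleftrightarrow>
    (\<exists>ys. ys \<noteq> [] \<and> set ys \<subseteq> B \<and> hd ys = x \<and> last ys = y \<and> chain_time S \<omega> ys \<le> enat m)"

lemma first_passage_time_le_iff:
  "first_passage_time S \<omega> x y \<le> enat m \<longleftrightarrow>
    (\<exists>ys. ys \<noteq> [] \<and> hd ys = x \<and> last ys = y \<and> chain_time S \<omega> ys \<le> enat m)"
proof
  assume le: "first_passage_time S \<omega> x y \<le> enat m"
  obtain ys where "ys \<noteq> []" "hd ys = x" "last ys = y" "chain_time S \<omega> ys = first_passage_time S \<omega> x y"
    by (rule chain_time_attains)
  with le show "\<exists>ys. ys \<noteq> [] \<and> hd ys = x \<and> last ys = y \<and> chain_time S \<omega> ys \<le> enat m" by auto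
next
  assume "\<exists>ys. ys \<noteq> [] \<and> hd ys = x \<and> last ys = y \<and> chain_time S \<omega> ys \<le> enat m"
  then show "first_passage_time S \<omega> x y \<le> enat m"
    using first_passage_time_le_chain_time[of _ x y S \<omega>] by (auto intro: order_trans)
qed

lemma chain_time_le_cong:
  assumes agree: "\<And>x j. x \<in> set ys \<Longrightarrow> j \<le> m \<Longrightarrow> S x j \<omega> = S x j \<omega>'"
    and le: "chain_time S \<omega> ys \<le> enat m"
  shows "chain_time S \<omega>' ys \<le> enat m"
proof -
  obtain j where j: "\<And>i. i < length ys - 1 \<Longrightarrow> S (ys ! i) (j i) \<omega> = ys ! Suc i"
    "(\<Sum>i<length ys - 1. j i) \<le> m"
    using ex_times_of_chain_time_le[OF le] by blast
  have "hitting_time S \<omega>' (ys ! i) (ys ! Suc i) \<le> enat (j i)" if "i < length ys - 1" for i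
  proof -
    have "j i \<le> m" using that j(2) member_le_sum[of i "{..<length ys - 1}" j] by simp
    then have "S (ys ! i) (j i) \<omega>' = ys ! Suc i"
      using agree[of "ys ! i" "j i"] j(1)[OF that] that by simp
    then show ?thesis by (auto simp: hitting_time_le_iff)
  qed
  then have "chain_time S \<omega>' ys \<le> (\<Sum>i<length ys - 1. enat (j i))"
    unfolding chain_time_def by (intro sum_mono) auto
  also have "(\<Sum>i<n. enat (j i)) = enat (\<Sum>i<n. j i)" for n
    by (induction n) (auto simp: zero_enat_def)
  finally show ?thesis using j(2) by (auto intro: order_trans)
qed

lemma passage_within_cong:
  assumes "\<And>x j. x \<in> B \<Longrightarrow> j \<le> m \<Longrightarrow> S x j \<omega> = S x j \<omega>'"
  shows "passage_within S B m x y \<omega> = passage_within S B m x y \<omega>'"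
  unfolding passage_within_def
  using assms chain_time_le_cong[of _ m S \<omega> \<omega>'] chain_time_le_cong[of _ m S \<omega>' \<omega>] by (metis subsetD)

text \<open>With unit steps a chain of duration \<open>m\<close> moves at most \<open>m\<close> from
  its start, so confinement to a ball of radius \<open>h \<ge> m\<close> costs nothing.\<close>

lemma passage_within_ball:
  assumes steps: "\<And>x j. S x (Suc j) \<omega> - S x j \<omega> \<in> unit_steps" "\<And>x. S x 0 \<omega> = x"
    and le: "first_passage_time S \<omega> x y \<le> enat m" "m \<le> h"
  shows "passage_within S {z. l1_norm (z - x) \<le> int h} m x y \<omega>"
proof -
  obtain ys where ys: "ys \<noteq> []" "hd ys = x" "last ys = y" "chain_time S \<omega> ys \<le> enat m"
    using le(1) by (auto simp: first_passage_time_le_iff)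
  obtain j where j: "\<And>i. i < length ys - 1 \<Longrightarrow> S (ys ! i) (j i) \<omega> = ys ! Suc i"
    "(\<Sum>i<length ys - 1. j i) \<le> m"
    using ex_times_of_chain_time_le[OF ys(4)] by blast
  have dist: "l1_norm (ys ! i - x) \<le> int (\<Sum>l<i. j l)" if "i < length ys" for i
    using that
  proof (induction i)
    case 0
    then show ?case using ys by (simp add: hd_conv_nth)
  next
    case (Suc i)
    have "l1_norm (S (ys ! i) (j i) \<omega> - ys ! i) \<le> int (j i)"
      using steps by (intro l1_norm_walk_le) auto
    then have "l1_norm (ys ! Suc i - ys ! i) \<le> int (j i)" using j(1)[of i] Suc.prems by simp
    moreover have "l1_norm (ys ! Suc i - x) \<le> l1_norm (ys ! Suc i - ys ! i) + l1_norm (ys ! i - x)"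
      using l1_norm_triangle[of "ys ! Suc i - ys ! i" "ys ! i - x"] by simp
    ultimately show ?case using Suc by simp
  qed
  have "l1_norm (ys ! i - x) \<le> int h" if "i < length ys" for i
  proof -
    have "(\<Sum>l<i. j l) \<le> (\<Sum>l<length ys - 1. j l)" using that by (intro sum_mono2) auto
    then show ?thesis using dist[OF that] j(2) le(2) by linarith
  qed
  then have "set ys \<subseteq> {z. l1_norm (z - x) \<le> int h}" by (auto simp: in_set_conv_nth)
  then show ?thesis using ys unfolding passage_within_def by blast
qed

lemma ex_geodesic:
  fixes x :: "int ^ 'd"
  obtains g :: "nat \<Rightarrow> int ^ 'd" where "g 0 = 0" "g (nat (l1_norm x)) = x"
    "\<And>i. i < nat (l1_norm x) \<Longrightarrow> l1_norm (g (Suc i) - g i) = 1"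
    "\<And>i. i \<le> nat (l1_norm x) \<Longrightarrow> l1_norm (g i) = int i"
proof -
  have "\<exists>g :: nat \<Rightarrow> int ^ 'd. g 0 = 0 \<and> g n = x \<and> (\<forall>i<n. l1_norm (g (Suc i) - g i) = 1) \<and>
      (\<forall>i\<le>n. l1_norm (g i) = int i)" if "l1_norm x = int n" for n and x :: "int ^ 'd"
    using that
  proof (induction n arbitrary: x)
    case 0
    then show ?case by (intro exI[of _ "\<lambda>_. 0"]) simp
  next
    case (Suc n)
    then have "x \<noteq> 0" by auto
    then obtain v where v: "v \<in> unit_steps" "l1_norm (x + v) = l1_norm x - 1"
      by (rule ex_unit_step_towards)
    then obtain g :: "nat \<Rightarrow> int ^ 'd" where g: "g 0 = 0" "g n = x + v"
      "\<forall>i<n. l1_norm (g (Suc i) - g i) = 1" "\<forall>i\<le>n. l1_norm (g i) = int i"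
      using Suc.IH[of "x + v"] Suc.prems by auto
    have "l1_norm (x - (x + v)) = 1"
      using v(1) l1_norm_minus_commute[of 0 v] by (simp add: unit_steps_def)
    then show ?case
      using g Suc.prems by (intro exI[of _ "g(Suc n := x)"]) (auto simp: less_Suc_eq le_Suc_eq)
  qed
  from this[of x "nat (l1_norm x)"] show ?thesis using that by auto
qed

section \<open>Sums of passage times along a geodesic\<close>

context independent_simple_random_walks
begin

lemma shift: "independent_simple_random_walks M (\<lambda>x j \<omega>. S (x + z) j \<omega> - z)"
proof (intro independent_simple_random_walks.intro independent_simple_random_walks_axioms.intro)
  show "prob_space M" by (rule prob_space_axioms)
next
  fix x
  interpret W: simple_random_walk M "x + z" "S (x + z)" by (rule walk)
  show "simple_random_walk M x (\<lambda>j \<omega>. S (x + z) j \<omega> - z)"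
  proof (intro simple_random_walk.intro simple_random_walk_axioms.intro prob_space_axioms)
    show "(\<lambda>\<omega>. S (x + z) j \<omega> - z) \<in> measurable M (count_space UNIV)" for j
      by (rule measurable_compose[OF measurable_S]) simp
    show "S (x + z) 0 \<omega> - z = x" if "\<omega> \<in> space M" for \<omega> using start[OF that] by simp
  qed (simp_all add: W.indep_increments W.distr_increment)
next
  let ?P = "PiM (UNIV :: nat set) (\<lambda>_. count_space (UNIV :: (int ^ 'd) set))"
  \<comment> \<open>Translating the index is expressed as a grouping of the walks into the singleton
    blocks \<open>{x + z}\<close>.\<close>
  have "indep_vars (\<lambda>x. PiM {x + z} (\<lambda>_. ?P)) (\<lambda>x \<omega>. restrict (\<lambda>y j. S y j \<omega>) {x + z}) UNIV"
    by (rule indep_vars_restrict[OF indep_walks]) (auto simp: disjoint_family_on_def)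
  then have "indep_vars (\<lambda>_. ?P) (\<lambda>x \<omega>. (\<lambda>f j. f (x + z) j - z) (restrict (\<lambda>y j. S y j \<omega>) {x + z})) UNIV"
  proof (rule indep_vars_compose2)
    fix x
    have c1: "(\<lambda>f. f (x + z)) \<in> measurable (PiM {x + z} (\<lambda>_. ?P)) ?P"
      by (rule measurable_component_singleton) simp
    have c2: "(\<lambda>w. w j) \<in> measurable ?P (count_space UNIV)" for j :: nat
      by (rule measurable_component_singleton) simp
    have c3: "(\<lambda>v. v - z) \<in> measurable (count_space UNIV) (count_space UNIV)" by simp
    have "(\<lambda>f. f (x + z) j - z) \<in> measurable (PiM {x + z} (\<lambda>_. ?P)) (count_space UNIV)" for j :: nat
      by (rule measurable_compose[OF measurable_compose[OF c1 c2] c3])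
    then show "(\<lambda>f j. f (x + z) j - z) \<in> measurable (PiM {x + z} (\<lambda>_. ?P)) ?P"
      by (rule measurable_abs_UNIV)
  qed
  then show "indep_vars (\<lambda>_. ?P) (\<lambda>x \<omega> j. S (x + z) j \<omega> - z) UNIV" by simp
qed

lemma chain_time_le_events: "{\<omega> \<in> space M. chain_time S \<omega> ys \<le> enat m} \<in> events"
proof -
  have "(\<lambda>\<omega>. chain_time S \<omega> ys \<le> enat m) \<in> measurable M (count_space UNIV)"
  proof (rule local_measurable[of "set ys" m])
    fix \<omega> \<omega>' assume a: "\<And>x j. x \<in> set ys \<Longrightarrow> j \<le> m \<Longrightarrow> S x j \<omega> = S x j \<omega>'"
    show "(chain_time S \<omega> ys \<le> enat m) = (chain_time S \<omega>' ys \<le> enat m)"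
      using chain_time_le_cong[of ys m S \<omega> \<omega>'] chain_time_le_cong[of ys m S \<omega>' \<omega>] a by metis
  qed simp
  from measurable_sets_Collect[OF this, of "\<lambda>b. b"] show ?thesis by simp
qed

lemma first_passage_time_le_events: "{\<omega> \<in> space M. first_passage_time S \<omega> x y \<le> enat m} \<in> events"
proof -
  have "{\<omega> \<in> space M. first_passage_time S \<omega> x y \<le> enat m}
      = (\<Union>ys\<in>{ys. ys \<noteq> [] \<and> hd ys = x \<and> last ys = y}. {\<omega> \<in> space M. chain_time S \<omega> ys \<le> enat m})"
    by (auto simp: first_passage_time_le_iff)
  then show ?thesis using chain_time_le_events by (auto intro: sets.countable_UN')
qed

lemma first_passage_time_gt_events: "(slow_passage M S x y m) \<in> events"
proof -
  have "(slow_passage M S x y m)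
      = space M - {\<omega> \<in> space M. first_passage_time S \<omega> x y \<le> enat m}" by auto
  then show ?thesis using first_passage_time_le_events by simp
qed

text \<open>A crude union bound with a slope \<open>h\<close> that may be large; it serves the
  finitely many \<open>x\<close> below the threshold of the asymptotic estimates.\<close>

lemma prob_passage_gt_le:
  assumes "\<And>x. x < n \<Longrightarrow> prob (slow_passage M S (g x) (g (Suc x)) h) \<le> \<tau>"
    and "g 0 = 0"
  shows "prob (slow_passage M S 0 (g n) (n * h)) \<le> real n * \<tau>"
proof -
  have sum_le: "first_passage_time S \<omega> 0 (g n) \<le> enat (n * h)"
    if "\<And>i. i < n \<Longrightarrow> first_passage_time S \<omega> (g i) (g (Suc i)) \<le> enat h" for n \<omega>
    using that
  proof (induction n)
    case 0
    then show ?case using assms(2) by (simp add: first_passage_time_refl)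
  next
    case (Suc n)
    have "first_passage_time S \<omega> 0 (g (Suc n)) \<le> first_passage_time S \<omega> 0 (g n) + first_passage_time S \<omega> (g n) (g (Suc n))"
      by (rule first_passage_time_triangle)
    also have "\<dots> \<le> enat (n * h) + enat h" using Suc by (intro add_mono) auto
    finally show ?case by (simp add: add.commute)
  qed
  have "prob (slow_passage M S 0 (g n) (n * h))
      \<le> prob (\<Union>i<n. (slow_passage M S (g i) (g (Suc i)) h))"
  proof (rule finite_measure_mono)
    show "(slow_passage M S 0 (g n) (n * h))
        \<subseteq> (\<Union>i<n. (slow_passage M S (g i) (g (Suc i)) h))"
    proof
      fix \<omega> assume "\<omega> \<in> (slow_passage M S 0 (g n) (n * h))"
      then have "\<omega> \<in> space M" "\<exists>i<n. \<not> first_passage_time S \<omega> (g i) (g (Suc i)) \<le> enat h"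
        using sum_le[of n \<omega>] by blast+
      then show "\<omega> \<in> (\<Union>i<n. (slow_passage M S (g i) (g (Suc i)) h))"
        by blast
    qed
    show "(\<Union>i<n. (slow_passage M S (g i) (g (Suc i)) h)) \<in> events"
      using first_passage_time_gt_events by (intro sets.finite_UN) auto
  qed
  also have "\<dots> \<le> (\<Sum>i<n. prob (slow_passage M S (g i) (g (Suc i)) h))"
    using first_passage_time_gt_events by (intro finite_measure_subadditive_finite) auto
  also have "\<dots> \<le> (\<Sum>i<n. \<tau>)" using assms(1) by (intro sum_mono) auto
  finally show ?thesis by simp
qed

text \<open>The passage times between successive points of a geodesic, truncated at \<open>h\<close>, depend only
  on the walks started within distance \<open>h\<close>, hence are independent for points further than \<open>2 h\<close>
  apart; Hoeffding's inequality is applied to each residue class modulo \<open>2 h + 1\<close>.\<close>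

lemma prob_passage_along_geodesic_le:
  assumes g: "g 0 = 0" "\<And>i. i \<le> n \<Longrightarrow> l1_norm (g i) = int i"
    and \<mu>: "\<And>i. i < n \<Longrightarrow> (\<Sum>m<h. prob (slow_passage M S (g i) (g (Suc i)) m)) \<le> real \<mu>"
    and \<tau>: "\<And>i. i < n \<Longrightarrow> prob (slow_passage M S (g i) (g (Suc i)) h) \<le> \<tau>"
    and h: "h \<ge> 1" "2 * h + 1 \<le> n"
  shows "prob (slow_passage M S 0 (g n) ((\<mu> + 1) * n))
    \<le> real n * \<tau> + real (2 * h + 1) * exp (- 2 * real (n div (2 * h + 1)) / real h ^ 2)"
proof -
  define L where "L = 2 * h + 1"
  define B where "B i = {z. l1_norm (z - g i) \<le> int h}" for i
  define R where "R i m \<omega> = passage_within S (B i) m (g i) (g (Suc i)) \<omega>" for i m \<omega>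
  \<comment> \<open>Counting the \<open>m < h\<close> that the passage time exceeds gives, almost
    surely, its minimum with \<open>h\<close>; the localised \<open>R\<close> makes this count
    local, and its mean is a sum of tail probabilities.\<close>
  define Y where "Y i \<omega> = (\<Sum>m<h. of_bool (\<not> R i m \<omega>) :: real)" for i \<omega>
  define I where "I c = {i. i < n \<and> i mod L = c}" for c
  have L: "L \<ge> 1" by (simp add: L_def)
  have fI: "finite (I c)" for c by (simp add: I_def)
  have fB: "finite (B i)" for i unfolding B_def by (rule finite_l1_ball)
  have Y_loc: "Y i \<omega> = Y i \<omega>'" if agree: "\<And>x j. x \<in> B i \<Longrightarrow> j \<le> h \<Longrightarrow> S x j \<omega> = S x j \<omega>'" for i \<omega> \<omega>'
  proof -
    have "R i m \<omega> = R i m \<omega>'" if "m < h" for m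
      unfolding R_def using \<open>m < h\<close> by (intro passage_within_cong agree) auto
    then show ?thesis unfolding Y_def by (intro sum.cong) auto
  qed
  have R_events: "{\<omega> \<in> space M. \<not> R i m \<omega>} \<in> events" for i m
  proof -
    have "R i m \<in> measurable M (count_space UNIV)"
    proof (rule local_measurable[OF fB[of i], of m])
      fix \<omega> \<omega>' assume a: "\<And>x j. x \<in> B i \<Longrightarrow> j \<le> m \<Longrightarrow> S x j \<omega> = S x j \<omega>'"
      show "R i m \<omega> = R i m \<omega>'" unfolding R_def by (rule passage_within_cong) (rule a)
    qed
    from measurable_sets_Collect[OF this, of "\<lambda>b. \<not> b"] show ?thesis by simp
  qed
  have R_iff: "AE \<omega> in M. \<forall>i m. m \<le> h \<longrightarrow> (R i m \<omega> \<longleftrightarrow> first_passage_time S \<omega> (g i) (g (Suc i)) \<le> enat m)"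
    using AE_unit_steps AE_space
  proof eventually_elim
    case (elim \<omega>)
    show ?case
    proof (intro allI impI iffI)
      fix i m assume "m \<le> h" "first_passage_time S \<omega> (g i) (g (Suc i)) \<le> enat m"
      then show "R i m \<omega>"
        unfolding R_def B_def using elim start by (intro passage_within_ball) auto
    next
      fix i m assume "R i m \<omega>"
      then show "first_passage_time S \<omega> (g i) (g (Suc i)) \<le> enat m"
        unfolding R_def passage_within_def first_passage_time_le_iff by blast
    qed
  qed
  have prob_R: "prob {\<omega> \<in> space M. \<not> R i m \<omega>}
      = prob (slow_passage M S (g i) (g (Suc i)) m)" if "m \<le> h" for i m
    using R_iff R_events first_passage_time_gt_events that by (intro measure_eq_AE) auto
  have Y_borel: "Y i \<in> borel_measurable M" for i
    by (rule measurable_compose[OF local_measurable[OF fB[of i] Y_loc]]) auto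
  have Y_range: "0 \<le> Y i \<omega>" "Y i \<omega> \<le> real h" for i \<omega>
  proof -
    show "0 \<le> Y i \<omega>" unfolding Y_def by (intro sum_nonneg) auto
    have "Y i \<omega> \<le> (\<Sum>m<h. 1)" unfolding Y_def by (intro sum_mono) auto
    then show "Y i \<omega> \<le> real h" by simp
  qed
  have EY: "expectation (Y i) \<le> real \<mu>" if "i < n" for i
  proof -
    have int: "integrable M (indicator {\<omega> \<in> space M. \<not> R i m \<omega>} :: _ \<Rightarrow> real)" for m
      using R_events by (intro integrable_real_indicator) (auto simp: less_top[symmetric])
    have "Y i \<omega> = (\<Sum>m<h. indicator {\<omega> \<in> space M. \<not> R i m \<omega>} \<omega>)" if "\<omega> \<in> space M" for \<omega>
      unfolding Y_def using that by (intro sum.cong refl) (simp add: indicator_def of_bool_def)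
    then have "expectation (Y i) = expectation (\<lambda>\<omega>. \<Sum>m<h. indicator {\<omega> \<in> space M. \<not> R i m \<omega>} \<omega>)"
      by (intro Bochner_Integration.integral_cong refl)
    also have "\<dots> = (\<Sum>m<h. expectation (indicator {\<omega> \<in> space M. \<not> R i m \<omega>}))"
      by (rule Bochner_Integration.integral_sum[OF int])
    also have "\<dots> = (\<Sum>m<h. prob {\<omega> \<in> space M. \<not> R i m \<omega>})"
      using sets.sets_into_space[OF R_events] by (simp add: Int_absorb2)
    also have "\<dots> = (\<Sum>m<h. prob (slow_passage M S (g i) (g (Suc i)) m))"
      by (intro sum.cong refl prob_R) auto
    finally show ?thesis using \<mu>[OF that] by simp
  qed
  have indep: "indep_vars (\<lambda>_. borel) Y (I c)" for c
  proof -
    have "indep_vars (\<lambda>_. count_space UNIV) Y (I c)"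
    proof (rule indep_vars_local[of _ B h])
      show "disjoint_family_on B (I c)"
        unfolding disjoint_family_on_def
      proof (intro ballI impI)
        have *: "B i \<inter> B l = {}" if "i \<in> I c" "l \<in> I c" "i < l" for i l
        proof (rule ccontr)
          assume "B i \<inter> B l \<noteq> {}"
          then obtain z where z: "l1_norm (z - g i) \<le> int h" "l1_norm (z - g l) \<le> int h" by (auto simp: B_def)
          have "L dvd l - i" using that mod_eq_dvd_iff_nat[of i l L] by (simp add: I_def)
          then have "l - i \<ge> L" using that(3) by (intro dvd_imp_le) auto
          \<comment> \<open>Since \<open>g i\<close> has norm \<open>i\<close>, two balls that meet
            force \<open>l - i \<le> 2 * h\<close>, which is less than \<open>L\<close>.\<close>
          moreover have "l1_norm (g l) \<le> l1_norm (g i) + l1_norm (z - g i) + l1_norm (z - g l)"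
            using l1_norm_triangle[of "g i" "z - g i"] l1_norm_triangle[of z "g l - z"]
              l1_norm_minus_commute[of "g l" z] by simp
          then have "int l \<le> int i + 2 * int h" using g(2) z that by (simp add: I_def)
          ultimately show False using that(3) by (simp add: L_def)
        qed
        fix i l assume "i \<in> I c" "l \<in> I c" "i \<noteq> l"
        then show "B i \<inter> B l = {}"
          using *[of i l] *[of l i] by (cases "i < l") (auto simp: Int_commute)
      qed
      fix i \<omega> \<omega>' assume "\<And>x j. x \<in> B i \<Longrightarrow> j \<le> h \<Longrightarrow> S x j \<omega> = S x j \<omega>'"
      then show "Y i \<omega> = Y i \<omega>'" by (rule Y_loc)
    qed (rule fB)
    then have "indep_vars (\<lambda>_. borel) (\<lambda>i \<omega>. (\<lambda>t. t) (Y i \<omega>)) (I c)"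
      by (rule indep_vars_compose2) simp
    then show ?thesis by simp
  qed
  have card_I: "n div L \<le> card (I c)" if "c < L" for c
  proof -
    have "(\<lambda>k. k * L + c) ` {..<n div L} \<subseteq> I c"
    proof
      fix i assume "i \<in> (\<lambda>k. k * L + c) ` {..<n div L}"
      then obtain k where k: "k < n div L" "i = k * L + c" by auto
      have "i < (k + 1) * L" using that k by simp
      also have "\<dots> \<le> (n div L) * L" using k by (intro mult_right_mono) auto
      also have "\<dots> \<le> n" by simp
      finally show "i \<in> I c" using that k by (simp add: I_def)
    qed
    then have "card ((\<lambda>k. k * L + c) ` {..<n div L}) \<le> card (I c)" using fI by (intro card_mono)
    moreover have "card ((\<lambda>k. k * L + c) ` {..<n div L}) = n div L"
      using L by (subst card_image) (auto simp: inj_on_def)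
    ultimately show ?thesis by simp
  qed
  have nL: "n div L \<ge> 1" using h(2) L by (simp add: L_def div_greater_zero_iff Suc_le_eq)
  define F where "F c = {\<omega> \<in> space M. (\<Sum>i\<in>I c. Y i \<omega>) \<ge> (real \<mu> + 1) * real (card (I c))}" for c
  have class_le: "prob (F c)
      \<le> exp (- 2 * real (n div L) / real h ^ 2)" if "c < L" for c
  proof -
    have cI: "card (I c) \<ge> 1" using card_I[OF that] nL by linarith
    \<comment> \<open>Deviation \<open>card (I c)\<close> above the mean with variables in
      \<open>[0, h]\<close> gives the exponent \<open>- 2 * card (I c) / h ^ 2\<close>, and each
      class has at least \<open>n div L\<close> indices.\<close>
    interpret Hf: Hoeffding_ineq M "I c" Y "\<lambda>_. 0" "\<lambda>_. real h" "\<Sum>i\<in>I c. expectation (Y i)"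
      by unfold_locales (use fI indep Y_range in auto)
    have "(\<Sum>i\<in>I c. expectation (Y i)) \<le> (\<Sum>i\<in>I c. real \<mu>)"
      using EY by (intro sum_mono) (auto simp: I_def)
    then have "F c \<subseteq> {\<omega> \<in> space M. (\<Sum>i\<in>I c. Y i \<omega>) \<ge> (\<Sum>i\<in>I c. expectation (Y i)) + real (card (I c))}"
      by (auto simp: F_def algebra_simps)
    then have "prob (F c)
        \<le> prob {\<omega> \<in> space M. (\<Sum>i\<in>I c. Y i \<omega>) \<ge> (\<Sum>i\<in>I c. expectation (Y i)) + real (card (I c))}"
      using Y_borel by (intro finite_measure_mono) auto
    also have "\<dots> \<le> exp (- 2 * (real (card (I c)))\<^sup>2 / (\<Sum>i\<in>I c. (real h - 0)\<^sup>2))"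
      using cI h(1) by (intro Hf.Hoeffding_ineq_ge) auto
    also have "\<dots> = exp (- 2 * real (card (I c)) / real h ^ 2)"
      using cI by (simp add: power2_eq_square)
    also have "\<dots> \<le> exp (- 2 * real (n div L) / real h ^ 2)"
      using card_I[OF that] by (simp add: divide_right_mono)
    finally show ?thesis .
  qed
  define E1 where "E1 = (\<Union>i<n. (slow_passage M S (g i) (g (Suc i)) h))"
  define E2 where "E2 = (\<Union>c<L. F c)"
  have E1: "E1 \<in> events" unfolding E1_def using first_passage_time_gt_events by (intro sets.finite_UN) auto
  have E2_ev: "F c \<in> events" for c
    unfolding F_def using Y_borel by measurable
  have E2: "E2 \<in> events" unfolding E2_def using E2_ev by (intro sets.finite_UN) auto
  have "AE \<omega> in M. \<omega> \<in> (slow_passage M S 0 (g n) ((\<mu> + 1) * n)) \<longrightarrow> \<omega> \<in> E1 \<union> E2"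
    using R_iff
  proof eventually_elim
    case (elim \<omega>)
    show ?case
    proof (intro impI, rule ccontr)
      assume a: "\<omega> \<in> (slow_passage M S 0 (g n) ((\<mu> + 1) * n))" and b: "\<omega> \<notin> E1 \<union> E2"
      let ?T = "\<lambda>i. first_passage_time S \<omega> (g i) (g (Suc i))"
      have fin: "?T i \<le> enat h" if "i < n" for i using a b that by (auto simp: E1_def)
      \<comment> \<open>Off \<open>E1\<close> every neighbour passage takes at most
        \<open>h\<close>, so the truncated value is the passage time itself.\<close>
      have Y_eq: "enat (nat \<lfloor>Y i \<omega>\<rfloor>) = ?T i \<and> Y i \<omega> = real (nat \<lfloor>Y i \<omega>\<rfloor>)" if i: "i < n" for i
      proof -
        obtain t where t: "?T i = enat t" "t \<le> h" using fin[OF i] by (cases "?T i") auto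
        have "Y i \<omega> = (\<Sum>m<h. of_bool (m < t))"
          unfolding Y_def
        proof (rule sum.cong)
          fix m assume m: "m \<in> {..<h}"
          with elim have "R i m \<omega> \<longleftrightarrow> ?T i \<le> enat m" by simp
          then show "of_bool (\<not> R i m \<omega>) = (of_bool (m < t) :: real)" using t by auto
        qed simp
        also have "\<dots> = real (card ({..<h} \<inter> {m. m < t}))" by simp
        also have "{..<h} \<inter> {m. m < t} = {..<t}" using t(2) by auto
        finally show ?thesis using t(1) by simp
      qed
      define t where "t i = nat \<lfloor>Y i \<omega>\<rfloor>" for i
      have "first_passage_time S \<omega> 0 (g k) \<le> enat (\<Sum>i<k. t i)" if "k \<le> n" for k
        using that
      proof (induction k)
        case 0
        then show ?case using g(1) by (simp add: first_passage_time_refl)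
      next
        case (Suc k)
        have "first_passage_time S \<omega> 0 (g (Suc k)) \<le> first_passage_time S \<omega> 0 (g k) + ?T k"
          by (rule first_passage_time_triangle)
        also have "\<dots> \<le> enat (\<Sum>i<k. t i) + enat (t k)"
          using Suc Y_eq[of k] by (intro add_mono) (auto simp: t_def)
        finally show ?case by simp
      qed
      then have "first_passage_time S \<omega> 0 (g n) \<le> enat (\<Sum>i<n. t i)" by simp
      moreover have "(\<Sum>i<n. t i) \<le> (\<mu> + 1) * n"
      proof -
        have part: "(\<Sum>i<n. f i) = (\<Sum>c<L. \<Sum>i\<in>I c. f i)" for f :: "nat \<Rightarrow> real"
        proof -
          have "(\<Sum>c<L. \<Sum>i\<in>I c. f i) = (\<Sum>c<L. \<Sum>i\<in>{i \<in> {..<n}. i mod L = c}. f i)"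
            by (simp add: I_def)
          also have "\<dots> = (\<Sum>i<n. f i)"
            using L by (intro sum.group) auto
          finally show ?thesis ..
        qed
        have "real (\<Sum>i<n. t i) = (\<Sum>i<n. Y i \<omega>)"
          unfolding of_nat_sum using Y_eq by (intro sum.cong) (auto simp: t_def)
        also have "\<dots> = (\<Sum>c<L. \<Sum>i\<in>I c. Y i \<omega>)" by (rule part)
        also have "\<dots> \<le> (\<Sum>c<L. (real \<mu> + 1) * real (card (I c)))"
        proof (rule sum_mono)
          fix c assume "c \<in> {..<L}"
          then show "(\<Sum>i\<in>I c. Y i \<omega>) \<le> (real \<mu> + 1) * real (card (I c))"
            using a b by (auto simp: E2_def F_def not_le less_imp_le)
        qed
        also have "\<dots> = (real \<mu> + 1) * (\<Sum>c<L. \<Sum>i\<in>I c. 1)"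
          by (simp add: sum_distrib_left)
        also have "(\<Sum>c<L. \<Sum>i\<in>I c. 1) = real n" using part[of "\<lambda>_. 1"] by simp
        also have "(real \<mu> + 1) * real n = real ((\<mu> + 1) * n)" by (simp add: distrib_right)
        finally have "real (\<Sum>i<n. t i) \<le> real ((\<mu> + 1) * n)" .
        then show ?thesis by (simp only: of_nat_le_iff)
      qed
      then have "enat (\<Sum>i<n. t i) \<le> enat ((\<mu> + 1) * n)" by (simp only: enat_ord_simps)
      ultimately have "first_passage_time S \<omega> 0 (g n) \<le> enat ((\<mu> + 1) * n)" by (rule order_trans)
      then show False using a by blast
    qed
  qed
  then have "prob (slow_passage M S 0 (g n) ((\<mu> + 1) * n)) \<le> prob (E1 \<union> E2)"
    using E1 E2 by (intro finite_measure_mono_AE) auto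
  also have "\<dots> \<le> prob E1 + prob E2" using E1 E2 by (intro measure_Un_le) auto
  also have "prob E1 \<le> (\<Sum>i<n. prob (slow_passage M S (g i) (g (Suc i)) h))"
    unfolding E1_def using first_passage_time_gt_events by (intro finite_measure_subadditive_finite) auto
  also have "\<dots> \<le> (\<Sum>i<n. \<tau>)" using \<tau> by (intro sum_mono) auto
  also have "prob E2 \<le> (\<Sum>c<L. prob (F c))"
    unfolding E2_def using E2_ev by (intro finite_measure_subadditive_finite) auto
  also have "\<dots> \<le> (\<Sum>c<L. exp (- 2 * real (n div L) / real h ^ 2))"
    using class_le by (intro sum_mono) auto
  finally show ?thesis by (simp add: L_def)
qed

end

section \<open>Lengths of optimal paths\<close>

text \<open>Nonemptiness comes from \<open>ex_optimal_path\<close>, and the upper bound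
  \<open>b\<close> already makes the set of lengths finite, so existence of minimum and maximum
  needs no separate argument.\<close>

lemma optimal_lengths_between_iff:
  "optimal_lengths_between S \<omega> x a b \<longleftrightarrow>
    (\<forall>\<gamma>\<in>optimal_paths S \<omega> 0 x. a \<le> real (length \<gamma>) \<and> real (length \<gamma>) \<le> b)"
proof -
  let ?L = "length ` optimal_paths S \<omega> 0 x"
  have ne: "?L \<noteq> {}" using ex_optimal_path[of S \<omega> 0 x] by simp
  show ?thesis
  proof
    assume "optimal_lengths_between S \<omega> x a b"
    then have L: "finite ?L" "a \<le> real (Min ?L)" "real (Max ?L) \<le> b"
      by (simp_all add: optimal_lengths_between_def Let_def)
    show "\<forall>\<gamma>\<in>optimal_paths S \<omega> 0 x. a \<le> real (length \<gamma>) \<and> real (length \<gamma>) \<le> b"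
    proof
      fix \<gamma> assume "\<gamma> \<in> optimal_paths S \<omega> 0 x"
      then have "Min ?L \<le> length \<gamma>" "length \<gamma> \<le> Max ?L" using L(1) by simp_all
      then show "a \<le> real (length \<gamma>) \<and> real (length \<gamma>) \<le> b"
        using L(2,3) by (meson of_nat_le_iff order_trans)
    qed
  next
    assume R: "\<forall>\<gamma>\<in>optimal_paths S \<omega> 0 x. a \<le> real (length \<gamma>) \<and> real (length \<gamma>) \<le> b"
    then have "?L \<subseteq> {..nat \<lfloor>b\<rfloor>}" by (auto simp: le_nat_floor)
    then have fin: "finite ?L" using finite_subset by blast
    have "a \<le> real (Min ?L)" "real (Max ?L) \<le> b"
      using R Min_in[OF fin ne] Max_in[OF fin ne] by auto
    moreover have "Min ?L \<le> Max ?L" using fin ne by simp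
    ultimately show "optimal_lengths_between S \<omega> x a b"
      using fin ne by (simp add: optimal_lengths_between_def Let_def)
  qed
qed

text \<open>Rewrites equality of times through countably many threshold events.\<close>

lemma enat_eq_iff_le: "(X :: enat) = Y \<longleftrightarrow> (\<forall>m. X \<le> enat m \<longleftrightarrow> Y \<le> enat m)"
proof
  assume R: "\<forall>m. X \<le> enat m \<longleftrightarrow> Y \<le> enat m"
  show "X = Y"
  proof (cases X)
    case (enat k)
    then have "Y \<le> enat k" using R by auto
    then obtain l where "Y = enat l" by (cases Y) auto
    then have "X \<le> enat l" "enat l \<le> enat k" using R \<open>Y \<le> enat k\<close> by auto
    then show ?thesis using \<open>Y = enat l\<close> enat by simp
  next
    case infinity
    then show ?thesis using R by (cases Y) auto
  qed
qed simp

text \<open>The sum is split into blocks from \<open>A * q ^ b\<close> to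
  \<open>A * Suc q ^ b\<close>, on each of which monotonicity gives the bound
  \<open>\<tau> q\<close>; before \<open>A * q0 ^ b\<close> the terms are bounded by 1. It turns the
  tail known along powers into a bound for truncated means.\<close>

lemma sum_tail_le:
  fixes P \<tau> :: "nat \<Rightarrow> real"
  assumes mono: "\<And>i j. i \<le> j \<Longrightarrow> P j \<le> P i" and "\<And>i. P i \<le> 1"
    and \<tau>: "\<And>q. q \<ge> q0 \<Longrightarrow> P (A * q ^ b) \<le> \<tau> q" "\<And>q. 0 \<le> \<tau> q" and "Q \<ge> q0"
  shows "(\<Sum>m<A * Q ^ b. P m) \<le> real (A * q0 ^ b) + (\<Sum>q<Q. real A * (real q + 1) ^ b * \<tau> q)"
  using \<open>Q \<ge> q0\<close>
proof (induction Q rule: dec_induct)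
  case base
  have "(\<Sum>m<A * q0 ^ b. P m) \<le> (\<Sum>m<A * q0 ^ b. 1)" using assms(2) by (intro sum_mono)
  moreover have "0 \<le> (\<Sum>q<q0. real A * (real q + 1) ^ b * \<tau> q)"
    using \<tau>(2) by (intro sum_nonneg mult_nonneg_nonneg) auto
  ultimately show ?case by simp
next
  case (step Q)
  have le: "A * Q ^ b \<le> A * Suc Q ^ b" by (intro mult_left_mono power_mono) auto
  have "(\<Sum>m<A * Suc Q ^ b. P m) = (\<Sum>m<A * Q ^ b. P m) + (\<Sum>m=A * Q ^ b..<A * Suc Q ^ b. P m)"
    using sum.atLeastLessThan_concat[of 0 "A * Q ^ b" "A * Suc Q ^ b" P] le
    by (simp add: atLeast0LessThan)
  also have "(\<Sum>m=A * Q ^ b..<A * Suc Q ^ b. P m) \<le> (\<Sum>m=A * Q ^ b..<A * Suc Q ^ b. \<tau> Q)"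
  proof (rule sum_mono)
    fix m assume "m \<in> {A * Q ^ b..<A * Suc Q ^ b}"
    then have "P m \<le> P (A * Q ^ b)" by (intro mono) auto
    also have "\<dots> \<le> \<tau> Q" using step by (intro \<tau>)
    finally show "P m \<le> \<tau> Q" .
  qed
  also have "\<dots> = real (A * Suc Q ^ b - A * Q ^ b) * \<tau> Q" by simp
  also have "\<dots> \<le> real (A * Suc Q ^ b) * \<tau> Q"
    by (intro mult_right_mono of_nat_mono diff_le_self \<tau>(2))
  also have "\<dots> = real A * (real Q + 1) ^ b * \<tau> Q" by (simp add: add.commute)
  finally show ?case using step by simp
qed

lemma summable_power_exp:
  fixes c :: real
  assumes "c > 0"
  shows "summable (\<lambda>q. real A * (real q + 1) ^ b * (B * real q ^ e * exp (- c * real q)))"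
proof (rule summable_comparison_test_bigo)
  show "summable (\<lambda>q. norm (1 / real q ^ 2))"
    using inverse_power_summable[of 2, where 'a = real] by (simp add: divide_inverse)
  show "(\<lambda>q. real A * (real q + 1) ^ b * (B * real q ^ e * exp (- c * real q))) \<in> O(\<lambda>q. 1 / real q ^ 2)"
    using assms by real_asymp
qed

text \<open>Here \<open>s\<close> will be a small power of the norm of \<open>x\<close>; three error
  terms of this shape share the allowance \<open>exp (- s)\<close>.\<close>

lemma eventually_power_exp_square_le:
  fixes c C :: real
  assumes "c > 0"
  shows "eventually (\<lambda>s. C * s ^ k * exp (- c * s ^ 2) \<le> exp (- s) / 3) at_top"
  using assms by real_asymp

context independent_simple_random_walks
begin

text \<open>Translation invariance: the assumed tail holds for every family of walks on
  \<open>M\<close>, in particular for the family translated by \<open>x\<close>.\<close>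

lemma prob_neighbour_gt_le:
  assumes tail: "\<And>(S :: int ^ 'd \<Rightarrow> nat \<Rightarrow> 'w \<Rightarrow> int ^ 'd) y. independent_simple_random_walks M S \<Longrightarrow> l1_norm y \<le> 1 \<Longrightarrow>
      measure M (slow_passage M S 0 y m) \<le> \<tau>"
    and "l1_norm (y - x) \<le> 1"
  shows "prob (slow_passage M S x y m) \<le> \<tau>"
proof -
  let ?S = "\<lambda>y j \<omega>. S (y + x) j \<omega> - x"
  interpret sh: independent_simple_random_walks M ?S by (rule shift)
  have "first_passage_time S \<omega> x y \<le> first_passage_time ?S \<omega> 0 (y - x)" for \<omega>
    using first_passage_time_shift_le[of S \<omega> x "y - x"] by simp
  then have "prob (slow_passage M S x y m)
      \<le> prob (slow_passage M ?S 0 (y - x) m)"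
    by (intro finite_measure_mono sh.first_passage_time_gt_events) (auto dest: order_trans)
  also have "\<dots> \<le> \<tau>" by (rule tail[OF shift assms(2)])
  finally show ?thesis .
qed

text \<open>There are only countably many lists of lattice points, and each optimality condition is
  a countable combination of threshold events.\<close>

lemma optimal_lengths_between_events:
  "{\<omega> \<in> space M. optimal_lengths_between S \<omega> x a b} \<in> events"
proof -
  have eq_ev: "{\<omega> \<in> space M. first_passage_time S \<omega> 0 x = chain_time S \<omega> \<gamma>} \<in> events" for \<gamma>
  proof -
    have "{\<omega> \<in> space M. first_passage_time S \<omega> 0 x = chain_time S \<omega> \<gamma>}
        = {\<omega> \<in> space M. \<forall>m. first_passage_time S \<omega> 0 x \<le> enat m \<longleftrightarrow> chain_time S \<omega> \<gamma> \<le> enat m}"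
      by (simp add: enat_eq_iff_le)
    also have "\<dots> \<in> events"
      unfolding iff_conv_conj_imp
      by (intro sets.sets_Collect_countable_All sets.sets_Collect_conj sets.sets_Collect_imp
          first_passage_time_le_events chain_time_le_events)
    finally show ?thesis .
  qed
  have "{\<omega> \<in> space M. optimal_lengths_between S \<omega> x a b}
      = {\<omega> \<in> space M. \<forall>\<gamma>. first_passage_time S \<omega> 0 x = chain_time S \<omega> \<gamma> \<longrightarrow>
          (is_path \<gamma> \<and> hd \<gamma> = 0 \<and> last \<gamma> = x \<longrightarrow> a \<le> real (length \<gamma>) \<and> real (length \<gamma>) \<le> b)}"
    by (auto simp: optimal_lengths_between_iff optimal_paths_def)
  also have "\<dots> \<in> events"
    by (intro sets.sets_Collect_countable_All sets.sets_Collect_imp eq_ev) auto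
  finally show ?thesis .
qed

text \<open>If the passage takes time at most \<open>H\<close>, every optimal path is a chain of
  duration at most \<open>H\<close>: it has at most \<open>H + 1\<close> vertices, and fewer than
  \<open>a\<close> would make it a quick short path.\<close>

lemma prob_optimal_lengths_between_ge:
  assumes T: "prob (slow_passage M S 0 x H) \<le> p1"
    and short: "prob (quick_path M S x a H) \<le> p2"
    and b: "real H + 1 \<le> b"
  shows "prob {\<omega> \<in> space M. optimal_lengths_between S \<omega> x a b} \<ge> 1 - p1 - p2"
proof -
  define E1 where "E1 = (slow_passage M S 0 x H)"
  define E2 where "E2 = (quick_path M S x a H)"
  have E1: "E1 \<in> events" unfolding E1_def by (rule first_passage_time_gt_events)
  have E2: "E2 \<in> events"
  proof -
    have "E2 = (\<Union>ys\<in>{ys. ys \<noteq> [] \<and> distinct ys \<and> hd ys = 0 \<and> last ys = x \<and> real (length ys) < a}.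
        {\<omega> \<in> space M. chain_time S \<omega> ys \<le> enat H})" by (auto simp: E2_def)
    then show ?thesis using chain_time_le_events by (auto intro: sets.countable_UN')
  qed
  have "space M - {\<omega> \<in> space M. optimal_lengths_between S \<omega> x a b} \<subseteq> E1 \<union> E2"
  proof (rule subsetI, rule ccontr)
    fix \<omega> assume \<omega>: "\<omega> \<in> space M - {\<omega> \<in> space M. optimal_lengths_between S \<omega> x a b}" and not: "\<omega> \<notin> E1 \<union> E2"
    have "a \<le> real (length \<gamma>) \<and> real (length \<gamma>) \<le> b" if "\<gamma> \<in> optimal_paths S \<omega> 0 x" for \<gamma>
    proof
      have \<gamma>: "\<gamma> \<noteq> []" "distinct \<gamma>" "hd \<gamma> = 0" "last \<gamma> = x" "chain_time S \<omega> \<gamma> \<le> enat H"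
        using that \<omega> not by (auto simp: optimal_paths_def is_path_def E1_def)
      then show "a \<le> real (length \<gamma>)" using \<omega> not by (force simp: E2_def)
      have "enat (length \<gamma>) \<le> chain_time S \<omega> \<gamma> + 1"
        using \<gamma> \<omega> start by (intro length_le_chain_time) auto
      also have "\<dots> \<le> enat H + 1" using \<gamma>(5) by (intro add_mono) auto
      finally have "length \<gamma> \<le> H + 1" by (simp add: one_enat_def)
      then show "real (length \<gamma>) \<le> b" using b by linarith
    qed
    then have "optimal_lengths_between S \<omega> x a b" by (simp add: optimal_lengths_between_iff)
    then show False using \<omega> by blast
  qed
  then have "prob (space M - {\<omega> \<in> space M. optimal_lengths_between S \<omega> x a b}) \<le> prob (E1 \<union> E2)"
    using E1 E2 by (intro finite_measure_mono) auto
  also have "\<dots> \<le> prob E1 + prob E2" using E1 E2 by (rule measure_Un_le)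
  also have "\<dots> \<le> p1 + p2" using T short by (simp add: E1_def E2_def)
  finally show ?thesis using prob_compl[OF optimal_lengths_between_events, of x a b] by simp
qed

end

text \<open>The first bound has the slope \<open>\<mu> + 1\<close>, independent of \<open>Q\<close>,
  which can thus grow with \<open>x\<close>. The second has slope \<open>A * Q ^ b\<close> but no
  lower bound on the norm of \<open>x\<close>, and will be used with one fixed
  \<open>Q\<close>.\<close>

lemma ex_passage_tail:
  assumes d: "CARD('d::finite) \<ge> 2"
  shows "\<exists>\<mu> A b e q0 :: nat. \<exists>B c :: real. c > 0 \<and> A \<ge> 1 \<and> b \<ge> 1 \<and> B \<ge> 0 \<and>
    (\<forall>(M :: 'w measure) (S :: int ^ 'd \<Rightarrow> nat \<Rightarrow> 'w \<Rightarrow> int ^ 'd).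
      independent_simple_random_walks M S \<longrightarrow> (\<forall>x. \<forall>Q\<ge>q0.
        (1 \<le> A * Q ^ b \<longrightarrow> 2 * (A * Q ^ b) + 1 \<le> nat (l1_norm x) \<longrightarrow>
          measure M (slow_passage M S 0 x ((\<mu> + 1) * nat (l1_norm x)))
          \<le> real (nat (l1_norm x)) * (B * real Q ^ e * exp (- c * real Q)) + real (2 * (A * Q ^ b) + 1) *
            exp (- 2 * real (nat (l1_norm x) div (2 * (A * Q ^ b) + 1)) / real (A * Q ^ b) ^ 2)) \<and>
        measure M (slow_passage M S 0 x (nat (l1_norm x) * (A * Q ^ b)))
          \<le> real (nat (l1_norm x)) * (B * real Q ^ e * exp (- c * real Q))))"
  using ex_neighbour_tail[OF d, where 'w = 'w]
proof (elim exE conjE, goal_cases)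
  case (1 A b e B0 c q0)
  note c = 1(1-3) and tail0 = 1(4)
  define B where "B = \<bar>B0\<bar>"
  define \<tau> where "\<tau> q = B * real q ^ e * exp (- c * real q)" for q :: nat
  have \<tau>: "0 \<le> \<tau> q" for q by (simp add: \<tau>_def B_def)
  have tail: "measure M (slow_passage M S 0 y (A * q ^ b)) \<le> \<tau> q"
    if "q \<ge> q0" "independent_simple_random_walks M S" "l1_norm y \<le> 1"
    for q and M :: "'w measure" and S :: "int ^ 'd \<Rightarrow> nat \<Rightarrow> 'w \<Rightarrow> int ^ 'd" and y
  proof -
    have "measure M (slow_passage M S 0 y (A * q ^ b))
        \<le> B0 * real q ^ e * exp (- c * real q)"
      using tail0 that by blast
    also have "\<dots> \<le> \<tau> q" unfolding \<tau>_def B_def by (intro mult_right_mono) auto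
    finally show ?thesis .
  qed
  let ?f = "\<lambda>q. real A * (real q + 1) ^ b * \<tau> q"
  have sum_f: "summable ?f"
    unfolding \<tau>_def by (rule summable_power_exp[OF c(1)])
  \<comment> \<open>An upper bound, uniform in the truncation level, for the mean truncated passage
    time to a neighbour.\<close>
  define \<mu> where "\<mu> = nat \<lceil>real (A * q0 ^ b) + suminf ?f\<rceil>"
  have \<mu>: "real (A * q0 ^ b) + suminf ?f \<le> real \<mu>" unfolding \<mu>_def by linarith
  have main: "(1 \<le> A * Q ^ b \<longrightarrow> 2 * (A * Q ^ b) + 1 \<le> nat (l1_norm x) \<longrightarrow>
          measure M (slow_passage M S 0 x ((\<mu> + 1) * nat (l1_norm x)))
          \<le> real (nat (l1_norm x)) * \<tau> Q + real (2 * (A * Q ^ b) + 1) *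
            exp (- 2 * real (nat (l1_norm x) div (2 * (A * Q ^ b) + 1)) / real (A * Q ^ b) ^ 2)) \<and>
        measure M (slow_passage M S 0 x (nat (l1_norm x) * (A * Q ^ b)))
          \<le> real (nat (l1_norm x)) * \<tau> Q"
    if ind: "independent_simple_random_walks M S" and Q: "Q \<ge> q0"
    for M :: "'w measure" and S :: "int ^ 'd \<Rightarrow> nat \<Rightarrow> 'w \<Rightarrow> int ^ 'd" and x Q
  proof -
    interpret independent_simple_random_walks M S by (rule ind)
    define n where "n = nat (l1_norm x)"
    obtain g :: "nat \<Rightarrow> int ^ 'd" where g: "g 0 = 0" "g n = x"
      "\<And>i. i < n \<Longrightarrow> l1_norm (g (Suc i) - g i) = 1" "\<And>i. i \<le> n \<Longrightarrow> l1_norm (g i) = int i"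
      unfolding n_def by (rule ex_geodesic[of x]) blast
    define P where "P i m = prob (slow_passage M S (g i) (g (Suc i)) m)" for i m
    have P_le: "P i (A * q ^ b) \<le> \<tau> q" if "i < n" "q \<ge> q0" for i q
      unfolding P_def using g(3)[OF that(1)] tail[OF that(2)] by (intro prob_neighbour_gt_le) auto
    have P_mono: "P i m' \<le> P i m" if "m \<le> m'" for i m m'
    proof -
      have le: "enat m \<le> enat m'" using that by simp
      show ?thesis unfolding P_def
        by (intro finite_measure_mono first_passage_time_gt_events) (use order_trans[OF _ le] in blast)
    qed
    have sum_P: "(\<Sum>m<A * Q ^ b. P i m) \<le> real \<mu>" if "i < n" for i
    proof -
      have "(\<Sum>m<A * Q ^ b. P i m) \<le> real (A * q0 ^ b) + (\<Sum>q<Q. ?f q)"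
      proof (rule sum_tail_le)
        show "P i m' \<le> P i m" if "m \<le> m'" for m m' using that by (rule P_mono)
        show "P i (A * q ^ b) \<le> \<tau> q" if "q \<ge> q0" for q using \<open>i < n\<close> that by (rule P_le)
      qed (use \<tau> Q in \<open>simp_all add: P_def\<close>)
      also have "(\<Sum>q<Q. ?f q) \<le> suminf ?f"
        using sum_f \<tau> by (intro sum_le_suminf) auto
      finally show ?thesis using \<mu> by linarith
    qed
    have "prob (slow_passage M S 0 (g n) ((\<mu> + 1) * n))
        \<le> real n * \<tau> Q + real (2 * (A * Q ^ b) + 1) * exp (- 2 * real (n div (2 * (A * Q ^ b) + 1)) / real (A * Q ^ b) ^ 2)"
      if "1 \<le> A * Q ^ b" "2 * (A * Q ^ b) + 1 \<le> n"
      using g(1,4) sum_P P_le[OF _ Q] that unfolding P_def by (intro prob_passage_along_geodesic_le) auto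
    moreover have "prob (slow_passage M S 0 (g n) (n * (A * Q ^ b))) \<le> real n * \<tau> Q"
      using g(1) P_le[OF _ Q] unfolding P_def by (intro prob_passage_gt_le) auto
    ultimately show ?thesis unfolding n_def[symmetric] g(2) by blast
  qed
  show ?thesis
    by (rule exI[of _ \<mu>], rule exI[of _ A], rule exI[of _ b], rule exI[of _ e], rule exI[of _ q0],
        rule exI[of _ B], rule exI[of _ c], intro conjI c allI impI)
      (use main in \<open>simp_all add: \<tau>_def B_def\<close>)
qed

section \<open>Choice of constants and conclusion\<close>

lemma half_le_nat_div:
  fixes n L :: nat
  assumes "1 \<le> L" "L \<le> n"
  shows "real n / (2 * real L) \<le> real (n div L)"
proof -
  have "n < L * (n div L) + L"
    using assms(1) dividend_less_times_div[of L n] by (simp add: add.commute)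
  moreover have "L \<le> L * (n div L)" using assms by (simp add: div_greater_zero_iff Suc_le_eq)
  ultimately have "n \<le> 2 * (L * (n div L))" by linarith
  then have "real n \<le> 2 * (real L * real (n div L))" by (metis of_nat_le_iff of_nat_mult of_nat_numeral)
  then show ?thesis using assms by (simp add: field_simps)
qed

theorem proposition1p2:
  assumes "CARD('d::finite) \<ge> 2"
  shows "\<exists>\<epsilon>>0. \<exists>c>0. \<exists>C>0.
    \<forall>(M :: 'w measure) (S :: int ^ 'd \<Rightarrow> nat \<Rightarrow> 'w \<Rightarrow> int ^ 'd).
      independent_simple_random_walks M S \<longrightarrow>
      (\<forall>x :: int ^ 'd.
        \<P>(\<omega> in M. optimal_lengths_between S \<omega> x
            (c * real_of_int (l1_norm x)) (C * real_of_int (l1_norm x)))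
          \<ge> 1 - exp (- (real_of_int (l1_norm x) powr \<epsilon>)))"
  using ex_passage_tail[OF assms, where 'w = 'w]
proof (elim exE conjE, goal_cases)
  case (1 \<mu> A b e q0 B c)
  note c = 1(1-4) and tail = 1(5)
  \<comment> \<open>With \<open>n\<close> the norm of \<open>x\<close>,
    \<open>s = n powr \<epsilon>\<close> and \<open>Q\<close> about \<open>s ^ 2\<close>, the
    truncation level \<open>A * Q ^ b\<close> is of order \<open>s ^ (2 * b)\<close>, which is the
    fourth root of \<open>n\<close>.\<close>
  define \<epsilon> where "\<epsilon> = 1 / (8 * real b)"
  \<comment> \<open>Minimises \<open>l ^ 2 * (\<mu> + 1) * n - l * n\<close>, the exponent of the
    short-path bound at \<open>H = (\<mu> + 1) * n\<close>; the minimum is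
    \<open>- l * n / 2\<close>.\<close>
  define l where "l = 1 / (2 * (real \<mu> + 1))"
  define Z :: real where "Z = 2 ^ CARD('d) / (1 - exp (- l\<^sup>2 / 2))"
  have \<epsilon>: "\<epsilon> > 0" "\<epsilon> \<le> 1" using c(3) by (simp_all add: \<epsilon>_def field_simps)
  have l: "l > 0" by (simp add: l_def)
  have Z: "Z > 1"
  proof -
    define t where "t = exp (- l\<^sup>2 / 2)"
    have t: "0 < t" "t < 1" using l by (simp_all add: t_def)
    have "1 \<le> (2 :: real) ^ CARD('d)" by (intro one_le_power) simp
    then have "1 - t < 2 ^ CARD('d)" using t by linarith
    then have "1 < 2 ^ CARD('d) / (1 - t)" using t by (subst less_divide_eq_1_pos) auto
    then show ?thesis by (simp only: Z_def t_def)
  qed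
  then have lnZ: "ln Z > 0" by simp
  \<comment> \<open>With at most \<open>c3 * n\<close> hops the factor \<open>Z ^ m\<close> is at
    most \<open>exp (l * n / 4)\<close>, half of the available decay.\<close>
  define c3 where "c3 = l / (4 * ln Z)"
  have c3: "c3 > 0" using l lnZ by (simp add: c3_def)
  have "\<forall>\<^sub>F s in at_top. B * exp c * s ^ (8 * b + 2 * e) * exp (- c * s ^ 2) \<le> exp (- s) / 3"
    by (rule eventually_power_exp_square_le[OF c(1)])
  moreover have "\<forall>\<^sub>F s in at_top. 3 * real A * s ^ (2 * b) * exp (- (1 / (3 * real A ^ 3)) * s ^ 2) \<le> exp (- s) / 3"
    by (rule eventually_power_exp_square_le) (use c(2) in simp)
  moreover have "\<forall>\<^sub>F s in at_top. (c3 + 1) * s ^ (8 * b) * exp (- (l / 4) * s ^ 2) \<le> exp (- s) / 3"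
    by (rule eventually_power_exp_square_le) (use l in simp)
  moreover have "\<forall>\<^sub>F s in at_top. s \<ge> 3 * real A + real q0 + 2"
    by (rule eventually_ge_at_top)
  ultimately have "\<forall>\<^sub>F s in at_top. B * exp c * s ^ (8 * b + 2 * e) * exp (- c * s ^ 2) \<le> exp (- s) / 3 \<and>
      3 * real A * s ^ (2 * b) * exp (- (1 / (3 * real A ^ 3)) * s ^ 2) \<le> exp (- s) / 3 \<and>
      (c3 + 1) * s ^ (8 * b) * exp (- (l / 4) * s ^ 2) \<le> exp (- s) / 3 \<and> s \<ge> 3 * real A + real q0 + 2"
    by (intro eventually_conj)
  \<comment> \<open>In this order the bounds serve a slow neighbour passage, the Hoeffding term and
    a quick path with few vertices.\<close>
  then obtain s0 where s0: "\<And>s. s \<ge> s0 \<Longrightarrow>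
      B * exp c * s ^ (8 * b + 2 * e) * exp (- c * s ^ 2) \<le> exp (- s) / 3 \<and>
      3 * real A * s ^ (2 * b) * exp (- (1 / (3 * real A ^ 3)) * s ^ 2) \<le> exp (- s) / 3 \<and>
      (c3 + 1) * s ^ (8 * b) * exp (- (l / 4) * s ^ 2) \<le> exp (- s) / 3 \<and> s \<ge> 3 * real A + real q0 + 2"
    by (auto simp: eventually_at_top_linorder)
  \<comment> \<open>From \<open>n0\<close> on, the \<open>8 * b\<close>-th root of the norm is at
    least \<open>s0\<close>.\<close>
  define n0 where "n0 = nat \<lceil>max 1 s0 ^ (8 * b)\<rceil> + 1"
  have n0: "n0 \<ge> 1" "max 1 s0 ^ (8 * b) \<le> real n0" unfolding n0_def by linarith+
  have "(\<lambda>Q. real n0 * (B * real Q ^ e * exp (- c * real Q))) \<longlonglongrightarrow> 0"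
    using c(1) by real_asymp
  then have "\<forall>\<^sub>F Q in sequentially. real n0 * (B * real Q ^ e * exp (- c * real Q)) < exp (- real n0)"
    by (rule order_tendstoD) simp
  \<comment> \<open>A fixed scale for all norms from 1 to below \<open>n0\<close>: there the failure
    probability is at most \<open>exp (- n0)\<close>, which is below the allowance.\<close>
  then obtain Q1 where Q1: "Q1 \<ge> q0" "real n0 * (B * real Q1 ^ e * exp (- c * real Q1)) \<le> exp (- real n0)"
    unfolding eventually_sequentially by (meson le_cases less_imp_le)
  \<comment> \<open>The bound \<open>1 / n0\<close> makes the required lower length at most 1 for
    norms below \<open>n0\<close>, where every path satisfies it.\<close>
  define cc where "cc = min c3 (1 / real n0)"
  \<comment> \<open>Covers \<open>H + 1\<close> vertices in both regimes:
    \<open>H = (\<mu> + 1) * n\<close> for large norms and \<open>H = n * (A * Q1 ^ b)\<close> for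
    small ones.\<close>
  define C where "C = max (real \<mu> + 2) (real (A * Q1 ^ b) + 1)"
  have cc: "cc > 0" "cc \<le> c3" "cc \<le> 1 / real n0" using c3 n0 by (auto simp: cc_def)
  have C: "C > 0" "real \<mu> + 2 \<le> C" "real (A * Q1 ^ b) + 1 \<le> C" by (auto simp: C_def)
  have main: "measure M {\<omega> \<in> space M. optimal_lengths_between S \<omega> x
        (cc * real_of_int (l1_norm x)) (C * real_of_int (l1_norm x))}
      \<ge> 1 - exp (- (real_of_int (l1_norm x) powr \<epsilon>))"
    if ind: "independent_simple_random_walks M S"
    for M :: "'w measure" and S :: "int ^ 'd \<Rightarrow> nat \<Rightarrow> 'w \<Rightarrow> int ^ 'd" and x
  proof -
    interpret independent_simple_random_walks M S by (rule ind)
    define n where "n = nat (l1_norm x)"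
    have nx: "real_of_int (l1_norm x) = real n" by (simp add: n_def)
    consider "n = 0" | "1 \<le> n" "n < n0" | "n0 \<le> n" by linarith
    then show ?thesis
    proof cases
      case 1
      \<comment> \<open>For \<open>x = 0\<close> the right-hand side is 0, since
        \<open>0 powr \<epsilon> = 0\<close>.\<close>
      then show ?thesis by (simp add: nx)
    next
      case 2
      have "prob (slow_passage M S 0 x (n * (A * Q1 ^ b))) \<le> exp (- (real n powr \<epsilon>))"
      proof -
        have "prob (slow_passage M S 0 x (n * (A * Q1 ^ b)))
            \<le> real n * (B * real Q1 ^ e * exp (- c * real Q1))"
          using tail ind Q1(1) unfolding n_def by blast
        also have "\<dots> \<le> real n0 * (B * real Q1 ^ e * exp (- c * real Q1))"
          using 2 c(4) by (intro mult_right_mono) auto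
        also have "\<dots> \<le> exp (- real n0)" by (rule Q1(2))
        also have "\<dots> \<le> exp (- (real n powr \<epsilon>))"
        proof -
          have "real n powr \<epsilon> \<le> real n powr 1" using 2 \<epsilon> by (intro powr_mono) auto
          then show ?thesis using 2 by simp
        qed
        finally show ?thesis .
      qed
      moreover have "prob (quick_path M S x (cc * real n) (n * (A * Q1 ^ b))) \<le> 0"
      proof -
        have "cc * real n \<le> 1 / real n0 * real n0" using cc 2 n0 by (intro mult_mono) auto
        then have "cc * real n \<le> 1" using n0 by simp
        moreover have "1 \<le> real (length ys)" if "ys \<noteq> []" for ys :: "(int ^ 'd) list"
          using that by (cases ys) auto
        ultimately have "\<not> real (length ys) < cc * real n" if "ys \<noteq> []" for ys :: "(int ^ 'd) list"
          using that by fastforce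
        then have "(quick_path M S x (cc * real n) (n * (A * Q1 ^ b))) = {}" by blast
        then show ?thesis by (simp only: measure_empty)
      qed
      moreover have "real (n * (A * Q1 ^ b)) + 1 \<le> C * real n"
      proof -
        have "real (n * (A * Q1 ^ b)) + 1 \<le> (real (A * Q1 ^ b) + 1) * real n"
          using 2 by (simp add: algebra_simps)
        also have "\<dots> \<le> C * real n" using C by (intro mult_right_mono) auto
        finally show ?thesis .
      qed
      ultimately show ?thesis
        unfolding nx using prob_optimal_lengths_between_ge by fastforce
    next
      case 3
      define s where "s = real n powr \<epsilon>"
      have n1: "1 \<le> n" using 3 n0 by simp
      have sn: "s ^ (8 * b) = real n"
        using n1 c(3) by (simp add: s_def powr_power \<epsilon>_def)
      have "s \<ge> s0"
      proof (rule ccontr)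
        assume "\<not> s0 \<le> s"
        then have "s ^ (8 * b) < max 1 s0 ^ (8 * b)"
          using c(3) by (intro power_strict_mono) (auto simp: s_def)
        then show False using n0 3 sn by linarith
      qed
      from s0[OF this] have e1: "B * exp c * s ^ (8 * b + 2 * e) * exp (- c * s ^ 2) \<le> exp (- s) / 3"
        and e2: "3 * real A * s ^ (2 * b) * exp (- (1 / (3 * real A ^ 3)) * s ^ 2) \<le> exp (- s) / 3"
        and e3: "(c3 + 1) * s ^ (8 * b) * exp (- (l / 4) * s ^ 2) \<le> exp (- s) / 3"
        and s_ge: "s \<ge> 3 * real A + real q0 + 2" by blast+
      have s1: "s \<ge> 1" using s_ge by linarith
      have ss: "s \<le> s ^ 2" using s1 by (intro self_le_power) auto
      define w where "w = s ^ (2 * b)"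
      have sw: "s ^ 2 \<le> w" unfolding w_def using s1 c(3) by (intro power_increasing) auto
      have wn: "w ^ 4 = real n" using sn by (simp add: w_def power_mult[symmetric] mult.commute mult.left_commute)
      have w1: "w \<ge> 1" "w \<ge> 3 * real A" using sw ss s1 s_ge by linarith+
      define Q where "Q = nat \<lfloor>s ^ 2\<rfloor>"
      have Q: "real Q \<le> s ^ 2" "s ^ 2 - 1 \<le> real Q" unfolding Q_def using s1 by (simp, linarith)
      have Qq: "Q \<ge> q0" "Q \<ge> 1"
      proof -
        have "real q0 + 1 \<le> real Q" using Q(2) ss s_ge by linarith
        then show "Q \<ge> q0" "Q \<ge> 1" by linarith+
      qed
      define h where "h = A * Q ^ b"
      have h1: "h \<ge> 1" unfolding h_def using c(2) Qq(2) by (simp add: Suc_le_eq)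
      have hw: "real h \<le> real A * w"
      proof -
        have "real Q ^ b \<le> (s ^ 2) ^ b" using Q(1) by (intro power_mono) auto
        then show ?thesis unfolding h_def w_def power_mult by (simp add: mult_left_mono)
      qed
      have Lw: "real (2 * h + 1) \<le> 3 * real A * w"
      proof -
        have "1 * 1 \<le> real A * w" using c(2) w1 by (intro mult_mono) auto
        then show ?thesis using hw by simp
      qed
      have Ln: "2 * h + 1 \<le> n"
      proof -
        have "3 * real A * w \<le> w * w" using w1 by (intro mult_right_mono) auto
        also have "\<dots> \<le> w ^ 4" using w1 power_increasing[of 2 4 w] by (simp add: power2_eq_square)
        finally show ?thesis using Lw wn by linarith
      qed
      have T: "prob (slow_passage M S 0 x ((\<mu> + 1) * n)) \<le> 2 * (exp (- s) / 3)"
      proof -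
        have "prob (slow_passage M S 0 x ((\<mu> + 1) * n))
          \<le> real n * (B * real Q ^ e * exp (- c * real Q)) +
            real (2 * h + 1) * exp (- 2 * real (n div (2 * h + 1)) / real h ^ 2)"
          using tail ind Qq(1) h1 Ln unfolding n_def h_def by blast
        moreover have "real n * (B * real Q ^ e * exp (- c * real Q)) \<le> exp (- s) / 3"
        proof -
          have "real Q ^ e \<le> (s ^ 2) ^ e" using Q(1) by (intro power_mono) auto
          moreover have "exp (- c * real Q) \<le> exp (c - c * s ^ 2)"
            using mult_left_mono[OF Q(2), of c] c(1) by (simp add: algebra_simps)
          ultimately have "real n * (B * real Q ^ e * exp (- c * real Q)) \<le> real n * (B * (s ^ 2) ^ e * exp (c - c * s ^ 2))"
            using c(4) by (intro mult_left_mono mult_mono) auto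
          also have "\<dots> = B * exp c * s ^ (8 * b + 2 * e) * exp (- c * s ^ 2)"
          proof -
            have "(s ^ 2) ^ e = s ^ (2 * e)" by (simp add: power_mult)
            moreover have "exp (c - c * s ^ 2) = exp c * exp (- c * s ^ 2)" by (simp add: exp_add[symmetric])
            ultimately show ?thesis by (simp only: sn[symmetric] power_add mult_ac)
          qed
          finally show ?thesis using e1 by linarith
        qed
        moreover have "real (2 * h + 1) * exp (- 2 * real (n div (2 * h + 1)) / real h ^ 2) \<le> exp (- s) / 3"
        proof -
          \<comment> \<open>As \<open>n = w ^ 4\<close> while \<open>h\<close> and
            \<open>2 * h + 1\<close> are at most of order \<open>w\<close>, the Hoeffding exponent
            is at least of order \<open>w\<close>, which dominates \<open>s ^ 2\<close>.\<close>
          have "w / (3 * real A ^ 3) \<le> 2 * real (n div (2 * h + 1)) / real h ^ 2"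
          proof -
            have "w / (3 * real A ^ 3) = w ^ 4 / (3 * real A * w) / (real A * w) ^ 2"
              using w1 c(2) by (simp add: field_simps power2_eq_square power3_eq_cube power4_eq_xxxx)
            also have "\<dots> \<le> real n / real (2 * h + 1) / real h ^ 2"
              unfolding wn using hw Lw h1 w1 c(2)
              by (intro frac_le divide_left_mono power_mono mult_pos_pos divide_nonneg_nonneg) auto
            also have "\<dots> = 2 * (real n / (2 * real (2 * h + 1))) / real h ^ 2"
            proof -
              have "a / t = 2 * (a / (2 * t))" for a t :: real by simp
              then show ?thesis by (rule arg_cong)
            qed
            also have "\<dots> \<le> 2 * real (n div (2 * h + 1)) / real h ^ 2"
              using half_le_nat_div[of "2 * h + 1" n] Ln by (intro divide_right_mono mult_left_mono) auto
            finally show ?thesis .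
          qed
          moreover have "s ^ 2 / (3 * real A ^ 3) \<le> w / (3 * real A ^ 3)" using sw by (intro divide_right_mono) auto
          ultimately have "exp (- 2 * real (n div (2 * h + 1)) / real h ^ 2) \<le> exp (- (1 / (3 * real A ^ 3)) * s ^ 2)"
            by simp
          then have "real (2 * h + 1) * exp (- 2 * real (n div (2 * h + 1)) / real h ^ 2)
              \<le> 3 * real A * w * exp (- (1 / (3 * real A ^ 3)) * s ^ 2)"
            using Lw w1 by (intro mult_mono) auto
          then show ?thesis using e2 unfolding w_def by linarith
        qed
        ultimately show ?thesis by linarith
      qed
      define m where "m = nat \<lfloor>c3 * real n\<rfloor>"
      have m: "real m \<le> c3 * real n" unfolding m_def using c3 by simp
      have "cc * real n \<le> c3 * real n" using cc by (intro mult_right_mono) auto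
      then have "cc * real n \<le> real m + 2" unfolding m_def by linarith
      then have "prob (quick_path M S x (cc * real n) ((\<mu> + 1) * n))
          \<le> real (Suc m) * Z ^ m * exp (l\<^sup>2 * real ((\<mu> + 1) * n) - l * real n)"
        using prob_short_path_le[OF l, of _ m x "(\<mu> + 1) * n"] by (simp only: Z_def nx)
      also have "\<dots> \<le> ((c3 + 1) * real n) * exp (l * real n / 4) * exp (- (l * real n / 2))"
      proof (intro mult_mono)
        have "c3 * real n + 1 \<le> (c3 + 1) * real n" using n1 by (simp add: algebra_simps)
        then show "real (Suc m) \<le> (c3 + 1) * real n" using m by simp
        have "Z ^ m = exp (real m * ln Z)" using Z by (simp add: exp_of_nat_mult)
        also have "\<dots> \<le> exp (c3 * real n * ln Z)" using m lnZ by (simp add: mult_right_mono)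
        also have "c3 * real n * ln Z = l * real n / 4" using lnZ by (simp add: c3_def)
        finally show "Z ^ m \<le> exp (l * real n / 4)" .
        have "l\<^sup>2 * real ((\<mu> + 1) * n) = l * real n / 2"
        proof -
          have half: "l * (real \<mu> + 1) = 1 / 2" by (simp add: l_def)
          have "l\<^sup>2 * real ((\<mu> + 1) * n) = l * real n * (l * (real \<mu> + 1))"
            by (simp add: power2_eq_square algebra_simps)
          then show ?thesis by (simp only: half)
        qed
        then show "exp (l\<^sup>2 * real ((\<mu> + 1) * n) - l * real n) \<le> exp (- (l * real n / 2))"
          by simp
      qed (use c3 Z in auto)
      also have "\<dots> = (c3 + 1) * real n * exp (- (l / 4) * real n)"
        by (simp add: exp_add[symmetric] mult.assoc)
      also have "\<dots> \<le> (c3 + 1) * real n * exp (- (l / 4) * s ^ 2)"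
      proof -
        have "s ^ 2 \<le> real n"
          unfolding sn[symmetric] using s1 c(3) by (intro power_increasing) auto
        then show ?thesis using l c3 by (intro mult_left_mono) (auto simp: mult_left_mono)
      qed
      also have "\<dots> \<le> exp (- s) / 3" using e3 unfolding sn .
      finally have short: "prob (quick_path M S x (cc * real n) ((\<mu> + 1) * n)) \<le> exp (- s) / 3" .
      have "real ((\<mu> + 1) * n) + 1 \<le> C * real n"
      proof -
        have "real ((\<mu> + 1) * n) + 1 \<le> (real \<mu> + 2) * real n" using n1 by (simp add: algebra_simps)
        also have "\<dots> \<le> C * real n" using C by (intro mult_right_mono) auto
        finally show ?thesis .
      qed
      from prob_optimal_lengths_between_ge[OF T short this] show ?thesis
        unfolding nx by (simp add: s_def)
    qed
  qed
  show ?thesis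
    by (rule exI[of _ \<epsilon>], rule conjI, rule \<epsilon>(1), rule exI[of _ cc], rule conjI, rule cc(1),
        rule exI[of _ C], rule conjI, rule C(1)) (intro allI impI main)
qed

end
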